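(* The following function is in $\#\mathrm{P}$: given codes $\mathbf{v},\mathbf{w}\in\mathbb{N}^m$ in unary with $\mathbf{v}\le\mathbf{w}$ in the Bruhat order, and a point $\mathbf{a}$ of nonnegative integers (one coordinate per variable) in binary, output $Y_{\mathbf{w}/\mathbf{v}}(\mathbf{a})$.
   Context: Lehmer code: for a permutation $\sigma\in S_N$ (written $\sigma(1)\sigma(2)\cdots\sigma(N)$, and identified with its extension to $S_M$, $M\ge N$, fixing $N+1,\dots,M$), its code is $(v_1,\dots,v_N)$ with $v_i=|\{j>i:\sigma(j)<\sigma(i)\}|$; this is a bijection between permutations and codes (codes identified with their extensions by trailing zeros), and $\langle\mathbf{v}\rangle$ denotes the permutation with code $\mathbf{v}$. The length $|\sigma|$ is the number of inversions of $\sigma$, which equals $|\mathbf{v}|=\sum_iv_i$. For $s<t$, $\sigma\tau_{st}$ denotes the permutation obtained from $\sigma$ by exchanging the values in positions $s$ and $t$. Bruhat order on $S_N$: the transitive closure of the covers $\sigma\lessdot\pi$, meaning $\pi=\sigma\tau_{st}$ for some $s<t$ and $|\pi|=|\sigma|+1$. Bruhat order on codes is inherited via $\langle\cdot\rangle$. Labeled Bruhat order: for each cover $\sigma\lessdot\pi$ with $\pi=\sigma\tau_{st}$, and each $j$ with $s\le j<t$, there is a directed edge $\sigma\to\pi$ labeled $(j,b)$ where $b=\sigma(s)=\pi(t)$. A chain $\sigma_0\xrightarrow{(j_1,b_1)}\sigma_1\to\cdots\xrightarrow{(j_\ell,b_\ell)}\sigma_\ell$ is increasing if its labels increase in lexicographic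 order. For a chain $C$, $\mathbf{e}(C)=(e_1,\dots,e_{N-1})$ with $e_i$ the number of labels with first coordinate $i$. For $\sigma\le\pi$ in $S_N$ the skew Schubert polynomial is $Y_{\pi/\sigma}(\mathbf{x})=\sum_C\mathbf{x}^{\mathbf{d}}/\mathbf{x}^{\mathbf{e}(C)}$, summing over all increasing chains $C$ from $\sigma$ to $\pi$, where $\mathbf{d}=(N-1,N-2,\dots,1)$; this is a polynomial in $x_1,\dots,x_{N-1}$. For codes, $Y_{\mathbf{w}/\mathbf{v}}:=Y_{\langle\mathbf{w}\rangle/\langle\mathbf{v}\rangle}$, computed in $S_N$ with $N=|\mathbf{w}|+m$ (large enough that $\langle\mathbf{v}\rangle,\langle\mathbf{w}\rangle\in S_N$). The output is a nonnegative integer. *)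

theory Defs
  imports
    "HOL-Computational_Algebra.Polynomial"
    "HOL-Combinatorics.Transposition"
    "HOL-Combinatorics.Permutations"
begin

section \<open>Turing machines, the class P and the class #P\<close>

text \<open>
  Deterministic machines with finitely many two-way infinite tapes. States and tape symbols are
  initial segments of the naturals; symbol 0 is the blank, 1 and 2 stand for the bits
  \<^term>\<open>False\<close> and \<^term>\<open>True\<close>, and further work symbols are allowed. Only the finitely many
  values of the transition function described in \<open>wf_tm\<close> are ever used.
\<close>

datatype move = Move_Left | Stay | Move_Right

record tm =
  ntapes :: nat
  nsyms :: nat
  nstates :: nat
  start :: nat
  accept :: nat
  reject :: nat
  delta :: "nat \<Rightarrow> nat list \<Rightarrow> nat \<times> (nat \<times> move) list"

definition wf_tm :: "tm \<Rightarrow> bool" where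
  "wf_tm M \<longleftrightarrow>
     ntapes M \<ge> 1 \<and> nsyms M \<ge> 3 \<and>
     start M < nstates M \<and> accept M < nstates M \<and> reject M < nstates M \<and>
     accept M \<noteq> reject M \<and>
     (\<forall>q ss. q < nstates M \<and> length ss = ntapes M \<and> (\<forall>s\<in>set ss. s < nsyms M) \<longrightarrow>
        (case delta M q ss of (q', acts) \<Rightarrow>
           q' < nstates M \<and> length acts = ntapes M \<and> (\<forall>(s, d)\<in>set acts. s < nsyms M)))"

text \<open>A tape consists of the contents of its cells and the position of the head.\<close>

type_synonym tape = "(int \<Rightarrow> nat) \<times> int"
type_synonym config = "nat \<times> tape list"

fun read_tape :: "tape \<Rightarrow> nat" where
  "read_tape (c, h) = c h"

fun move_head :: "move \<Rightarrow> int \<Rightarrow> int" where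
  "move_head Move_Left h = h - 1"
| "move_head Stay h = h"
| "move_head Move_Right h = h + 1"

fun act_tape :: "nat \<times> move \<Rightarrow> tape \<Rightarrow> tape" where
  "act_tape (s, d) (c, h) = (c(h := s), move_head d h)"

fun tm_step :: "tm \<Rightarrow> config \<Rightarrow> config" where
  "tm_step M (q, ts) =
     (if q = accept M \<or> q = reject M then (q, ts)
      else case delta M q (map read_tape ts) of (q', acts) \<Rightarrow> (q', map2 act_tape acts ts))"

definition input_tape :: "bool list \<Rightarrow> tape" where
  "input_tape x =
     ((\<lambda>i. if 0 \<le> i \<and> i < int (length x) then (if x ! nat i then 2 else 1) else 0), 0)"

definition init_config :: "tm \<Rightarrow> bool list \<Rightarrow> config" where
  "init_config M x = (start M, input_tape x # replicate (ntapes M - 1) (\<lambda>_. 0, 0))"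

text \<open>
  Halting configurations are fixed points of \<^const>\<open>tm_step\<close>, so looking at the state after
  exactly \<open>T (length x)\<close> steps says that the machine halts within that many steps.
\<close>

definition decides_in_time :: "tm \<Rightarrow> bool list set \<Rightarrow> (nat \<Rightarrow> nat) \<Rightarrow> bool" where
  "decides_in_time M L T \<longleftrightarrow>
     (\<forall>x. fst ((tm_step M ^^ T (length x)) (init_config M x)) =
            (if x \<in> L then accept M else reject M))"

definition class_P :: "bool list set set" where
  "class_P = {L. \<exists>M. wf_tm M \<and> (\<exists>p :: nat poly. decides_in_time M L (poly p))}"

text \<open>A self-delimiting form of a bit string, and the resulting pairing of two strings.\<close>

definition framed :: "bool list \<Rightarrow> bool list" where
  "framed bs = concat (map (\<lambda>b. [True, b]) bs) @ [False]"

definition pair_string :: "bool list \<Rightarrow> bool list \<Rightarrow> bool list" where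
  "pair_string x y = framed x @ y"

definition sharp_P :: "(bool list \<Rightarrow> nat) set" where
  "sharp_P = {f. \<exists>L\<in>class_P. \<exists>p :: nat poly. \<forall>x.
     f x = card {y. length y = poly p (length x) \<and> pair_string x y \<in> L}}"

text \<open>
  The string function belonging to a function \<open>F\<close> on a set \<open>D\<close> of instances with an injective
  encoding \<open>enc\<close>. Strings that encode no instance are given the value 0.
\<close>

definition string_function :: "('i \<Rightarrow> bool list) \<Rightarrow> 'i set \<Rightarrow> ('i \<Rightarrow> nat) \<Rightarrow> bool list \<Rightarrow> nat" where
  "string_function enc D F s = (if s \<in> enc ` D then F (inv_into D enc s) else 0)"


section \<open>Lehmer codes and the labeled Bruhat order\<close>

text \<open>
  An element of \<open>S\<^sub>N\<close> is a function \<open>\<sigma>\<close> with \<^term>\<open>\<sigma> permutes {1..N}\<close>; since such a function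
  fixes everything outside \<open>{1..N}\<close>, it is identified with its extensions to larger \<open>S\<^sub>M\<close>.
\<close>

type_synonym perm = "nat \<Rightarrow> nat"

definition lehmer :: "perm \<Rightarrow> nat \<Rightarrow> nat" where
  "lehmer \<sigma> i = card {j. i < j \<and> \<sigma> j < \<sigma> i}"

definition perm_of_code :: "nat list \<Rightarrow> perm" where
  "perm_of_code v =
     (THE \<sigma>. (\<exists>N. \<sigma> permutes {1..N}) \<and>
        (\<forall>i\<ge>1. lehmer \<sigma> i = (if i \<le> length v then v ! (i - 1) else 0)))"

text \<open>The Lehmer code is a bijection, so the definite description above is proper.\<close>

lemma code_perm_exists:
  "\<exists>\<sigma>. \<sigma> permutes {1..sum_list v + length v} \<and>
     (\<forall>i\<ge>1. lehmer \<sigma> i = (if i \<le> length v then v ! (i - 1) else 0))"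
proof (induction v)
  case Nil
  have "lehmer (\<lambda>a. a) i = 0" for i by (simp add: lehmer_def card_eq_0_iff)
  thus ?case by (intro exI[of _ "\<lambda>a. a"]) (auto simp: permutes_def)
next
  case (Cons k v)
  then obtain \<tau> where \<tau>: "\<tau> permutes {1..sum_list v + length v}"
    and code: "\<And>i. i \<ge> 1 \<Longrightarrow> lehmer \<tau> i = (if i \<le> length v then v ! (i - 1) else 0)" by auto
  define M where "M = sum_list (k # v) + length (k # v)"
  define g where "g = (\<lambda>u :: nat. if u \<le> k then u else Suc u)"
  define \<sigma> where "\<sigma> = (\<lambda>i. if i = 0 then 0 else if i = 1 then Suc k else g (\<tau> (i - 1)))"
  have g_less: "g a < g b \<longleftrightarrow> a < b" for a b by (auto simp: g_def)
  have g_eq: "g a = g b \<longleftrightarrow> a = b" for a b by (auto simp: g_def split: if_splits)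
  have g_neq: "g a \<noteq> Suc k" for a by (auto simp: g_def)
  have g_0: "g a = 0 \<longleftrightarrow> a = 0" for a by (auto simp: g_def)
  have \<tau>_0: "\<tau> i = 0 \<longleftrightarrow> i = 0" for i
    using permutes_not_in[OF \<tau>, of 0] inj_eq[OF permutes_inj[OF \<tau>], of i 0] by simp
  have inj: "inj \<sigma>"
  proof (rule injI)
    fix i j assume "\<sigma> i = \<sigma> j"
    moreover have "0 = g a \<longleftrightarrow> a = 0" "Suc k \<noteq> g a" for a by (auto simp: g_def)
    ultimately show "i = j"
      by (cases i; cases j)
        (auto simp: \<sigma>_def g_eq g_0 g_neq \<tau>_0 inj_eq[OF permutes_inj[OF \<tau>]] split: if_splits)
  qed
  have outside: "\<sigma> i = i" if "i \<notin> {1..M}" for i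
  proof (cases "i = 0")
    case False
    hence "i > M" using that by auto
    hence "\<tau> (i - 1) = i - 1" by (intro permutes_not_in[OF \<tau>]) (auto simp: M_def)
    thus ?thesis using \<open>i > M\<close> by (auto simp: \<sigma>_def g_def M_def)
  qed (simp add: \<sigma>_def)
  have "\<sigma> ` {1..M} \<subseteq> {1..M}" using outside inj by (metis image_subsetI injD)
  hence "bij_betw \<sigma> {1..M} {1..M}"
    using endo_inj_surj[of "{1..M}" \<sigma>] inj_on_subset[OF inj subset_UNIV] by (simp add: bij_betw_def)
  hence perm: "\<sigma> permutes {1..M}" using outside by (intro bij_imp_permutes)
  have "lehmer \<sigma> i = (k # v) ! (i - 1)" if i1: "i = 1" for i
  proof -
    have "{j. i < j \<and> \<sigma> j < \<sigma> i} = Suc ` inv \<tau> ` {1..k}"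
    proof (intro set_eqI iffI)
      fix j assume j: "j \<in> {j. i < j \<and> \<sigma> j < \<sigma> i}"
      then obtain j' where j': "j = Suc j'" "j' \<noteq> 0" using i1 by (cases j) auto
      hence "g (\<tau> j') < Suc k" using j i1 by (simp add: \<sigma>_def)
      hence "\<tau> j' \<in> {1..k}" using \<tau>_0[of j'] j'(2) by (auto simp: g_def split: if_splits)
      thus "j \<in> Suc ` inv \<tau> ` {1..k}" using j' permutes_inverses(2)[OF \<tau>] by (metis image_eqI)
    next
      fix j assume "j \<in> Suc ` inv \<tau> ` {1..k}"
      then obtain u where u: "u \<in> {1..k}" "j = Suc (inv \<tau> u)" by auto
      moreover have "inv \<tau> u \<noteq> 0"
        using u(1) \<tau>_0[of "inv \<tau> u"] permutes_inverses(1)[OF \<tau>, of u] by auto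
      ultimately show "j \<in> {j. i < j \<and> \<sigma> j < \<sigma> i}"
        using i1 permutes_inverses(1)[OF \<tau>, of u] by (simp add: \<sigma>_def g_def)
    qed
    moreover have "card (Suc ` inv \<tau> ` {1..k}) = k"
      using permutes_inj[OF permutes_inv[OF \<tau>]]
      by (subst card_image, simp, subst card_image) (auto intro: inj_on_subset)
    ultimately show ?thesis using i1 by (simp add: lehmer_def)
  qed
  moreover have "lehmer \<sigma> i = lehmer \<tau> (i - 1)" if i1: "i > 1" for i
  proof -
    have "{j. i < j \<and> \<sigma> j < \<sigma> i} = Suc ` {j. i - 1 < j \<and> \<tau> j < \<tau> (i - 1)}"
    proof (intro set_eqI iffI)
      fix j assume j: "j \<in> {j. i < j \<and> \<sigma> j < \<sigma> i}"
      then obtain j' where "j = Suc j'" using i1 by (cases j) auto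
      thus "j \<in> Suc ` {j. i - 1 < j \<and> \<tau> j < \<tau> (i - 1)}"
        using j i1 by (auto simp: \<sigma>_def g_less split: if_splits)
    next
      fix j assume "j \<in> Suc ` {j. i - 1 < j \<and> \<tau> j < \<tau> (i - 1)}"
      thus "j \<in> {j. i < j \<and> \<sigma> j < \<sigma> i}" using i1 by (auto simp: \<sigma>_def g_less)
    qed
    thus ?thesis by (simp add: lehmer_def card_image)
  qed
  ultimately have "lehmer \<sigma> i = (if i \<le> length (k # v) then (k # v) ! (i - 1) else 0)"
    if "i \<ge> 1" for i
    using that code[of "i - 1"] by (cases "i = 1") (auto simp: nth_Cons')
  thus ?case using perm M_def by blast
qed

lemma code_perm_unique:
  assumes \<sigma>: "\<sigma> permutes {1..N}" and \<pi>: "\<pi> permutes {1..N'}"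
    and eq: "\<And>i. i \<ge> 1 \<Longrightarrow> lehmer \<sigma> i = lehmer \<pi> i"
  shows "\<sigma> = \<pi>"
proof
  have lehmer: "lehmer \<rho> i = card ({..<\<rho> i} - \<rho> ` {..<i})" if \<rho>: "\<rho> permutes {1..L}" for \<rho> L i
  proof -
    have "\<rho> ` {j. i < j \<and> \<rho> j < \<rho> i} = {..<\<rho> i} - \<rho> ` {..<i}"
    proof (intro set_eqI iffI)
      fix u assume u: "u \<in> {..<\<rho> i} - \<rho> ` {..<i}"
      obtain j where "u = \<rho> j" using surjD[OF permutes_surj[OF \<rho>]] by blast
      moreover from this have "i < j" using u by (cases i j rule: linorder_cases) auto
      ultimately show "u \<in> \<rho> ` {j. i < j \<and> \<rho> j < \<rho> i}" using u by auto
    qed (auto simp: inj_eq[OF permutes_inj[OF \<rho>]])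
    thus ?thesis
      unfolding lehmer_def by (metis card_image inj_on_subset permutes_inj[OF \<rho>] subset_UNIV)
  qed
  show "\<sigma> i = \<pi> i" for i
  proof (induction i rule: less_induct)
    case (less i)
    show ?case
    proof (cases "i = 0")
      case True
      thus ?thesis using permutes_not_in[OF \<sigma>, of 0] permutes_not_in[OF \<pi>, of 0] by simp
    next
      case False
      define X where "X = \<sigma> ` {..<i}"
      have X: "X = \<pi> ` {..<i}" using less unfolding X_def by (intro image_cong) auto
      have notin: "\<sigma> i \<notin> X" "\<pi> i \<notin> X"
        using inj_image_mem_iff[OF permutes_inj[OF \<sigma>], of i "{..<i}"]
          inj_image_mem_iff[OF permutes_inj[OF \<pi>], of i "{..<i}"]
        unfolding X_def[symmetric] X[symmetric] by simp_all
      have card_eq: "card ({..<\<sigma> i} - X) = card ({..<\<pi> i} - X)"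
        using eq[of i] False lehmer[OF \<sigma>, of i] lehmer[OF \<pi>, of i]
        unfolding X_def[symmetric] X[symmetric] by simp
      have strict: "card ({..<a} - X) < card ({..<b} - X)" if "a < b" "a \<notin> X" for a b
        using that by (intro psubset_card_mono) auto
      show ?thesis
        using strict[OF _ notin(1), of "\<pi> i"] strict[OF _ notin(2), of "\<sigma> i"] card_eq
        by (cases "\<sigma> i" "\<pi> i" rule: linorder_cases) auto
    qed
  qed
qed

lemma perm_of_code:
  "perm_of_code v permutes {1..sum_list v + length v}"
  "i \<ge> 1 \<Longrightarrow> lehmer (perm_of_code v) i = (if i \<le> length v then v ! (i - 1) else 0)"
proof -
  obtain \<sigma> where \<sigma>: "\<sigma> permutes {1..sum_list v + length v}"
    "\<forall>i\<ge>1. lehmer \<sigma> i = (if i \<le> length v then v ! (i - 1) else 0)"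
    using code_perm_exists by blast
  have "perm_of_code v = \<sigma>"
    unfolding perm_of_code_def
  proof (rule the_equality)
    show "\<pi> = \<sigma>" if "(\<exists>N. \<pi> permutes {1..N}) \<and>
        (\<forall>i\<ge>1. lehmer \<pi> i = (if i \<le> length v then v ! (i - 1) else 0))" for \<pi>
      using that \<sigma> code_perm_unique by metis
  qed (use \<sigma> in blast)
  thus "perm_of_code v permutes {1..sum_list v + length v}"
    "i \<ge> 1 \<Longrightarrow> lehmer (perm_of_code v) i = (if i \<le> length v then v ! (i - 1) else 0)"
    using \<sigma> by auto
qed

definition perm_length :: "perm \<Rightarrow> nat" where
  "perm_length \<sigma> = card {(i, j). i < j \<and> \<sigma> j < \<sigma> i}"

text \<open>\<open>\<pi> = \<sigma> \<tau>\<^sub>s\<^sub>t\<close> covers \<open>\<sigma>\<close> in \<open>S\<^sub>N\<close>.\<close>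

definition cover_by :: "nat \<Rightarrow> nat \<Rightarrow> nat \<Rightarrow> perm \<Rightarrow> perm \<Rightarrow> bool" where
  "cover_by N s t \<sigma> \<pi> \<longleftrightarrow>
     \<sigma> permutes {1..N} \<and> 1 \<le> s \<and> s < t \<and> t \<le> N \<and>
     \<pi> = \<sigma> \<circ> Transposition.transpose s t \<and> perm_length \<pi> = perm_length \<sigma> + 1"

definition bruhat_le :: "nat \<Rightarrow> perm \<Rightarrow> perm \<Rightarrow> bool" where
  "bruhat_le N \<sigma> \<pi> \<longleftrightarrow>
     \<sigma> permutes {1..N} \<and> \<pi> permutes {1..N} \<and> (\<lambda>\<rho> \<rho>'. \<exists>s t. cover_by N s t \<rho> \<rho>')\<^sup>*\<^sup>* \<sigma> \<pi>"

definition code_le :: "nat list \<Rightarrow> nat list \<Rightarrow> bool" where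
  "code_le v w \<longleftrightarrow> (\<exists>N. bruhat_le N (perm_of_code v) (perm_of_code w))"

definition labeled_edge :: "nat \<Rightarrow> perm \<Rightarrow> nat \<times> nat \<Rightarrow> perm \<Rightarrow> bool" where
  "labeled_edge N \<sigma> l \<pi> \<longleftrightarrow>
     (\<exists>s t j. cover_by N s t \<sigma> \<pi> \<and> s \<le> j \<and> j < t \<and> l = (j, \<sigma> s))"

text \<open>A chain is recorded as the list of its edges, each given by its label and its target.\<close>

type_synonym chain = "((nat \<times> nat) \<times> perm) list"

fun is_chain :: "nat \<Rightarrow> perm \<Rightarrow> chain \<Rightarrow> perm \<Rightarrow> bool" where
  "is_chain N \<sigma> [] \<pi> \<longleftrightarrow> \<sigma> permutes {1..N} \<and> \<sigma> = \<pi>"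
| "is_chain N \<sigma> ((l, \<rho>) # C) \<pi> \<longleftrightarrow> labeled_edge N \<sigma> l \<rho> \<and> is_chain N \<rho> C \<pi>"

fun label_less :: "nat \<times> nat \<Rightarrow> nat \<times> nat \<Rightarrow> bool" where
  "label_less (j, b) (j', b') \<longleftrightarrow> j < j' \<or> (j = j' \<and> b < b')"

definition increasing_chains :: "nat \<Rightarrow> perm \<Rightarrow> perm \<Rightarrow> chain set" where
  "increasing_chains N \<sigma> \<pi> = {C. is_chain N \<sigma> C \<pi> \<and> sorted_wrt label_less (map fst C)}"

definition label_count :: "chain \<Rightarrow> nat \<Rightarrow> nat" where
  "label_count C i = count_list (map (fst \<circ> fst) C) i"


section \<open>Skew Schubert polynomials\<close>

text \<open>
  The value at \<open>x\<close> of the skew Schubert polynomial. The set of increasing chains is finite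
  (\<open>finite_increasing_chains\<close> below), and the subtraction in the exponent is not truncated
  (\<open>label_count_le\<close> below).
\<close>

definition skew_schubert :: "nat \<Rightarrow> perm \<Rightarrow> perm \<Rightarrow> (nat \<Rightarrow> 'a::comm_semiring_1) \<Rightarrow> 'a" where
  "skew_schubert N \<sigma> \<pi> x =
     (\<Sum>C\<in>increasing_chains N \<sigma> \<pi>. \<Prod>i\<in>{1..N-1}. x i ^ ((N - i) - label_count C i))"

definition code_size :: "nat list \<Rightarrow> nat" where
  "code_size w = sum_list w + length w"

definition skew_schubert_code :: "nat list \<Rightarrow> nat list \<Rightarrow> (nat \<Rightarrow> 'a::comm_semiring_1) \<Rightarrow> 'a" where
  "skew_schubert_code w v = skew_schubert (code_size w) (perm_of_code v) (perm_of_code w)"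

lemma perm_length_transpose_less:
  assumes \<sigma>: "\<sigma> permutes {1..N}" and st: "s < t" and inv: "\<sigma> t < \<sigma> s"
  shows "perm_length (\<sigma> \<circ> Transposition.transpose s t) < perm_length \<sigma>"
proof -
  let ?\<tau> = "Transposition.transpose s t"
  let ?I = "\<lambda>\<rho>. {(i, j). i < j \<and> \<rho> j < (\<rho> i :: nat)}"
  let ?\<phi> = "\<lambda>(i, j). if ?\<tau> i < ?\<tau> j then (?\<tau> i, ?\<tau> j) else (i, j)"
  have "?I \<sigma> \<subseteq> {0..N} \<times> {0..N}"
  proof (rule subsetI, elim CollectE case_prodE conjE)
    fix p and i j :: nat assume p: "p = (i, j)" and "i < j" "\<sigma> j < \<sigma> i"
    have "j \<le> N"
    proof (rule ccontr)
      assume "\<not> j \<le> N"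
      hence "\<sigma> j = j" using \<sigma> by (auto simp: permutes_def)
      hence "\<sigma> i > i" "\<sigma> i > N" using \<open>i < j\<close> \<open>\<sigma> j < \<sigma> i\<close> \<open>\<not> j \<le> N\<close> by auto
      moreover have "i \<in> {1..N}" using \<sigma> \<open>\<sigma> i > i\<close> by (metis less_irrefl permutes_not_in)
      ultimately show False using permutes_in_image[OF \<sigma>, of i] by auto
    qed
    thus "p \<in> {0..N} \<times> {0..N}" using p \<open>i < j\<close> by auto
  qed
  hence fin: "finite (?I \<sigma>)" using finite_subset by blast
  have "inj_on ?\<phi> (?I (\<sigma> \<circ> ?\<tau>))"
  proof (rule inj_on_inverseI[where g = ?\<phi>])
    fix p assume "p \<in> ?I (\<sigma> \<circ> ?\<tau>)"
    thus "?\<phi> (?\<phi> p) = p" by (cases p) simp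
  qed
  moreover have "?\<phi> ` ?I (\<sigma> \<circ> ?\<tau>) \<subseteq> ?I \<sigma> - {(s, t)}"
    using st inv by (auto simp: Transposition.transpose_def split: if_splits)
  ultimately have "card (?I (\<sigma> \<circ> ?\<tau>)) \<le> card (?I \<sigma> - {(s, t)})"
    using fin card_inj_on_le by blast
  also have "\<dots> < card (?I \<sigma>)"
    using st inv fin by (intro psubset_card_mono) auto
  finally show ?thesis by (simp add: perm_length_def)
qed

lemma cover_by_less: "cover_by N s t \<sigma> \<pi> \<Longrightarrow> \<sigma> s < \<sigma> t"
  using perm_length_transpose_less[of \<sigma> N s t] permutes_inj[of \<sigma> "{1..N}"]
  by (metis cover_by_def injD linorder_less_linear less_irrefl not_add_less1)

lemma label_count_le_aux:
  assumes "is_chain N \<sigma> C \<pi>" "sorted_wrt label_less (map fst C)" "F \<subseteq> {k<..N}"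
    "\<forall>f\<in>F. \<forall>b. (k, b) \<in> set (map fst C) \<longrightarrow> \<sigma> f < b"
    "F \<noteq> {} \<longrightarrow> (\<forall>l\<in>set (map fst C). k \<le> fst l)"
  shows "card F + label_count C k \<le> N - k"
  using assms
proof (induction C arbitrary: \<sigma> F)
  case Nil
  thus ?case using card_mono[of "{k<..N}" F] by (simp add: label_count_def)
next
  case (Cons e C)
  obtain i b \<rho> where e: "e = ((i, b), \<rho>)" by (metis prod.exhaust)
  obtain s t where st: "cover_by N s t \<sigma> \<rho>" "s \<le> i" "i < t" "b = \<sigma> s"
    using Cons.prems(1) by (auto simp: e labeled_edge_def)
  have lt: "\<sigma> s < \<sigma> t" using st(1) cover_by_less by blast
  have C: "is_chain N \<rho> C \<pi>" "sorted_wrt label_less (map fst C)"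
    using Cons.prems(1,2) by (auto simp: e)
  have later: "label_less (i, b) l" if "l \<in> set (map fst C)" for l
    using Cons.prems(2) that by (auto simp: e)
  have \<rho>: "\<rho> = \<sigma> \<circ> Transposition.transpose s t" and tN: "t \<le> N"
    using st(1) by (auto simp: cover_by_def)
  have cnt: "label_count (e # C) k = (if i = k then 1 else 0) + label_count C k"
    by (simp add: label_count_def e)
  consider "i < k" | "i = k" | "i > k" by linarith
  thus ?case
  proof cases
    case 1
    hence "F = {}" using Cons.prems(5) by (fastforce simp: e)
    thus ?thesis using Cons.IH[OF C, of "{}"] 1 by (simp add: cnt)
  next
    case 2
    have tF: "t \<notin> F" using Cons.prems(4) lt st(4) 2 by (auto simp: e)
    have "card (insert t F) + label_count C k \<le> N - k"
    proof (rule Cons.IH[OF C])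
      show "insert t F \<subseteq> {k<..N}" using Cons.prems(3) st(3) tN 2 by auto
      show "\<forall>f\<in>insert t F. \<forall>b. (k, b) \<in> set (map fst C) \<longrightarrow> \<rho> f < b"
      proof (intro ballI allI impI)
        fix f b' assume f: "f \<in> insert t F" and b': "(k, b') \<in> set (map fst C)"
        have "b < b'" using later[OF b'] 2 by simp
        show "\<rho> f < b'"
        proof (cases "f = t")
          case True
          thus ?thesis using \<open>b < b'\<close> st(4) by (simp add: \<rho>)
        next
          case False
          hence "f \<in> F" using f by simp
          hence "f \<noteq> s" using Cons.prems(3) st(2) 2 by auto
          hence "\<rho> f = \<sigma> f" using False by (simp add: \<rho> transpose_apply_other)
          thus ?thesis using \<open>f \<in> F\<close> b' Cons.prems(4) by auto
        qed
      qed
      show "insert t F \<noteq> {} \<longrightarrow> (\<forall>l\<in>set (map fst C). k \<le> fst l)"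
        using later 2 by force
    qed
    moreover have "finite F" using Cons.prems(3) finite_subset by blast
    ultimately show ?thesis using tF 2 by (simp add: cnt)
  next
    case 3
    have "label_count C k = 0"
      using later 3 unfolding label_count_def by (force simp: count_list_0_iff)
    moreover have "card F \<le> N - k" using card_mono[of "{k<..N}" F] Cons.prems(3) by simp
    ultimately show ?thesis using 3 by (simp add: cnt)
  qed
qed

lemma label_count_le: "C \<in> increasing_chains N \<sigma> \<pi> \<Longrightarrow> label_count C i \<le> N - i"
  using label_count_le_aux[of N \<sigma> C \<pi> "{}" i] by (simp add: increasing_chains_def)

lemma is_chain_length: "is_chain N \<sigma> C \<pi> \<Longrightarrow> perm_length \<pi> = perm_length \<sigma> + length C"
  by (induction N \<sigma> C \<pi> rule: is_chain.induct) (auto simp: labeled_edge_def cover_by_def)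

lemma is_chain_set:
  "is_chain N \<sigma> C \<pi> \<Longrightarrow> set C \<subseteq> ({0..N} \<times> {0..N}) \<times> {\<rho>. \<rho> permutes {1..N}}"
proof (induction N \<sigma> C \<pi> rule: is_chain.induct)
  case (2 N \<sigma> l \<rho> C \<pi>)
  from 2(2) obtain s t j where st: "cover_by N s t \<sigma> \<rho>" "j < t" "l = (j, \<sigma> s)"
    by (auto simp: labeled_edge_def)
  have *: "\<sigma> permutes {1..N}" "s \<in> {1..N}" "t \<in> {1..N}"
    using st(1) by (auto simp: cover_by_def)
  have "\<rho> permutes {1..N}"
    using st(1) permutes_compose[OF permutes_swap_id[OF *(2,3)] *(1)] by (simp add: cover_by_def)
  moreover have "\<sigma> s \<in> {1..N}" using permutes_in_image[OF *(1), of s] *(2) by blast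
  ultimately show ?case using 2 st * by auto
qed auto

lemma finite_increasing_chains: "finite (increasing_chains N \<sigma> \<pi>)"
proof (rule finite_subset)
  let ?A = "({0..N} \<times> {0..N}) \<times> {\<rho>. \<rho> permutes {1..N}}"
  show "increasing_chains N \<sigma> \<pi> \<subseteq> {C. set C \<subseteq> ?A \<and> length C = perm_length \<pi> - perm_length \<sigma>}"
    using is_chain_set is_chain_length by (fastforce simp: increasing_chains_def)
  show "finite {C. set C \<subseteq> ?A \<and> length C = perm_length \<pi> - perm_length \<sigma>}"
    by (intro finite_lists_length_eq finite_cartesian_product finite_permutations) auto
qed


section \<open>The evaluation problem\<close>

text \<open>
  An instance \<open>(v, w, a)\<close> consists of two codes of the same length and one coordinate for each of
  the \<open>N - 1\<close> variables; \<open>a ! (i - 1)\<close> is the value of the variable \<open>x\<^sub>i\<close>.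
\<close>

type_synonym inst = "nat list \<times> nat list \<times> nat list"

definition skew_instances :: "inst set" where
  "skew_instances =
     {(v, w, a). length v = length w \<and> code_le v w \<and> length a = code_size w - 1}"

definition skew_value :: "inst \<Rightarrow> nat" where
  "skew_value = (\<lambda>(v, w, a). skew_schubert_code w v (\<lambda>i. a ! (i - 1)))"

definition unary :: "nat \<Rightarrow> bool list" where
  "unary n = replicate n True @ [False]"

text \<open>Binary digits, most significant first, without leading zeros (0 has no digits).\<close>

fun binary :: "nat \<Rightarrow> bool list" where
  "binary n = (if n = 0 then [] else binary (n div 2) @ [odd n])"

declare binary.simps [simp del]

fun encode_instance :: "inst \<Rightarrow> bool list" where
  "encode_instance (v, w, a) =
     unary (length v) @ concat (map unary v) @ concat (map unary w) @
     concat (map (framed \<circ> binary) a)"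

lemma unary_append_eq: "unary m @ x = unary n @ y \<longleftrightarrow> m = n \<and> x = y"
proof (induction m arbitrary: n)
  case 0
  show ?case by (cases n) (auto simp: unary_def)
next
  case (Suc m)
  show ?case using Suc.IH by (cases n) (auto simp: unary_def)
qed

lemma framed_append_eq: "framed b @ x = framed c @ y \<longleftrightarrow> b = c \<and> x = y"
proof (induction b arbitrary: c)
  case Nil
  show ?case by (cases c) (auto simp: framed_def)
next
  case (Cons z b)
  show ?case using Cons.IH by (cases c) (auto simp: framed_def)
qed

lemma inj_binary: "inj binary"
proof (rule injI)
  show "m = n" if "binary m = binary n" for m n
    using that
  proof (induction m arbitrary: n rule: less_induct)
    case (less m)
    show ?case
    proof (cases "m = 0 \<or> n = 0")
      case True
      thus ?thesis using less.prems by (subst (asm) (1 2) binary.simps) (auto split: if_splits)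
    next
      case False
      hence "binary (m div 2) = binary (n div 2) \<and> odd m = odd n"
        using less.prems by (subst (asm) (1 2) binary.simps) auto
      moreover from this have "m div 2 = n div 2" using less.IH[of "m div 2" "n div 2"] False by simp
      ultimately show ?thesis by (metis odd_two_times_div_two_succ even_two_times_div_two)
    qed
  qed
qed

lemma concat_unary_append_eq:
  "length v = length v' \<Longrightarrow>
     concat (map unary v) @ x = concat (map unary v') @ y \<longleftrightarrow> v = v' \<and> x = y"
  by (induction v v' rule: list_induct2) (auto simp: unary_append_eq)

lemma concat_framed_binary_eq:
  "concat (map (framed \<circ> binary) a) = concat (map (framed \<circ> binary) a') \<longleftrightarrow> a = a'"
proof (induction a arbitrary: a')
  case Nil
  show ?case by (cases a') (auto simp: framed_def)
next
  case (Cons n a)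
  show ?case
  proof (cases a')
    case Nil
    thus ?thesis by (auto simp: framed_def)
  next
    case (Cons n' a'')
    thus ?thesis using Cons.IH by (simp add: framed_append_eq inj_eq[OF inj_binary])
  qed
qed

lemma inj_on_encode_instance: "inj_on encode_instance skew_instances"
  by (rule inj_onI)
    (auto simp: skew_instances_def unary_append_eq concat_unary_append_eq concat_framed_binary_eq)

end

theory Submission
  imports Defs "HOL-Library.Nat_Bijection"
begin

text \<open>
  A certificate for \<open>(v, w, a)\<close> consists of a parse of the input, an increasing chain from
  \<open>\<langle>v\<rangle>\<close> to \<open>\<langle>w\<rangle>\<close> with all its intermediate permutations, and, for every variable \<open>x\<^sub>i\<close>, as many numbers
  below \<open>a\<^sub>i\<close> as the exponent of \<open>x\<^sub>i\<close> in the monomial of the chain; each chain is thus counted as often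
  as the value of its monomial. Since the certificate holds all intermediate data, checking it is a matter of
  bounded quantifiers and bounded counting over positions. Such conditions are written as
  expressions built from bounded sums, and these are evaluated by nested loops over unary counters, one
  counter per tape, in polynomial time. If \<open>v \<le> w\<close> fails, there are no
  chains, and the count is the value 0 of a string that encodes no instance.
\<close>

section \<open>Counter programs on Turing machines\<close>

text \<open>Counting, unlike deciding, needs exactly one accepted certificate for each object. This
  governs the design: every entry of a certificate is either data of the parse and the chain, or a
  digit of a chosen number, or required to be 0; binary blocks carry no leading zeros; and the bits
  that spell an entry must be ones followed by zeros. The second obstacle is size. Counters hold
  only values polynomial in the input length, while the coordinates of the point may be exponential.
  They never become values of an expression: only their digits occur, and a chosen number is
  compared with its bound at the highest differing digit. Everything else is small, because
  \<open>N\<close> is at most the number of blocks of the input and the length of a chain is bounded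
  by the number of pairs of positions. The permutations of the two codes are not constructed. They
  are guessed with the chain and recognized by their Lehmer codes.\<close>

text \<open>
  Tape 0 holds the input; every other tape is a counter, blank except for a mark (symbol 1) in cell 0,
  whose value is the position of its head. A halting program accepts iff the counter on tape 1 is
  not zero.
\<close>

datatype instr = Move nat move | Jump nat "nat set" nat

text \<open>The four states after the program are, in order, the final test of the counter on tape
  1, acceptance, rejection, and a start state that writes the mark into cell 0 of every counter,
  because \<open>init_config\<close> supplies blank tapes.\<close>

definition machine :: "nat \<Rightarrow> instr list \<Rightarrow> tm" where
  "machine k P = \<lparr>ntapes = k, nsyms = 3, nstates = length P + 4, start = length P + 3,
     accept = length P + 1, reject = length P + 2,
     delta = (\<lambda>q ss.
       if q < length P then
         (case P ! q of
            Move j d \<Rightarrow> (q + 1, (map (\<lambda>s. (s, Stay)) ss)[j := (ss ! j, d)])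
          | Jump j S l \<Rightarrow> (if ss ! j \<in> S then l else q + 1, map (\<lambda>s. (s, Stay)) ss))
       else if q = length P then
         (if ss ! 1 = 1 then length P + 2 else length P + 1, map (\<lambda>s. (s, Stay)) ss)
       else if q = length P + 3 then
         (0, map (\<lambda>i. (if i = 0 then ss ! 0 else 1, Stay)) [0..<k])
       else (q, map (\<lambda>s. (s, Stay)) ss))\<rparr>"

text \<open>After the start step every transition writes back the symbol it reads. The tape contents
  therefore depend on the input alone, and a configuration reduces to a state and the head
  positions, as in \<open>conf\<close>.\<close>

definition cells :: "bool list \<Rightarrow> nat \<Rightarrow> int \<Rightarrow> nat" where
  "cells x j = (if j = 0 then fst (input_tape x) else (\<lambda>p. if p = 0 then 1 else 0))"

definition conf :: "nat \<Rightarrow> bool list \<Rightarrow> nat \<Rightarrow> (nat \<Rightarrow> int) \<Rightarrow> config" where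
  "conf k x q h = (q, map (\<lambda>j. (cells x j, h j)) [0..<k])"

lemma funpow_one: "(f :: 'a \<Rightarrow> 'a) ^^ 1 = f"
  by (simp add: fun_eq_iff)

lemma tm_step_Move:
  assumes "q < length P" "P ! q = Move j d" "j < k"
  shows "tm_step (machine k P) (conf k x q h) = conf k x (q + 1) (h(j := move_head d (h j)))"
  using assms
  by (auto simp: machine_def conf_def intro!: nth_equalityI simp: nth_list_update)

lemma tm_step_Jump:
  assumes "q < length P" "P ! q = Jump j S l" "j < k"
  shows "tm_step (machine k P) (conf k x q h) = conf k x (if cells x j (h j) \<in> S then l else q + 1) h"
  using assms
  by (auto simp: machine_def conf_def intro!: nth_equalityI)

lemma tm_step_start:
  assumes "k \<ge> 1"
  shows "tm_step (machine k P) (init_config (machine k P) x) = conf k x 0 (\<lambda>_. 0)"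
proof -
  have "map2 act_tape (map (\<lambda>i. (if i = 0 then (read_tape (input_tape x) # replicate (k - Suc 0) 0) ! 0 else 1, Stay)) [0..<k])
      (input_tape x # replicate (k - 1) (\<lambda>_. 0, 0)) = map (\<lambda>j. (cells x j, 0)) [0..<k]"
    using assms
    by (intro nth_equalityI)
      (auto simp: cells_def nth_Cons' input_tape_def fun_eq_iff)
  thus ?thesis
    by (simp add: machine_def conf_def init_config_def)
qed

lemma tm_step_final:
  assumes "k \<ge> 2"
  shows "tm_step (machine k P) (conf k x (length P) h) =
    conf k x (if h 1 = 0 then length P + 2 else length P + 1) h"
  using assms
  by (auto simp: machine_def conf_def cells_def intro!: nth_equalityI)

section \<open>Structured programs, their compilation and their step counts\<close>

datatype com = Mv nat move | Seq com com (infixr \<open>;;\<close> 60) | While nat "nat set" com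
  | Unless nat "nat set" com

fun clen :: "com \<Rightarrow> nat" where
  "clen (Mv j d) = 1"
| "clen (c ;; c') = clen c + clen c'"
| "clen (While j S c) = clen c + 2"
| "clen (Unless j S c) = clen c + 1"

text \<open>Jump targets are absolute, hence the load address \<open>p\<close>. The instruction
  \<open>Jump 0 UNIV p\<close> is the unconditional jump that closes a loop.\<close>

fun code :: "nat \<Rightarrow> com \<Rightarrow> instr list" where
  "code p (Mv j d) = [Move j d]"
| "code p (c ;; c') = code p c @ code (p + clen c) c'"
| "code p (While j S c) = Jump j S (p + clen c + 2) # code (p + 1) c @ [Jump 0 UNIV p]"
| "code p (Unless j S c) = Jump j S (p + clen c + 1) # code (p + 1) c"

fun width :: "com \<Rightarrow> nat" where
  "width (Mv j d) = Suc j"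
| "width (c ;; c') = max (width c) (width c')"
| "width (While j S c) = max (Suc j) (width c)"
| "width (Unless j S c) = max (Suc j) (width c)"

lemma length_code [simp]: "length (code p c) = clen c"
  by (induction c arbitrary: p) auto

lemma code_targets: "Jump j S l \<in> set (code p c) \<Longrightarrow> l \<le> p + clen c"
  by (induction c arbitrary: p) fastforce+

lemma code_moves: "Move j d \<in> set (code p c) \<Longrightarrow> j < width c"
  by (induction c arbitrary: p) fastforce+

text \<open>A big-step semantics with exact step counts. The sum in \<open>While_step\<close> is
  arranged for \<open>funpow_add\<close>, which applies the rightmost summand first: test, body,
  jump back, remaining loop.\<close>

inductive exec :: "bool list \<Rightarrow> com \<Rightarrow> (nat \<Rightarrow> int) \<Rightarrow> nat \<Rightarrow> (nat \<Rightarrow> int) \<Rightarrow> bool" for x where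
  Mv: "exec x (Mv j d) h 1 (h(j := move_head d (h j)))"
| Seq: "exec x c h t h' \<Longrightarrow> exec x c' h' t' h'' \<Longrightarrow> exec x (c ;; c') h (t + t') h''"
| While_exit: "cells x j (h j) \<in> S \<Longrightarrow> exec x (While j S c) h 1 h"
| While_step: "cells x j (h j) \<notin> S \<Longrightarrow> exec x c h t h' \<Longrightarrow> exec x (While j S c) h' t' h'' \<Longrightarrow>
    exec x (While j S c) h (t' + (1 + (t + 1))) h''"
| Unless_skip: "cells x j (h j) \<in> S \<Longrightarrow> exec x (Unless j S c) h 1 h"
| Unless_do: "cells x j (h j) \<notin> S \<Longrightarrow> exec x c h t h' \<Longrightarrow> exec x (Unless j S c) h (t + 1) h'"

text \<open>The program \<open>P\<close> is only required to contain \<open>code p c\<close> at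
  address \<open>p\<close>, because the induction descends to fragments of one fixed
  program.\<close>

lemma exec_machine:
  assumes "exec x c h t h'" "width c \<le> k"
    "p + clen c \<le> length P" "\<And>i. i < clen c \<Longrightarrow> P ! (p + i) = code p c ! i"
  shows "(tm_step (machine k P) ^^ t) (conf k x p h) = conf k x (p + clen c) h'"
  using assms
proof (induction arbitrary: p)
  case (Mv j d h)
  thus ?case using Mv(3)[of 0] by (simp add: tm_step_Move fun_upd_def)
next
  case (Seq c h t h' c' t' h'')
  have 1: "(tm_step (machine k P) ^^ t) (conf k x p h) = conf k x (p + clen c) h'"
  proof (rule Seq.IH(1))
    show "P ! (p + i) = code p c ! i" if "i < clen c" for i
      using that Seq.prems(3)[of i] by (simp add: nth_append)
  qed (use Seq.prems in auto)
  have 2: "(tm_step (machine k P) ^^ t') (conf k x (p + clen c) h') =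
      conf k x (p + clen c + clen c') h''"
  proof (rule Seq.IH(2))
    show "P ! (p + clen c + i) = code (p + clen c) c' ! i" if "i < clen c'" for i
      using that Seq.prems(3)[of "clen c + i"] by (simp add: nth_append add.assoc)
  qed (use Seq.prems in auto)
  show ?case
    by (subst add.commute, subst funpow_add) (simp add: 1 2 add.assoc)
next
  case (While_exit j h S c)
  thus ?case using While_exit(4)[of 0] by (simp add: tm_step_Jump)
next
  case (While_step j h S c t h' t' h'')
  have 0: "tm_step (machine k P) (conf k x p h) = conf k x (p + 1) h"
    using While_step.prems(3)[of 0] While_step.prems(1,2) While_step.hyps(1)
    by (simp add: tm_step_Jump)
  have 1: "(tm_step (machine k P) ^^ t) (conf k x (p + 1) h) = conf k x (p + 1 + clen c) h'"
  proof (rule While_step.IH(1))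
    show "P ! (p + 1 + i) = code (p + 1) c ! i" if "i < clen c" for i
      using that While_step.prems(3)[of "Suc i"] by (simp add: nth_append)
  qed (use While_step.prems in auto)
  have 2: "tm_step (machine k P) (conf k x (p + 1 + clen c) h') = conf k x p h'"
  proof -
    have "P ! (p + 1 + clen c) = Jump 0 UNIV p"
      using While_step.prems(3)[of "Suc (clen c)"] by (simp add: nth_append)
    thus ?thesis
      using While_step.prems(1,2) by (subst tm_step_Jump) auto
  qed
  have 3: "(tm_step (machine k P) ^^ t') (conf k x p h') = conf k x (p + clen (While j S c)) h''"
    using While_step.prems by (intro While_step.IH(2)) auto
  have "(tm_step (machine k P) ^^ (t' + (1 + (t + 1)))) (conf k x p h) =
      (tm_step (machine k P) ^^ t') (tm_step (machine k P)
        ((tm_step (machine k P) ^^ t) (tm_step (machine k P) (conf k x p h))))"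
    by (simp only: funpow_add o_apply funpow_one)
  thus ?case by (simp only: 0 1 2 3)
next
  case (Unless_skip j h S c)
  thus ?case using Unless_skip(4)[of 0] by (simp add: tm_step_Jump)
next
  case (Unless_do j h S c t h')
  have 0: "tm_step (machine k P) (conf k x p h) = conf k x (p + 1) h"
    using Unless_do.prems(3)[of 0] Unless_do.prems(1,2) Unless_do.hyps(1)
    by (simp add: tm_step_Jump)
  have 1: "(tm_step (machine k P) ^^ t) (conf k x (p + 1) h) = conf k x (p + 1 + clen c) h'"
  proof (rule Unless_do.IH)
    show "P ! (p + 1 + i) = code (p + 1) c ! i" if "i < clen c" for i
      using that Unless_do.prems(3)[of "Suc i"] by (simp add: nth_append)
  qed (use Unless_do.prems in auto)
  show ?case by (simp only: funpow_add o_apply funpow_one 0 1) simp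
qed

lemma wf_machine:
  assumes "k \<ge> 2" "width c \<le> k"
  shows "wf_tm (machine k (code 0 c))"
proof -
  let ?P = "code 0 c"
  have "case delta (machine k ?P) q ss of (q', acts) \<Rightarrow>
      q' < nstates (machine k ?P) \<and> length acts = k \<and> (\<forall>(s, d)\<in>set acts. s < 3)"
    if "q < length ?P + 4" "length ss = k" "\<forall>s\<in>set ss. s < 3" for q ss
  proof (cases "q < length ?P")
    case True
    hence mem: "?P ! q \<in> set ?P" by simp
    show ?thesis
    proof (cases "?P ! q")
      case (Move j d)
      hence "ss ! j < 3" using code_moves[of j d 0 c] mem assms(2) that by simp
      thus ?thesis
        using True Move that
        by (auto simp: machine_def dest!: set_update_subset_insert[THEN subsetD])
    next
      case (Jump j S l)
      hence "l \<le> clen c" using code_targets[of j S l 0 c] mem by simp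
      thus ?thesis using True Jump that by (auto simp: machine_def)
    qed
  next
    case False
    moreover have "ss ! 0 < 3" using that assms(1) by (cases ss) auto
    ultimately show ?thesis using that by (auto simp: machine_def)
  qed
  thus ?thesis
    using assms(1) by (auto simp: wf_tm_def machine_def)
qed

lemma tm_step_halted:
  "q = accept M \<or> q = reject M \<Longrightarrow> (tm_step M ^^ t) (q, ts) = (q, ts)"
  by (induction t) auto

text \<open>The summand 2 pays for the start step and the final test. The \<open>r\<close> steps
  left over are idle, since halting configurations are fixed points; this turns a bound on the time
  into the exact time that \<open>decides_in_time\<close> prescribes.\<close>

lemma exec_class_P:
  assumes "\<And>x. \<exists>t h. t \<le> poly p (length x) \<and> exec x c (\<lambda>_. 0) t h \<and> (h 1 \<noteq> 0 \<longleftrightarrow> x \<in> L)"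
  shows "L \<in> class_P"
proof -
  define k where "k = max 2 (width c)"
  define M where "M = machine k (code 0 c)"
  have k: "k \<ge> 2" "k \<ge> 1" "width c \<le> k" by (auto simp: k_def)
  have "decides_in_time M L (poly (p + 2))"
    unfolding decides_in_time_def
  proof
    fix x
    obtain t h where t: "t \<le> poly p (length x)" "exec x c (\<lambda>_. 0) t h" "h 1 \<noteq> 0 \<longleftrightarrow> x \<in> L"
      using assms by blast
    define r where "r = poly p (length x) - t"
    have T: "poly (p + 2) (length x) = r + (1 + (t + 1))"
      using t(1) by (simp add: r_def)
    have run: "(tm_step M ^^ t) (conf k x 0 (\<lambda>_. 0)) = conf k x (clen c) h"
      using exec_machine[OF t(2) k(3), of 0 "code 0 c"] by (simp add: M_def)
    have "(tm_step M ^^ poly (p + 2) (length x)) (init_config M x) =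
       (tm_step M ^^ r) (tm_step M ((tm_step M ^^ t) (tm_step M (init_config M x))))"
      unfolding T by (simp only: funpow_add o_apply funpow_one)
    also have "\<dots> = (tm_step M ^^ r) (conf k x (if x \<in> L then accept M else reject M) h)"
    proof -
      have "accept M = clen c + 1" "reject M = clen c + 2"
        by (simp_all add: M_def machine_def)
      thus ?thesis
        using run tm_step_start[OF k(2), of "code 0 c" x]
          tm_step_final[OF k(1), of "code 0 c" x h] t(3)
        by (auto simp flip: M_def)
    qed
    also have "\<dots> = conf k x (if x \<in> L then accept M else reject M) h"
      unfolding conf_def by (rule tm_step_halted) auto
    finally show "fst ((tm_step M ^^ poly (p + 2) (length x)) (init_config M x)) =
        (if x \<in> L then accept M else reject M)"
      by (simp add: conf_def)
  qed
  moreover have "wf_tm M" unfolding M_def using k by (intro wf_machine)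
  ultimately show ?thesis unfolding class_P_def by blast
qed

section \<open>Timed runs on counters with natural values\<close>

text \<open>Two relaxations of \<open>exec\<close>: heads stay at natural positions, so that they
  are counter values, and the exact time becomes an upper bound, so that costs can be
  rounded.\<close>

definition runs :: "bool list \<Rightarrow> com \<Rightarrow> (nat \<Rightarrow> nat) \<Rightarrow> nat \<Rightarrow> (nat \<Rightarrow> nat) \<Rightarrow> bool" where
  "runs x c R B R' \<longleftrightarrow> (\<exists>t\<le>B. exec x c (int \<circ> R) t (int \<circ> R'))"

lemma runs_mono: "runs x c R B R' \<Longrightarrow> B \<le> B' \<Longrightarrow> runs x c R B' R'"
  unfolding runs_def by (meson order_trans)

lemma runs_Seq: "runs x c R B R' \<Longrightarrow> runs x c' R' B' R'' \<Longrightarrow> runs x (c ;; c') R (B + B') R''"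
  unfolding runs_def by (meson add_mono exec.Seq)

lemma runs_right:
  assumes "R' = R(r := R r + 1)" "B \<ge> 1"
  shows "runs x (Mv r Move_Right) R B R'"
proof -
  have "int \<circ> R' = (int \<circ> R)(r := move_head Move_Right ((int \<circ> R) r))"
    using assms(1) by (auto simp: fun_eq_iff)
  thus ?thesis using exec.Mv[of x r Move_Right "int \<circ> R"] assms(2) by (auto simp: runs_def)
qed

lemma runs_left:
  assumes "R r > 0" "R' = R(r := R r - 1)" "B \<ge> 1"
  shows "runs x (Mv r Move_Left) R B R'"
proof -
  have "int \<circ> R' = (int \<circ> R)(r := move_head Move_Left ((int \<circ> R) r))"
    using assms(1,2) by (auto simp: fun_eq_iff)
  thus ?thesis using exec.Mv[of x r Move_Left "int \<circ> R"] assms(3) by (auto simp: runs_def)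
qed

lemma runs_right_Seq:
  assumes "runs x c (R(r := R r + 1)) (B - 1) R'" "B \<ge> 1"
  shows "runs x (Mv r Move_Right ;; c) R B R'"
  using runs_Seq[OF runs_right[of _ R r 1] assms(1)] assms(2) by simp

lemma runs_Unless_skip: "cells x j (int (R j)) \<in> S \<Longrightarrow> runs x (Unless j S c) R 1 R"
  unfolding runs_def using exec.Unless_skip[of x j "int \<circ> R"] by auto

lemma runs_Unless_do:
  "cells x j (int (R j)) \<notin> S \<Longrightarrow> runs x c R B R' \<Longrightarrow> runs x (Unless j S c) R (B + 1) R'"
  unfolding runs_def using exec.Unless_do[of x j "int \<circ> R"] by (metis add_le_mono1 comp_apply)

text \<open>\<open>F k\<close> is the register state with \<open>k\<close> rounds to go. Counting
  down lets \<open>k\<close> coincide with the counter that drives the loop in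
  \<open>runs_loop\<close>.\<close>

lemma runs_While:
  assumes "\<And>k. k < K \<Longrightarrow> cells x j (int (F (Suc k) j)) \<notin> S" "cells x j (int (F 0 j)) \<in> S"
    "\<And>k. k < K \<Longrightarrow> runs x c (F (Suc k)) B (F k)"
  shows "runs x (While j S c) (F K) (K * (B + 2) + 1) (F 0)"
  using assms
proof (induction K)
  case 0
  show ?case
    unfolding runs_def using exec.While_exit[of x j "int \<circ> F 0"] 0(2) by auto
next
  case (Suc K)
  hence "runs x (While j S c) (F K) (K * (B + 2) + 1) (F 0)" by simp
  moreover have "runs x c (F (Suc K)) B (F K)" "cells x j (int (F (Suc K) j)) \<notin> S"
    using Suc.prems by auto
  ultimately obtain t t' where "t \<le> B" "t' \<le> K * (B + 2) + 1"
    "exec x (While j S c) (int \<circ> F (Suc K)) (t' + (1 + (t + 1))) (int \<circ> F 0)"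
    using exec.While_step[of x j "int \<circ> F (Suc K)"] unfolding runs_def by (metis comp_apply)
  thus ?case unfolding runs_def by (intro exI[of _ "t' + (1 + (t + 1))"]) auto
qed

text \<open>The exit set \<open>{1}\<close> is the mark in cell 0, so the test asks whether the
  counter is zero. The decrement precedes the body, which thus sees the values from one below the
  initial value down to 0: the index range of a bounded sum.\<close>

abbreviation loop :: "nat \<Rightarrow> com \<Rightarrow> com" where
  "loop r c \<equiv> While r {1} (Mv r Move_Left ;; c)"

lemma runs_loop:
  assumes "r > 0" "\<And>k. k \<le> K \<Longrightarrow> F k r = k" "\<And>k. k < K \<Longrightarrow> runs x c ((F (Suc k))(r := k)) B (F k)"
    "R = F K" "R' = F 0"
  shows "runs x (loop r c) R (K * (B + 3) + 1) R'"
proof -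
  have "runs x (loop r c) (F K) (K * ((1 + B) + 2) + 1) (F 0)"
  proof (rule runs_While)
    fix k assume k: "k < K"
    show "cells x r (int (F (Suc k) r)) \<notin> {1}"
      using assms(1,2) k by (simp add: cells_def)
    show "runs x (Mv r Move_Left ;; c) (F (Suc k)) (1 + B) (F k)"
      using assms(2,3) k by (intro runs_Seq[OF runs_left]) auto
  qed (use assms(1,2) in \<open>simp add: cells_def\<close>)
  thus ?thesis using assms(4,5) by (simp add: numeral_eq_Suc)
qed

section \<open>Expressions with bounded sums\<close>

text \<open>Variables are de Bruijn indices: \<open>Sum a b\<close> binds the summation variable as variable 0 of \<open>b\<close>.\<close>

datatype expr = Var nat | One | Len | Bit expr | Plus expr expr | Minus expr expr | Sum expr expr

fun eval :: "bool list \<Rightarrow> expr \<Rightarrow> (nat \<Rightarrow> nat) \<Rightarrow> nat" where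
  "eval x (Var i) e = e i"
| "eval x One e = 1"
| "eval x Len e = length x"
| "eval x (Bit a) e = of_bool (eval x a e < length x \<and> x ! eval x a e)"
| "eval x (Plus a b) e = eval x a e + eval x b e"
| "eval x (Minus a b) e = eval x a e - eval x b e"
| "eval x (Sum a b) e = (\<Sum>i<eval x a e. eval x b (case_nat i e))"

text \<open>
  The program for an expression adds its value to register \<open>r\<close>, where register \<open>\<rho> i\<close> holds the
  \<open>i\<close>-th variable; the registers from \<open>s\<close> on are scratch space, zero before and after the run.
  Register 0 is the head on the input.
\<close>

fun prog :: "expr \<Rightarrow> (nat \<Rightarrow> nat) \<Rightarrow> nat \<Rightarrow> nat \<Rightarrow> com" where
  "prog (Var i) \<rho> r s =
     loop (\<rho> i) (Mv s Move_Right) ;; loop s (Mv (\<rho> i) Move_Right ;; Mv r Move_Right)"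
| "prog One \<rho> r s = Mv r Move_Right"
| "prog Len \<rho> r s =
     While 0 {0} (Mv 0 Move_Right ;; Mv r Move_Right ;; Mv s Move_Right) ;; loop s (Mv 0 Move_Left)"
| "prog (Bit a) \<rho> r s =
     prog a \<rho> s (s + 1) ;; loop s (Mv (s + 1) Move_Right ;; Mv 0 Move_Right) ;;
     Unless 0 (- {2}) (Mv r Move_Right) ;; loop (s + 1) (Mv 0 Move_Left)"
| "prog (Plus a b) \<rho> r s = prog a \<rho> r s ;; prog b \<rho> r s"
| "prog (Minus a b) \<rho> r s =
     prog a \<rho> s (s + 1) ;; prog b \<rho> (s + 1) (s + 2) ;;
     loop (s + 1) (Unless s {1} (Mv s Move_Left)) ;; loop s (Mv r Move_Right)"
| "prog (Sum a b) \<rho> r s = prog a \<rho> s (s + 1) ;; loop s (prog b (case_nat s \<rho>) r (s + 1))"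

text \<open>\<open>M\<close> bounds all variables as a polynomial in the input length. Under
  \<open>Sum\<close> the new variable lies below the value of \<open>a\<close>, which is why the
  body is bounded with respect to \<open>M + value_bound a M\<close>. For a fixed expression the
  nesting stays polynomial.\<close>

fun value_bound :: "expr \<Rightarrow> nat poly \<Rightarrow> nat poly" where
  "value_bound (Var i) M = M"
| "value_bound One M = 1"
| "value_bound Len M = [:0, 1:]"
| "value_bound (Bit a) M = 1"
| "value_bound (Plus a b) M = value_bound a M + value_bound b M"
| "value_bound (Minus a b) M = value_bound a M"
| "value_bound (Sum a b) M = value_bound a M * value_bound b (M + value_bound a M)"

text \<open>The constants add up the loops of \<open>prog\<close>: by \<open>runs_loop\<close>, a
  loop whose body costs \<open>B\<close> takes \<open>B + 3\<close> steps per round and 1 step for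
  the exit test.\<close>

fun time_bound :: "expr \<Rightarrow> nat poly \<Rightarrow> nat poly" where
  "time_bound (Var i) M = M * 9 + 2"
| "time_bound One M = 1"
| "time_bound Len M = [:2, 9:]"
| "time_bound (Bit a) M = time_bound a M + value_bound a M * 9 + 4"
| "time_bound (Plus a b) M = time_bound a M + time_bound b M"
| "time_bound (Minus a b) M =
     time_bound a M + time_bound b M + value_bound b M * 5 + value_bound a M * 4 + 2"
| "time_bound (Sum a b) M =
     time_bound a M + value_bound a M * (time_bound b (M + value_bound a M) + 3) + 1"

lemma eval_le: "(\<And>i. e i \<le> poly M (length x)) \<Longrightarrow> eval x a e \<le> poly (value_bound a M) (length x)"
proof (induction a arbitrary: e M)
  case (Sum a b)
  have a: "eval x a e \<le> poly (value_bound a M) (length x)"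
    using Sum by blast
  have "eval x b (case_nat i e) \<le> poly (value_bound b (M + value_bound a M)) (length x)"
    if "i < eval x a e" for i
  proof (rule Sum.IH(2))
    show "(case j of 0 \<Rightarrow> i | Suc n \<Rightarrow> e n) \<le> poly (M + value_bound a M) (length x)" for j
      using that a by (cases j) (simp_all add: trans_le_add1[OF Sum.prems])
  qed
  hence "(\<Sum>i<eval x a e. eval x b (case_nat i e)) \<le>
      of_nat (card {..<eval x a e}) * poly (value_bound b (M + value_bound a M)) (length x)"
    by (intro sum_bounded_above) simp
  also have "\<dots> \<le> poly (value_bound a M) (length x) * poly (value_bound b (M + value_bound a M)) (length x)"
    using a mult_le_mono1 by simp
  finally show ?case by simp
next
  case (Plus a b)
  thus ?case by (simp add: add_mono)
next
  case (Minus a b)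
  have "eval x a e \<le> poly (value_bound a M) (length x)"
    using Minus by blast
  thus ?case by simp
qed simp_all

definition frame_ok :: "(nat \<Rightarrow> nat) \<Rightarrow> nat \<Rightarrow> nat \<Rightarrow> (nat \<Rightarrow> nat) \<Rightarrow> (nat \<Rightarrow> nat) \<Rightarrow> bool" where
  "frame_ok \<rho> r s R e \<longleftrightarrow> R 0 = 0 \<and> (\<forall>q\<ge>s. R q = 0) \<and> 0 < r \<and> r < s \<and>
     (\<forall>i. 0 < \<rho> i \<and> \<rho> i \<noteq> r \<and> \<rho> i < s \<and> R (\<rho> i) = e i)"

lemma runs_prog:
  assumes "frame_ok \<rho> r s R e" "\<And>i. e i \<le> poly M (length x)"
  shows "runs x (prog a \<rho> r s) R (poly (time_bound a M) (length x)) (R(r := R r + eval x a e))"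
  using assms
proof (induction a arbitrary: \<rho> r s R e M)
  case (Var i)
  define q where "q = \<rho> i"
  have q: "0 < q" "q \<noteq> r" "q < s" "R q = e i" "R s = 0" "0 < r" "r < s"
    using Var(1) by (auto simp: q_def frame_ok_def)
  \<comment> \<open>Reading a counter empties it. The value is parked in \<open>s\<close> and then
    moved back to \<open>q\<close> and into \<open>r\<close> at the same time.\<close>
  have "runs x (loop q (Mv s Move_Right)) R (e i * (1 + 3) + 1) (R(q := 0, s := e i))"
    by (rule runs_loop[where F = "\<lambda>k. R(q := k, s := e i - k)"])
      (use q in \<open>auto intro!: runs_right simp: fun_eq_iff\<close>)
  moreover have "runs x (loop s (Mv q Move_Right ;; Mv r Move_Right)) (R(q := 0, s := e i))
      (e i * (1 + 1 + 3) + 1) (R(r := R r + e i))"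
    by (rule runs_loop[where F = "\<lambda>k. R(q := e i - k, s := k, r := R r + (e i - k))"])
      (use q in \<open>auto intro!: runs_right_Seq runs_right simp: fun_eq_iff\<close>)
  ultimately have "runs x (prog (Var i) \<rho> r s) R ((e i * (1 + 3) + 1) + (e i * (1 + 1 + 3) + 1))
      (R(r := R r + e i))"
    unfolding q_def[symmetric] prog.simps by (rule runs_Seq)
  thus ?case
    unfolding eval.simps by (rule runs_mono) (use Var(2)[of i] in simp)
next
  case (One \<rho> r s R e M)
  show ?case by (auto intro!: runs_right)
next
  case Len
  let ?n = "length x"
  have s: "R 0 = 0" "R s = 0" "0 < r" "r < s" using Len(1) by (auto simp: frame_ok_def)
  \<comment> \<open>The scan ends at the blank after the input; \<open>s\<close> counts along so
    that the head on the input can be brought back.\<close>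
  let ?F = "\<lambda>k. R(0 := ?n - k, s := ?n - k, r := R r + (?n - k))"
  have "runs x (While 0 {0} (Mv 0 Move_Right ;; Mv r Move_Right ;; Mv s Move_Right)) (?F ?n)
      (?n * (1 + (1 + 1) + 2) + 1) (?F 0)"
    by (rule runs_While)
      (use s in \<open>auto intro!: runs_right_Seq runs_right simp: fun_eq_iff cells_def input_tape_def\<close>)
  moreover have "?F ?n = R" using s by (auto simp: fun_eq_iff)
  moreover have "runs x (loop s (Mv 0 Move_Left)) (?F 0) (?n * (1 + 3) + 1) (R(r := R r + ?n))"
    by (rule runs_loop[where F = "\<lambda>k. R(0 := k, s := k, r := R r + ?n)"])
      (use s in \<open>auto intro!: runs_left simp: fun_eq_iff\<close>)
  ultimately have "runs x (prog Len \<rho> r s) R ((?n * (1 + (1 + 1) + 2) + 1) + (?n * (1 + 3) + 1))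
      (R(r := R r + ?n))"
    unfolding prog.simps using runs_Seq by metis
  thus ?case
    unfolding eval.simps by (rule runs_mono) simp
next
  case (Bit a)
  define v where "v = eval x a e"
  have s: "R 0 = 0" "R s = 0" "R (s + 1) = 0" "0 < r" "r < s"
    using Bit(2) by (auto simp: frame_ok_def)
  have v: "v \<le> poly (value_bound a M) (length x)"
    using eval_le Bit.prems(2) by (simp add: v_def)
  define u where "u = eval x (Bit a) e"
  have 1: "runs x (prog a \<rho> s (s + 1)) R (poly (time_bound a M) (length x)) (R(s := v))"
    using Bit.IH[of \<rho> s "s + 1" R e M] Bit.prems s by (auto simp: frame_ok_def v_def fun_upd_def less_Suc_eq)
  have 2: "runs x (loop s (Mv (s + 1) Move_Right ;; Mv 0 Move_Right)) (R(s := v))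
      (v * (1 + 1 + 3) + 1) (R(s + 1 := v, 0 := v))"
    by (rule runs_loop[where F = "\<lambda>k. R(s := k, s + 1 := v - k, 0 := v - k)"])
      (use s in \<open>auto intro!: runs_right_Seq runs_right simp: fun_eq_iff\<close>)
  \<comment> \<open>Symbol 2 is the bit \<open>True\<close>, and past the end of the input the head
    sees a blank. One test thus covers both the bit and the length condition.\<close>
  have 3: "runs x (Unless 0 (- {2}) (Mv r Move_Right)) (R(s + 1 := v, 0 := v)) 2
      (R(s + 1 := v, 0 := v, r := R r + u))"
  proof (cases "v < length x \<and> x ! v")
    case True
    have "runs x (Unless 0 (- {2}) (Mv r Move_Right)) (R(s + 1 := v, 0 := v)) (1 + 1)
      (R(s + 1 := v, 0 := v, r := R r + u))"
      using True s unfolding u_def eval.simps v_def[symmetric]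
      by (intro runs_Unless_do runs_right) (auto simp: cells_def input_tape_def fun_eq_iff)
    thus ?thesis by (simp add: numeral_2_eq_2)
  next
    case False
    hence "R(s + 1 := v, 0 := v) = R(s + 1 := v, 0 := v, r := R r + u)"
      using s unfolding u_def eval.simps v_def[symmetric] by (auto simp: fun_eq_iff)
    moreover have "runs x (Unless 0 (- {2}) (Mv r Move_Right)) (R(s + 1 := v, 0 := v)) 1
      (R(s + 1 := v, 0 := v))"
      using False by (intro runs_Unless_skip) (auto simp: cells_def input_tape_def)
    ultimately show ?thesis by (auto elim!: runs_mono)
  qed
  have 4: "runs x (loop (s + 1) (Mv 0 Move_Left)) (R(s + 1 := v, 0 := v, r := R r + u))
      (v * (1 + 3) + 1) (R(r := R r + u))"
    by (rule runs_loop[where F = "\<lambda>k. R(s + 1 := k, 0 := k, r := R r + u)"])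
      (use s in \<open>auto intro!: runs_left simp: fun_eq_iff\<close>)
  from runs_Seq[OF 1 runs_Seq[OF 2 runs_Seq[OF 3 4]]] show ?case
    unfolding u_def[symmetric] prog.simps by (rule runs_mono) (use v in simp)
next
  case (Plus a b)
  have 1: "runs x (prog a \<rho> r s) R (poly (time_bound a M) (length x)) (R(r := R r + eval x a e))"
    using Plus by blast
  have "frame_ok \<rho> r s (R(r := R r + eval x a e)) e"
    using Plus.prems(1) by (auto simp: frame_ok_def)
  from runs_Seq[OF 1 Plus.IH(2)[OF this Plus.prems(2)]]
  show ?case by (simp add: add.assoc fun_upd_def cong: if_cong)
next
  case (Minus a b)
  define u v where "u = eval x a e" and "v = eval x b e"
  have s: "R s = 0" "R (s + 1) = 0" "0 < r" "r < s"
    using Minus.prems(1) by (auto simp: frame_ok_def)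
  have uv: "u \<le> poly (value_bound a M) (length x)" "v \<le> poly (value_bound b M) (length x)"
    using eval_le Minus.prems(2) by (simp_all add: u_def v_def)
  have 1: "runs x (prog a \<rho> s (s + 1)) R (poly (time_bound a M) (length x)) (R(s := u))"
    using Minus.IH(1)[of \<rho> s "s + 1" R e M] Minus.prems s by (auto simp: frame_ok_def u_def fun_upd_def less_Suc_eq)
  have 2: "runs x (prog b \<rho> (s + 1) (s + 2)) (R(s := u)) (poly (time_bound b M) (length x))
      (R(s := u, s + 1 := v))"
  proof -
    have "\<rho> i < s" for i using Minus.prems(1) by (auto simp: frame_ok_def)
    hence "\<rho> i \<noteq> s \<and> \<rho> i \<noteq> s + 1 \<and> \<rho> i < s + 2" for i
      by (metis less_irrefl less_add_one less_trans trans_less_add1)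
    hence "frame_ok \<rho> (s + 1) (s + 2) (R(s := u)) e"
      using Minus.prems(1) by (auto simp: frame_ok_def)
    from Minus.IH(2)[OF this Minus.prems(2)] show ?thesis using s by (simp add: v_def fun_upd_def cong: if_cong)
  qed
  \<comment> \<open>Decrementing \<open>s\<close> at most \<open>v\<close> times, and never below
    the mark, yields truncated subtraction.\<close>
  have 3: "runs x (loop (s + 1) (Unless s {1} (Mv s Move_Left))) (R(s := u, s + 1 := v))
      (v * (2 + 3) + 1) (R(s := u - v))"
  proof (rule runs_loop[where F = "\<lambda>k. R(s := u - (v - k), s + 1 := k)"])
    fix k assume k: "k < v"
    show "runs x (Unless s {1} (Mv s Move_Left))
        ((R(s := u - (v - Suc k), s + 1 := Suc k))(s + 1 := k)) 2 (R(s := u - (v - k), s + 1 := k))"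
    proof (cases "u - (v - Suc k) = 0")
      case True
      have "runs x (Unless s {1} (Mv s Move_Left)) (R(s := u - (v - k), s + 1 := k)) 1
          (R(s := u - (v - k), s + 1 := k))"
        using True k s by (intro runs_Unless_skip) (auto simp: cells_def)
      moreover have "(R(s := u - (v - Suc k), s + 1 := Suc k))(s + 1 := k) =
          R(s := u - (v - k), s + 1 := k)"
        using True k by (auto simp: fun_eq_iff)
      ultimately show ?thesis by (auto elim!: runs_mono)
    next
      case False
      have "runs x (Unless s {1} (Mv s Move_Left))
        ((R(s := u - (v - Suc k), s + 1 := Suc k))(s + 1 := k)) (1 + 1) (R(s := u - (v - k), s + 1 := k))"
        using False k s by (intro runs_Unless_do runs_left) (auto simp: cells_def fun_eq_iff)
      thus ?thesis by (simp add: numeral_2_eq_2)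
    qed
  qed (use s in \<open>auto simp: fun_eq_iff\<close>)
  have 4: "runs x (loop s (Mv r Move_Right)) (R(s := u - v)) ((u - v) * (1 + 3) + 1)
      (R(r := R r + (u - v)))"
    by (rule runs_loop[where F = "\<lambda>k. R(s := k, r := R r + (u - v - k))"])
      (use s in \<open>auto intro!: runs_right simp: fun_eq_iff\<close>)
  from runs_Seq[OF 1 runs_Seq[OF 2 runs_Seq[OF 3 4]]] show ?case
    unfolding prog.simps eval.simps u_def[symmetric] v_def[symmetric]
    by (rule runs_mono) (use uv in simp)
next
  case (Sum a b)
  define u f where "u = eval x a e" and "f = (\<lambda>i. eval x b (case_nat i e))"
  let ?M = "M + value_bound a M"
  have s: "R s = 0" "0 < r" "r < s"
    using Sum.prems(1) by (auto simp: frame_ok_def)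
  have u: "u \<le> poly (value_bound a M) (length x)"
    using eval_le Sum.prems(2) by (simp add: u_def)
  have 1: "runs x (prog a \<rho> s (s + 1)) R (poly (time_bound a M) (length x)) (R(s := u))"
    using Sum.IH(1)[of \<rho> s "s + 1" R e M] Sum.prems s by (auto simp: frame_ok_def u_def fun_upd_def less_Suc_eq)
  \<comment> \<open>The loop counter \<open>s\<close> itself serves as the summation variable of the
    body, so the terms are added from the top index downwards.\<close>
  have 2: "runs x (loop s (prog b (case_nat s \<rho>) r (s + 1))) (R(s := u))
      (u * (poly (time_bound b ?M) (length x) + 3) + 1) (R(r := R r + (\<Sum>i<u. f i)))"
  proof (rule runs_loop[where F = "\<lambda>k. R(s := k, r := R r + (\<Sum>i\<in>{k..<u}. f i))"])
    fix k assume k: "k < u"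
    define R' where "R' = R(s := k, r := R r + (\<Sum>i\<in>{Suc k..<u}. f i))"
    have "frame_ok (case_nat s \<rho>) r (s + 1) R' (case_nat k e)"
      using Sum.prems(1) s by (auto simp: frame_ok_def R'_def less_Suc_eq split: nat.splits)
    moreover have "(case j of 0 \<Rightarrow> k | Suc n \<Rightarrow> e n) \<le> poly ?M (length x)" for j
      using k u by (cases j) (simp_all add: trans_le_add1[OF Sum.prems(2)])
    ultimately have "runs x (prog b (case_nat s \<rho>) r (s + 1)) R' (poly (time_bound b ?M) (length x))
        (R'(r := R' r + f k))"
      unfolding f_def by (rule Sum.IH(2))
    moreover have "R'(r := R' r + f k) = R(s := k, r := R r + (\<Sum>i\<in>{k..<u}. f i))"
      using k s by (auto simp: R'_def fun_eq_iff sum.atLeast_Suc_lessThan[of k u])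
    moreover have "R' = (R(s := Suc k, r := R r + (\<Sum>i\<in>{Suc k..<u}. f i)))(s := k)"
      using s by (auto simp: R'_def fun_eq_iff)
    ultimately show "runs x (prog b (case_nat s \<rho>) r (s + 1))
        ((R(s := Suc k, r := R r + (\<Sum>i\<in>{Suc k..<u}. f i)))(s := k))
        (poly (time_bound b ?M) (length x)) (R(s := k, r := R r + (\<Sum>i\<in>{k..<u}. f i)))"
      by simp
  qed (use s in \<open>auto simp: fun_eq_iff atLeast0LessThan\<close>)
  from runs_Seq[OF 1 2] show ?case
    unfolding prog.simps eval.simps u_def[symmetric] f_def[symmetric]
    by (rule runs_mono) (use u in simp)
qed

lemma eval_class_P: "{x. eval x a (\<lambda>_. 0) \<noteq> 0} \<in> class_P"
proof (rule exec_class_P)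
  fix x
  \<comment> \<open>Register 1 receives the result, since the final test looks there. Register 2
    stays 0 and stands for all variables at once; scratch space begins at 3.\<close>
  have "runs x (prog a (\<lambda>_. 2) 1 3) (\<lambda>_. 0) (poly (time_bound a 0) (length x))
      ((\<lambda>_. 0)(1 := 0 + eval x a (\<lambda>_. 0)))"
    by (rule runs_prog) (auto simp: frame_ok_def)
  then obtain t where "t \<le> poly (time_bound a 0) (length x)"
    "exec x (prog a (\<lambda>_. 2) 1 3) (int \<circ> (\<lambda>_. 0)) t (int \<circ> ((\<lambda>_. 0)(1 := 0 + eval x a (\<lambda>_. 0))))"
    unfolding runs_def by blast
  moreover have "int \<circ> (\<lambda>_ :: nat. 0) = (\<lambda>_. 0)" by auto
  ultimately have "exec x (prog a (\<lambda>_. 2) 1 3) (\<lambda>_. 0) t (int \<circ> ((\<lambda>_. 0)(1 := 0 + eval x a (\<lambda>_. 0))))"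
    by metis
  with \<open>t \<le> _\<close> show "\<exists>t h. t \<le> poly (time_bound a 0) (length x) \<and>
      exec x (prog a (\<lambda>_. 2) 1 3) (\<lambda>_. 0) t h \<and> (h 1 \<noteq> 0 \<longleftrightarrow> x \<in> {x. eval x a (\<lambda>_. 0) \<noteq> 0})"
    by (intro exI[of _ t] exI[of _ "int \<circ> ((\<lambda>_. 0)(1 := 0 + eval x a (\<lambda>_. 0)))"]) auto
qed

section \<open>Closure properties of functions given by expressions\<close>

text \<open>One expression has to serve all inputs and environments. With this notion a check can be
  written as an ordinary HOL function, and the closure rules supply the expression behind
  it.\<close>

definition feasible :: "(bool list \<Rightarrow> (nat \<Rightarrow> nat) \<Rightarrow> nat) \<Rightarrow> bool" where
  "feasible f \<longleftrightarrow> (\<exists>a. \<forall>x e. eval x a e = f x e)"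

lemma feasible_class_P:
  assumes "feasible (\<lambda>x e. of_bool (P x))"
  shows "{x. P x} \<in> class_P"
proof -
  obtain a where "eval x a e = of_bool (P x)" for x e using assms by (auto simp: feasible_def)
  thus ?thesis using eval_class_P[of a] by simp
qed

lemma feasible_var: "feasible (\<lambda>x e. e i)"
  unfolding feasible_def by (rule exI[of _ "Var i"]) simp

lemma feasible_length: "feasible (\<lambda>x e. length x)"
  unfolding feasible_def by (rule exI[of _ Len]) simp

lemma feasible_plus: "feasible a \<Longrightarrow> feasible b \<Longrightarrow> feasible (\<lambda>x e. a x e + b x e)"
  unfolding feasible_def by (metis eval.simps(5))

lemma feasible_minus: "feasible a \<Longrightarrow> feasible b \<Longrightarrow> feasible (\<lambda>x e. a x e - b x e)"
  unfolding feasible_def by (metis eval.simps(6))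

lemma feasible_bit: "feasible a \<Longrightarrow> feasible (\<lambda>x e. of_bool (a x e < length x \<and> x ! a x e))"
  unfolding feasible_def by (metis eval.simps(4))

lemma feasible_const: "feasible (\<lambda>x e. c)"
proof (induction c)
  case 0
  show ?case unfolding feasible_def by (rule exI[of _ "Minus One One"]) simp
next
  case (Suc c)
  have "feasible (\<lambda>x e. 1)" unfolding feasible_def by (rule exI[of _ One]) simp
  from feasible_plus[OF Suc this] show ?case by simp
qed

lemma feasible_Suc: "feasible a \<Longrightarrow> feasible (\<lambda>x e. Suc (a x e))"
  using feasible_plus[OF _ feasible_const[of 1]] by simp

text \<open>The second premise is the body with its bound variable turned into variable 0 and the
  others shifted. Higher-order unification performs this passage to de Bruijn indices whenever the
  rule is applied.\<close>

lemma feasible_sum: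
  assumes "feasible b" "feasible (\<lambda>x e. f x (\<lambda>n. e (Suc n)) (e 0))"
  shows "feasible (\<lambda>x e. \<Sum>i<b x e. f x e i)"
proof -
  from assms obtain b' f' where "eval x b' e = b x e" "eval x f' e = f x (\<lambda>n. e (Suc n)) (e 0)" for x e
    by (auto simp: feasible_def)
  thus ?thesis unfolding feasible_def by (intro exI[of _ "Sum b' f'"]) simp
qed

fun rename :: "(nat \<Rightarrow> nat) \<Rightarrow> expr \<Rightarrow> expr" where
  "rename r (Var i) = Var (r i)"
| "rename r One = One"
| "rename r Len = Len"
| "rename r (Bit a) = Bit (rename r a)"
| "rename r (Plus a b) = Plus (rename r a) (rename r b)"
| "rename r (Minus a b) = Minus (rename r a) (rename r b)"
| "rename r (Sum a b) = Sum (rename r a) (rename (case_nat 0 (\<lambda>n. Suc (r n))) b)"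

text \<open>Renaming provides weakening: a subterm placed beneath a new binder must have its
  variables shifted.\<close>

lemma eval_rename: "eval x (rename r a) e = eval x a (\<lambda>n. e (r n))"
proof (induction a arbitrary: r e)
  case (Sum a b)
  have "(\<lambda>n. case_nat i e (case_nat 0 (\<lambda>n. Suc (r n)) n)) = case_nat i (\<lambda>n. e (r n))" for i
    by (auto simp: fun_eq_iff split: nat.splits)
  thus ?case by (simp add: Sum)
qed simp_all

lemma feasible_rename: "feasible f \<Longrightarrow> feasible (\<lambda>x e. f x (\<lambda>n. e (r n)))"
  unfolding feasible_def by (metis eval_rename)

lemma feasible_times:
  assumes "feasible a" "feasible b"
  shows "feasible (\<lambda>x e. a x e * b x e)"
proof -
  have "feasible (\<lambda>x e. \<Sum>i<a x e. b x e)"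
    by (rule feasible_sum[of a "\<lambda>x e _. b x e"]) (rule assms feasible_rename[OF assms(2)])+
  thus ?thesis by simp
qed

lemma feasible_not:
  assumes "feasible (\<lambda>x e. of_bool (P x e))"
  shows "feasible (\<lambda>x e. of_bool (\<not> P x e))"
proof -
  have "feasible (\<lambda>x e. 1 - of_bool (P x e))" by (intro feasible_minus feasible_const assms)
  moreover have "1 - of_bool p = (of_bool (\<not> p) :: nat)" for p by simp
  ultimately show ?thesis by simp
qed

lemma feasible_conj:
  "feasible (\<lambda>x e. of_bool (P x e)) \<Longrightarrow> feasible (\<lambda>x e. of_bool (Q x e)) \<Longrightarrow>
    feasible (\<lambda>x e. of_bool (P x e \<and> Q x e))"
  using feasible_times[of "\<lambda>x e. of_bool (P x e)" "\<lambda>x e. of_bool (Q x e)"]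
  by (simp add: of_bool_conj)

lemma feasible_disj:
  assumes "feasible (\<lambda>x e. of_bool (P x e))" "feasible (\<lambda>x e. of_bool (Q x e))"
  shows "feasible (\<lambda>x e. of_bool (P x e \<or> Q x e))"
proof -
  have "feasible (\<lambda>x e. of_bool (\<not> (\<not> P x e \<and> \<not> Q x e)))"
    by (intro feasible_not feasible_conj assms)
  thus ?thesis by simp
qed

lemma feasible_imp:
  assumes "feasible (\<lambda>x e. of_bool (P x e))" "feasible (\<lambda>x e. of_bool (Q x e))"
  shows "feasible (\<lambda>x e. of_bool (P x e \<longrightarrow> Q x e))"
  unfolding imp_conv_disj by (intro feasible_disj feasible_not assms)

lemma feasible_iff:
  assumes "feasible (\<lambda>x e. of_bool (P x e))" "feasible (\<lambda>x e. of_bool (Q x e))"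
  shows "feasible (\<lambda>x e. of_bool (P x e \<longleftrightarrow> Q x e))"
  unfolding iff_conv_conj_imp by (intro feasible_conj feasible_imp assms)

lemma feasible_le:
  assumes "feasible a" "feasible b"
  shows "feasible (\<lambda>x e. of_bool (a x e \<le> b x e))"
proof -
  have "feasible (\<lambda>x e. 1 - (a x e - b x e))"
    by (intro feasible_minus feasible_const assms)
  moreover have "1 - (m - n) = of_bool (m \<le> n)" for m n :: nat by auto
  ultimately show ?thesis by simp
qed

lemma feasible_less:
  assumes "feasible a" "feasible b"
  shows "feasible (\<lambda>x e. of_bool (a x e < b x e))"
  unfolding less_eq_Suc_le by (intro feasible_le feasible_Suc assms)

lemma feasible_eq:
  assumes "feasible a" "feasible b"
  shows "feasible (\<lambda>x e. of_bool (a x e = b x e))"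
  using feasible_conj[OF feasible_le[OF assms] feasible_le[OF assms(2,1)]] by (simp add: eq_iff)

lemma feasible_ex:
  assumes "feasible b" "feasible (\<lambda>x e. of_bool (P x (\<lambda>n. e (Suc n)) (e 0)))"
  shows "feasible (\<lambda>x e. of_bool (\<exists>i<b x e. P x e i))"
proof -
  have "feasible (\<lambda>x e. of_bool (1 \<le> (\<Sum>i<b x e. of_bool (P x e i) :: nat)))"
    by (intro feasible_le feasible_const feasible_sum assms)
  moreover have "1 \<le> (\<Sum>i<n. of_bool (Q i) :: nat) \<longleftrightarrow> (\<exists>i<n. Q i)" for n :: nat and Q
    by (auto simp: Suc_le_eq card_gt_0_iff)
  ultimately show ?thesis by (simp only:)
qed

lemma feasible_all:
  assumes "feasible b" "feasible (\<lambda>x e. of_bool (P x (\<lambda>n. e (Suc n)) (e 0)))"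
  shows "feasible (\<lambda>x e. of_bool (\<forall>i<b x e. P x e i))"
proof -
  have "feasible (\<lambda>x e. of_bool (\<not> (\<exists>i<b x e. \<not> P x e i)))"
    by (intro feasible_not feasible_ex assms)
  thus ?thesis by simp
qed

lemma feasible_if:
  assumes "feasible (\<lambda>x e. of_bool (P x e))" "feasible a" "feasible b"
  shows "feasible (\<lambda>x e. if P x e then a x e else b x e)"
proof -
  have "feasible (\<lambda>x e. of_bool (P x e) * a x e + of_bool (\<not> P x e) * b x e)"
    by (intro feasible_plus feasible_times feasible_not assms)
  moreover have "of_bool (P x e) * a x e + of_bool (\<not> P x e) * b x e =
      (if P x e then a x e else b x e)" for x e by simp
  ultimately show ?thesis by simp
qed

text \<open>A computed value is bound by a sum with a single nonzero term, the one whose index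
  equals \<open>a x e\<close>.\<close>

lemma feasible_let:
  assumes "feasible a" "feasible (\<lambda>x e. f x (\<lambda>n. e (Suc n)) (e 0))"
  shows "feasible (\<lambda>x e. f x e (a x e))"
proof -
  have "feasible (\<lambda>x e. \<Sum>i<Suc (a x e). of_bool (i = a x e) * f x e i)"
    by (rule feasible_sum feasible_Suc feasible_times feasible_eq feasible_var assms
      feasible_rename[OF assms(1), where r = Suc])+
  moreover have "(\<Sum>i<Suc n. of_bool (i = n) * g i) = g n" for n and g :: "nat \<Rightarrow> nat"
    by simp
  ultimately show ?thesis by simp
qed

lemma feasible_comp:
  assumes "feasible (\<lambda>x e. f x (e 0))" "feasible a"
  shows "feasible (\<lambda>x e. f x (a x e))"
  using assms by (intro feasible_let[of a "\<lambda>x e. f x"])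

lemma feasible_comp2:
  assumes "feasible (\<lambda>x e. f x (e 0) (e 1))" "feasible a" "feasible b"
  shows "feasible (\<lambda>x e. f x (a x e) (b x e))"
proof (rule feasible_let[of a "\<lambda>x e i. f x i (b x e)"])
  show "feasible (\<lambda>x e. f x (e 0) (b x (\<lambda>n. e (Suc n))))"
  proof (rule feasible_let[of "\<lambda>x e. b x (\<lambda>n. e (Suc n))" "\<lambda>x e i. f x (e 0) i"])
    \<comment> \<open>Binding the two arguments one inside the other reverses their order;
      \<open>1 - n\<close> exchanges the variables 0 and 1.\<close>
    show "feasible (\<lambda>x e. f x (e (Suc 0)) (e 0))"
      using feasible_rename[OF assms(1), of "\<lambda>n. 1 - n"] by simp
  qed (rule feasible_rename[OF assms(3), where r = Suc])
qed (rule assms)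

lemma feasible_poly: "feasible a \<Longrightarrow> feasible (\<lambda>x e. poly p (a x e))"
proof (induction p)
  case 0
  show ?case by (simp add: feasible_const)
next
  case (pCons c p)
  thus ?case by (simp add: feasible_plus feasible_times feasible_const)
qed

lemmas feasible_intros =
  feasible_const feasible_var feasible_length feasible_plus feasible_minus feasible_Suc
  feasible_times feasible_sum feasible_if feasible_poly
  feasible_not feasible_conj feasible_disj feasible_imp feasible_iff feasible_le feasible_less
  feasible_eq feasible_ex feasible_all

section \<open>Counting certificates\<close>

definition bit_at :: "bool list \<Rightarrow> nat \<Rightarrow> bool" where
  "bit_at z i \<longleftrightarrow> i < length z \<and> z ! i"

lemma feasible_bit_at: "feasible a \<Longrightarrow> feasible (\<lambda>z e. of_bool (bit_at z (a z e)))"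
  unfolding bit_at_def by (rule feasible_bit)

text \<open>In \<open>framed x\<close> the even positions hold \<open>True\<close> up to the
  terminator, which is \<open>False\<close>. The first component is therefore as long as the initial
  run of \<open>True\<close> at even positions.\<close>

definition fst_length :: "bool list \<Rightarrow> nat" where
  "fst_length z = (\<Sum>i<length z. of_bool (\<forall>j<Suc i. bit_at z (2 * j)))"

lemma feasible_fst_length: "feasible (\<lambda>z e. fst_length z)"
  unfolding fst_length_def by (intro feasible_intros feasible_bit_at)

definition fst_bit :: "bool list \<Rightarrow> nat \<Rightarrow> bool" where
  "fst_bit z i \<longleftrightarrow> i < fst_length z \<and> bit_at z (2 * i + 1)"

lemma feasible_fst_bit: "feasible a \<Longrightarrow> feasible (\<lambda>z e. of_bool (fst_bit z (a z e)))"
  unfolding fst_bit_def by (intro feasible_intros feasible_fst_length feasible_bit_at)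

definition snd_bit :: "bool list \<Rightarrow> nat \<Rightarrow> bool" where
  "snd_bit z i \<longleftrightarrow> bit_at z (2 * fst_length z + 1 + i)"

lemma feasible_snd_bit: "feasible a \<Longrightarrow> feasible (\<lambda>z e. of_bool (snd_bit z (a z e)))"
  unfolding snd_bit_def by (intro feasible_intros feasible_fst_length feasible_bit_at)

lemma length_framed [simp]: "length (framed x) = 2 * length x + 1"
  by (induction x) (auto simp: framed_def)

lemma nth_framed:
  "i < length x \<Longrightarrow> framed x ! (2 * i)" "i < length x \<Longrightarrow> framed x ! Suc (2 * i) = x ! i"
  "\<not> framed x ! (2 * length x)"
proof -
  have framed_Cons: "framed (b # x) = True # b # framed x" for b x by (simp add: framed_def)
  show "i < length x \<Longrightarrow> framed x ! (2 * i)" "i < length x \<Longrightarrow> framed x ! Suc (2 * i) = x ! i"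
    by (induction x arbitrary: i) (auto simp: framed_Cons less_Suc_eq_0_disj)
  show "\<not> framed x ! (2 * length x)"
    by (induction x) (simp_all add: framed_Cons, simp add: framed_def)
qed

lemma fst_length_pair [simp]: "fst_length (pair_string x y) = length x"
proof -
  let ?z = "pair_string x y"
  have "(\<forall>j<Suc i. bit_at ?z (2 * j)) \<longleftrightarrow> i < length x" for i
  proof
    assume *: "\<forall>j<Suc i. bit_at ?z (2 * j)"
    show "i < length x"
    proof (rule ccontr)
      assume "\<not> i < length x"
      hence "bit_at ?z (2 * length x)" using * by simp
      thus False using nth_framed(3)[of x] by (simp add: bit_at_def pair_string_def nth_append)
    qed
  next
    assume "i < length x"
    thus "\<forall>j<Suc i. bit_at ?z (2 * j)"
      by (auto simp: bit_at_def pair_string_def nth_append nth_framed)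
  qed
  hence "fst_length ?z = card ({..<length ?z} \<inter> {i. i < length x})"
    by (simp add: fst_length_def of_bool_def sum.If_cases)
  also have "{..<length ?z} \<inter> {i. i < length x} = {..<length x}"
    by (auto simp: pair_string_def)
  finally show ?thesis by simp
qed

lemma fst_bit_pair [simp]: "fst_bit (pair_string x y) = bit_at x"
proof
  show "fst_bit (pair_string x y) i \<longleftrightarrow> bit_at x i" for i
    by (cases "i < length x")
      (simp_all add: fst_bit_def, simp_all add: bit_at_def pair_string_def nth_append nth_framed)
qed

lemma snd_bit_pair [simp]: "snd_bit (pair_string x y) = bit_at y"
  by (rule ext, simp add: snd_bit_def) (simp add: bit_at_def pair_string_def nth_append)

text \<open>
  A certificate of \<open>q\<^sup>2\<close> bits is read as \<open>q\<close> numbers \<open>k \<le> q\<close>, each written as \<open>k\<close> ones followed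
  by \<open>q - k\<close> zeros.
\<close>

definition entry :: "nat \<Rightarrow> (nat \<Rightarrow> bool) \<Rightarrow> nat \<Rightarrow> nat" where
  "entry q Y a = (if a < q then \<Sum>l<q. of_bool (Y (a * q + l)) else 0)"

definition unary_blocks :: "nat \<Rightarrow> (nat \<Rightarrow> bool) \<Rightarrow> bool" where
  "unary_blocks q Y \<longleftrightarrow> (\<forall>a<q. \<forall>l<q. 0 < l \<longrightarrow> Y (a * q + l) \<longrightarrow> Y (a * q + (l - 1)))"

text \<open>If the last index satisfies \<open>P\<close>, downward closure makes the whole range
  true; otherwise it contributes nothing and the induction hypothesis applies. A block of ones
  followed by zeros is thus determined by the number it spells.\<close>

lemma sum_of_bool_initial:
  "(\<forall>l<q. 0 < l \<longrightarrow> P l \<longrightarrow> P (l - 1)) \<Longrightarrow> l < q \<Longrightarrow> P l \<longleftrightarrow> l < (\<Sum>l<q. of_bool (P l) :: nat)"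
proof (induction q arbitrary: l)
  case (Suc q)
  have le: "(\<Sum>l<q. of_bool (P l) :: nat) \<le> q"
    using sum_bounded_above[of "{..<q}" "\<lambda>l. of_bool (P l) :: nat" 1] by simp
  show ?case
  proof (cases "P q")
    case True
    have closed: "P (m - 1)" if "0 < m" "m \<le> q" "P m" for m using Suc.prems(1) that by simp
    have "P (q - k)" for k
    proof (induction k)
      case (Suc k)
      thus ?case using closed[of "q - k"] by (cases "q \<le> k") simp_all
    qed (simp add: True)
    hence *: "P l" if "l \<le> q" for l using that by (metis diff_diff_cancel)
    have "(\<Sum>l<Suc q. of_bool (P l) :: nat) = (\<Sum>l<Suc q. 1)"
      by (intro sum.cong) (auto simp: *)
    thus ?thesis using Suc.prems(2) * by simp
  next
    case False
    thus ?thesis using Suc.IH[of l] Suc.prems le by (cases "l = q") auto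
  qed
qed simp

definition digits :: "nat \<Rightarrow> (nat \<Rightarrow> nat) \<Rightarrow> bool list" where
  "digits q u = map (\<lambda>p. p mod q < u (p div q)) [0..<q * q]"

lemma bit_at_digits: "a < q \<Longrightarrow> l < q \<Longrightarrow> bit_at (digits q u) (a * q + l) \<longleftrightarrow> l < u a"
proof -
  assume "a < q" "l < q"
  hence "a * q + l < q * q"
    by (metis add_less_cancel_left less_le_trans mult_le_mono1 mult_Suc Suc_leI add.commute)
  thus ?thesis using \<open>l < q\<close> by (simp add: bit_at_def digits_def)
qed

text \<open>From here on bit strings disappear from the counting: a certificate is a function with
  values at most \<open>q\<close> that vanishes from \<open>q\<close> on. Without
  \<open>unary_blocks\<close> one function would be spelled by many strings.\<close>

lemma entry_bij:
  "bij_betw (\<lambda>y. entry q (bit_at y)) {y. length y = q * q \<and> unary_blocks q (bit_at y)}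
     {u. (\<forall>a. u a \<le> q) \<and> (\<forall>a\<ge>q. u a = 0)}"
proof (rule bij_betw_byWitness[where f' = "digits q"])
  have *: "bit_at y (a * q + l) \<longleftrightarrow> l < entry q (bit_at y) a"
    if "unary_blocks q (bit_at y)" "a < q" "l < q" for y a l
    using sum_of_bool_initial[of q "\<lambda>l. bit_at y (a * q + l)" l] that
    by (simp add: entry_def unary_blocks_def)
  show "\<forall>y\<in>{y. length y = q * q \<and> unary_blocks q (bit_at y)}. digits q (entry q (bit_at y)) = y"
  proof (intro ballI nth_equalityI)
    fix y p assume y: "y \<in> {y. length y = q * q \<and> unary_blocks q (bit_at y)}"
      and "p < length (digits q (entry q (bit_at y)))"
    hence p: "p < q * q" by (simp add: digits_def)
    hence "q > 0" by (cases q) auto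
    hence "p div q < q" "p mod q < q" using p by (simp_all add: less_mult_imp_div_less)
    with *[of y "p div q" "p mod q"] y p show "digits q (entry q (bit_at y)) ! p = y ! p"
      by (simp add: digits_def bit_at_def)
  qed (simp add: digits_def)
  have entry: "entry q (bit_at (digits q u)) = u"
    if "\<forall>a. u a \<le> q" "\<forall>a\<ge>q. u a = 0" for u
  proof
    fix a
    show "entry q (bit_at (digits q u)) a = u a"
    proof (cases "a < q")
      case True
      hence "entry q (bit_at (digits q u)) a = (\<Sum>l<q. of_bool (l < u a))"
        by (simp add: entry_def bit_at_digits)
      also have "\<dots> = card ({..<q} \<inter> {l. l < u a})" by (simp add: of_bool_def sum.If_cases)
      also have "{..<q} \<inter> {l. l < u a} = {..<u a}" using that(1) by (auto intro: less_le_trans)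
      finally show ?thesis by simp
    qed (use that(2) in \<open>simp add: entry_def\<close>)
  qed
  thus "\<forall>u\<in>{u. (\<forall>a. u a \<le> q) \<and> (\<forall>a\<ge>q. u a = 0)}. entry q (bit_at (digits q u)) = u" by auto
  show "(\<lambda>y. entry q (bit_at y)) ` {y. length y = q * q \<and> unary_blocks q (bit_at y)}
      \<subseteq> {u. (\<forall>a. u a \<le> q) \<and> (\<forall>a\<ge>q. u a = 0)}"
    using sum_bounded_above[of "{..<q}" "\<lambda>l. of_bool (_ l) :: nat" 1] by (auto simp: entry_def)
  show "digits q ` {u. (\<forall>a. u a \<le> q) \<and> (\<forall>a\<ge>q. u a = 0)}
      \<subseteq> {y. length y = q * q \<and> unary_blocks q (bit_at y)}"
  proof safe
    fix u :: "nat \<Rightarrow> nat" assume "\<forall>a. u a \<le> q"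
    show "unary_blocks q (bit_at (digits q u))"
      unfolding unary_blocks_def
    proof (intro allI impI)
      fix a l assume "a < q" "l < q" "0 < l" "bit_at (digits q u) (a * q + l)"
      thus "bit_at (digits q u) (a * q + (l - 1))"
        using bit_at_digits[of a q l u] bit_at_digits[of a q "l - 1" u] by simp
    qed
  qed (simp add: digits_def)
qed

definition cert :: "nat poly \<Rightarrow> bool list \<Rightarrow> nat \<Rightarrow> nat" where
  "cert Q z = entry (poly Q (fst_length z)) (snd_bit z)"

lemma feasible_cert:
  assumes "feasible a"
  shows "feasible (\<lambda>z e. cert Q z (a z e))"
proof (rule feasible_comp[OF _ assms])
  show "feasible (\<lambda>z e. cert Q z (e 0))"
    unfolding cert_def entry_def
    by (intro feasible_intros feasible_fst_length feasible_snd_bit)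
qed

text \<open>The witness length is \<open>poly (Q * Q)\<close> because one bound serves for both the
  number of entries and their size. The test of \<open>unary_blocks\<close> is part of the language,
  so each \<open>u\<close> is counted through a single string.\<close>

lemma card_certificates_sharp_P:
  fixes Q :: "nat poly" and \<phi> :: "nat \<Rightarrow> (nat \<Rightarrow> bool) \<Rightarrow> (nat \<Rightarrow> nat) \<Rightarrow> bool"
  assumes "feasible (\<lambda>z e. of_bool (\<phi> (fst_length z) (fst_bit z) (cert Q z)))"
  shows "(\<lambda>x. card {u. (\<forall>a. u a \<le> poly Q (length x)) \<and> (\<forall>a\<ge>poly Q (length x). u a = 0) \<and>
    \<phi> (length x) (bit_at x) u}) \<in> sharp_P"
proof -
  define L where "L = {z. unary_blocks (poly Q (fst_length z)) (snd_bit z) \<and>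
    \<phi> (fst_length z) (fst_bit z) (cert Q z)}"
  have "L \<in> class_P"
    unfolding L_def
    by (intro feasible_class_P feasible_conj assms)
      (unfold unary_blocks_def, intro feasible_intros feasible_fst_length feasible_snd_bit)
  moreover have "card {u. (\<forall>a. u a \<le> poly Q (length x)) \<and> (\<forall>a\<ge>poly Q (length x). u a = 0) \<and>
      \<phi> (length x) (bit_at x) u} = card {y. length y = poly (Q * Q) (length x) \<and> pair_string x y \<in> L}"
    for x
  proof -
    define q where "q = poly Q (length x)"
    have "bij_betw (\<lambda>y. entry q (bit_at y))
        {y \<in> {y. length y = q * q \<and> unary_blocks q (bit_at y)}. \<phi> (length x) (bit_at x) (entry q (bit_at y))}
        {u \<in> {u. (\<forall>a. u a \<le> q) \<and> (\<forall>a\<ge>q. u a = 0)}. \<phi> (length x) (bit_at x) u}"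
      using entry_bij[of q] unfolding bij_betw_def by (auto intro: inj_on_subset)
    moreover have "{y \<in> {y. length y = q * q \<and> unary_blocks q (bit_at y)}. \<phi> (length x) (bit_at x) (entry q (bit_at y))}
        = {y. length y = poly (Q * Q) (length x) \<and> pair_string x y \<in> L}"
      by (auto simp: L_def cert_def q_def)
    ultimately show ?thesis
      by (auto simp: q_def dest!: bij_betw_same_card)
  qed
  ultimately show ?thesis unfolding sharp_P_def by blast
qed

section \<open>Checking codes, digits and chains\<close>

lemma length_unary [simp]: "length (unary k) = Suc k"
  by (simp add: unary_def)

lemma nth_unary: "j \<le> k \<Longrightarrow> unary k ! j \<longleftrightarrow> j < k"
  by (auto simp: unary_def nth_append)

lemma bit_at_drop: "bit_at (drop k xs) p \<longleftrightarrow> bit_at xs (k + p)"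
  by (auto simp: bit_at_def add.commute)

lemma eq_append_iff_bit_at:
  "xs = b @ ys \<longleftrightarrow> length b \<le> length xs \<and> (\<forall>k<length b. bit_at xs k = b ! k) \<and> drop (length b) xs = ys"
proof
  assume *: "length b \<le> length xs \<and> (\<forall>k<length b. bit_at xs k = b ! k) \<and> drop (length b) xs = ys"
  hence "take (length b) xs = b"
    by (intro nth_equalityI) (auto simp: bit_at_def)
  thus "xs = b @ ys" using * by (metis append_take_drop_id)
qed (auto simp: bit_at_def nth_append)

text \<open>Parsing becomes a set of conditions on single positions, each block being located by the
  sum of the preceding lengths. In this form bounded sums and quantifiers can express it.\<close>

lemma eq_concat_iff_bit_at:
  "xs = concat bl \<longleftrightarrow> length xs = (\<Sum>j<length bl. length (bl ! j)) \<and>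
     (\<forall>i<length bl. \<forall>k<length (bl ! i). bit_at xs ((\<Sum>j<i. length (bl ! j)) + k) = bl ! i ! k)"
proof (induction bl arbitrary: xs)
  case (Cons b bl)
  have all: "(\<forall>i<Suc n. Q i) \<longleftrightarrow> Q 0 \<and> (\<forall>i<n. Q (Suc i))" for n and Q :: "nat \<Rightarrow> bool"
    by (auto simp: less_Suc_eq_0_disj)
  show ?case
    by (auto simp: eq_append_iff_bit_at Cons.IH bit_at_drop all sum.lessThan_Suc_shift add.assoc
        simp del: sum.lessThan_Suc)
qed simp

lemma unary_block_iff:
  "(\<forall>j<length (unary k). X (p + j) = unary k ! j) \<longleftrightarrow> (\<forall>j<k. X (p + j)) \<and> \<not> X (p + k)"
  by (auto simp: nth_unary less_Suc_eq)

lemma framed_block_iff: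
  "(\<forall>j<length (framed b). X (p + j) = framed b ! j) \<longleftrightarrow>
     (\<forall>j<length b. X (p + 2 * j) \<and> X (p + (2 * j + 1)) = b ! j) \<and> \<not> X (p + 2 * length b)"
  (is "?L \<longleftrightarrow> ?R")
proof
  assume L: ?L
  show ?R
  proof (intro conjI allI impI)
    fix j assume "j < length b"
    thus "X (p + 2 * j)" "X (p + (2 * j + 1)) = b ! j"
      using L[rule_format, of "2 * j"] L[rule_format, of "2 * j + 1"] by (simp_all add: nth_framed)
  next
    show "\<not> X (p + 2 * length b)" using L[rule_format, of "2 * length b"] by (simp add: nth_framed)
  qed
next
  assume R: ?R
  show ?L
  proof (intro allI impI)
    fix j assume j: "j < length (framed b)"
    show "X (p + j) = framed b ! j"
    proof (cases "even j")
      case True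
      then obtain i where i: "j = 2 * i" by blast
      show ?thesis
      proof (cases "i < length b")
        case True
        thus ?thesis using R i nth_framed(1)[of i b] by simp
      next
        case False
        hence "i = length b" using i j by simp
        thus ?thesis using R i nth_framed(3)[of b] by simp
      qed
    next
      case False
      then obtain i where "j = 2 * i + 1" by (elim oddE)
      thus ?thesis using R j by (auto simp: nth_framed)
    qed
  qed
qed

text \<open>Digits are addressed from the least significant end, so they are bits in the sense of \<open>bit\<close>.\<close>

lemma binary_bits:
  "binary n = rev (map (bit n) [0..<length (binary n)])"
  "binary n \<noteq> [] \<Longrightarrow> bit n (length (binary n) - 1)"
  "length (binary n) \<le> k \<Longrightarrow> \<not> bit n k"
proof -
  have *: "binary n = rev (map (bit n) [0..<length (binary n)]) \<and>
    (binary n \<noteq> [] \<longrightarrow> bit n (length (binary n) - 1)) \<and> (\<forall>k\<ge>length (binary n). \<not> bit n k)"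
  proof (induction n rule: binary.induct)
    case (1 n)
    show ?case
    proof (cases "n = 0")
      case True
      thus ?thesis by (simp add: binary.simps)
    next
      case False
      let ?L = "length (binary (n div 2))"
      note IH = 1[OF False]
      have bin: "binary n = binary (n div 2) @ [odd n]" using False by (subst binary.simps) simp
      have bit_Suc': "bit n (Suc k) = bit (n div 2) k" for k by (simp add: bit_Suc)
      have "rev (map (bit n) [0..<Suc ?L]) = rev (map (bit (n div 2)) [0..<?L]) @ [odd n]"
        by (simp add: upt_conv_Cons map_Suc_upt[symmetric] bit_Suc' comp_def bit_0 del: upt_Suc)
      hence 1: "binary n = rev (map (bit n) [0..<length (binary n)])"
        using IH bin by simp
      have 2: "bit n ?L"
      proof (cases ?L)
        case 0
        hence "n div 2 = 0" by (metis binary.simps length_0_conv snoc_eq_iff_butlast)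
        hence "n = 1" using False by linarith
        thus ?thesis using 0 by (simp add: bit_0)
      next
        case (Suc k)
        thus ?thesis using IH by (auto simp: bit_Suc')
      qed
      have 3: "\<not> bit n k" if "k \<ge> length (binary n)" for k
        using that IH by (cases k) (auto simp: bin bit_Suc')
      from 1 2 3 show ?thesis by (simp add: bin)
    qed
  qed
  show "binary n = rev (map (bit n) [0..<length (binary n)])"
    "binary n \<noteq> [] \<Longrightarrow> bit n (length (binary n) - 1)"
    "length (binary n) \<le> k \<Longrightarrow> \<not> bit n k"
    using * by blast+
qed

text \<open>The highest nonzero bit fixes the number of digits. A guessed digit count is certified
  in this way.\<close>

lemma length_binary_unique:
  assumes "0 < L \<Longrightarrow> bit n (L - 1)" "\<And>k. L \<le> k \<Longrightarrow> \<not> bit n k"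
  shows "length (binary n) = L"
proof (rule linorder_cases)
  assume less: "length (binary n) < L"
  hence "0 < L" "length (binary n) \<le> L - 1" by linarith+
  thus ?thesis using assms(1) binary_bits(3)[of n "L - 1"] by blast
next
  assume "L < length (binary n)"
  moreover from this have "binary n \<noteq> []" by auto
  ultimately show ?thesis using assms(2)[of "length (binary n) - 1"] binary_bits(2)[of n] by simp
qed

lemma nth_binary: "k < length (binary n) \<Longrightarrow> binary n ! k = bit n (length (binary n) - 1 - k)"
  by (subst binary_bits(1)) (simp add: rev_nth)

text \<open>The highest differing bit decides. The comparison touches digits only, which is
  essential for numbers too large for a counter. The induction strips the lowest bit, which matters
  only when the halves agree.\<close>

lemma less_iff_bits:
  assumes "\<And>k. L \<le> k \<Longrightarrow> \<not> bit a k" "\<And>k. L \<le> k \<Longrightarrow> \<not> bit t k"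
  shows "(t :: nat) < a \<longleftrightarrow>
    (\<exists>k<L. bit a k \<and> \<not> bit t k \<and> (\<forall>k'<L. k < k' \<longrightarrow> (bit a k' \<longleftrightarrow> bit t k')))"
  using assms
proof (induction L arbitrary: a t)
  case 0
  hence "a = 0" "t = 0" by (auto intro!: bit_eqI)
  thus ?case by simp
next
  case (Suc L)
  have bits: "bit m (Suc k) = bit (m div 2) k" for m k :: nat by (simp add: bit_Suc)
  have IH: "t div 2 < a div 2 \<longleftrightarrow> (\<exists>k<L. bit (a div 2) k \<and> \<not> bit (t div 2) k \<and>
      (\<forall>k'<L. k < k' \<longrightarrow> (bit (a div 2) k' \<longleftrightarrow> bit (t div 2) k')))"
    using Suc.prems by (intro Suc.IH) (simp_all flip: bits)
  have eq: "a div 2 = t div 2 \<longleftrightarrow> (\<forall>k<L. bit (a div 2) k \<longleftrightarrow> bit (t div 2) k)"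
  proof
    assume *: "\<forall>k<L. bit (a div 2) k \<longleftrightarrow> bit (t div 2) k"
    show "a div 2 = t div 2"
    proof (rule bit_eqI)
      show "bit (a div 2) k \<longleftrightarrow> bit (t div 2) k" for k
        using * Suc.prems(1)[of "Suc k"] Suc.prems(2)[of "Suc k"] by (cases "k < L") (auto simp: bits)
    qed
  qed simp
  have all: "(\<forall>i<Suc n. Q i) \<longleftrightarrow> Q 0 \<and> (\<forall>i<n. Q (Suc i))"
    and ex: "(\<exists>i<Suc n. Q i) \<longleftrightarrow> Q 0 \<or> (\<exists>i<n. Q (Suc i))" for n and Q :: "nat \<Rightarrow> bool"
    by (auto simp: less_Suc_eq_0_disj)
  have "t < a \<longleftrightarrow> t div 2 < a div 2 \<or> (a div 2 = t div 2 \<and> bit a 0 \<and> \<not> bit t 0)"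
    unfolding bit_0 by presburger
  thus ?case unfolding ex all IH eq bits by auto
qed

section \<open>Permutations, covers and codes as conditions on finitely many values\<close>

lemma sum_of_bool_eq_card:
  "finite A \<Longrightarrow> (\<Sum>i\<in>A. of_bool (P i) :: nat) = card {i \<in> A. P i}"
  by (simp only: sum_of_bool_eq Collect_conj_eq Collect_mem_eq of_nat_id)

text \<open>All points outside \<open>{1..N}\<close> are fixed, so no inversion involves them. This
  confines the unbounded sets in \<open>lehmer\<close> and \<open>perm_length\<close> to a finite
  range.\<close>

lemma perm_above:
  fixes \<sigma> :: perm
  assumes "\<sigma> permutes {1..N}" "i < j" "\<sigma> j < \<sigma> i"
  shows "1 \<le> i" "j \<le> N"
proof -
  have "\<sigma> 0 = 0" using permutes_not_in[OF assms(1), of 0] by simp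
  thus i: "1 \<le> i" using assms(3) by (cases i) auto
  show "j \<le> N"
  proof (rule ccontr)
    assume j: "\<not> j \<le> N"
    hence "\<sigma> j = j" using permutes_not_in[OF assms(1), of j] by simp
    hence "\<sigma> i \<notin> {1..N}" "\<sigma> i \<noteq> i" using j assms(2,3) by auto
    thus False using permutes_in_image[OF assms(1), of i] permutes_not_in[OF assms(1), of i] by blast
  qed
qed

text \<open>Bounded sums start at 0 while positions start at 1, hence the range below
  \<open>Suc N\<close> together with the guard on \<open>i\<close>.\<close>

definition inversions :: "nat \<Rightarrow> (nat \<Rightarrow> nat) \<Rightarrow> nat" where
  "inversions N p = (\<Sum>i<Suc N. \<Sum>j<Suc N. of_bool (1 \<le> i \<and> i < j \<and> p j < p i))"

definition code_sum :: "nat \<Rightarrow> (nat \<Rightarrow> nat) \<Rightarrow> nat \<Rightarrow> nat" where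
  "code_sum N p i = (\<Sum>j<Suc N. of_bool (i < j \<and> p j < p i))"

lemma perm_length_eq_inversions:
  assumes "\<sigma> permutes {1..N}" "\<And>i. 1 \<le> i \<Longrightarrow> i \<le> N \<Longrightarrow> p i = \<sigma> i"
  shows "perm_length \<sigma> = inversions N p"
proof -
  have "inversions N p = (\<Sum>(i, j)\<in>{..<Suc N} \<times> {..<Suc N}. of_bool (1 \<le> i \<and> i < j \<and> p j < p i))"
    unfolding inversions_def by (rule sum.cartesian_product)
  also have "\<dots> = (\<Sum>q\<in>{..<Suc N} \<times> {..<Suc N}. of_bool (1 \<le> fst q \<and> fst q < snd q \<and> p (snd q) < p (fst q)))"
    by (intro sum.cong) auto
  also have "\<dots> = card {q \<in> {..<Suc N} \<times> {..<Suc N}. 1 \<le> fst q \<and> fst q < snd q \<and> p (snd q) < p (fst q)}"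
    by (rule sum_of_bool_eq_card) simp
  also have "{q \<in> {..<Suc N} \<times> {..<Suc N}. 1 \<le> fst q \<and> fst q < snd q \<and> p (snd q) < p (fst q)} =
      {(i, j). i < j \<and> \<sigma> j < \<sigma> i}"
  proof (intro set_eqI iffI)
    fix q assume "q \<in> {(i, j). i < j \<and> \<sigma> j < \<sigma> i}"
    then obtain i j where ij: "q = (i, j)" "i < j" "\<sigma> j < \<sigma> i" by auto
    have "1 \<le> i" "j \<le> N" using perm_above[OF assms(1) ij(2,3)] .
    thus "q \<in> {q \<in> {..<Suc N} \<times> {..<Suc N}. 1 \<le> fst q \<and> fst q < snd q \<and> p (snd q) < p (fst q)}"
      using ij assms(2)[of i] assms(2)[of j] by auto
  qed (use assms(2) in \<open>auto simp: less_Suc_eq_le\<close>)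
  finally show ?thesis by (simp add: perm_length_def)
qed

lemma lehmer_eq_code_sum:
  assumes "\<sigma> permutes {1..N}" "\<And>i. 1 \<le> i \<Longrightarrow> i \<le> N \<Longrightarrow> p i = \<sigma> i" "1 \<le> i" "i \<le> N"
  shows "lehmer \<sigma> i = code_sum N p i"
proof -
  have "code_sum N p i = card {j \<in> {..<Suc N}. i < j \<and> p j < p i}"
    unfolding code_sum_def by (rule sum_of_bool_eq_card) simp
  also have "{j \<in> {..<Suc N}. i < j \<and> p j < p i} = {j. i < j \<and> \<sigma> j < \<sigma> i}"
    using perm_above(2)[OF assms(1), of i] assms(2-4) by (auto simp: less_Suc_eq_le)
  finally show ?thesis by (simp add: lehmer_def)
qed

definition perm_ok :: "nat \<Rightarrow> (nat \<Rightarrow> nat) \<Rightarrow> bool" where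
  "perm_ok N p \<longleftrightarrow> (\<forall>i<Suc N. 1 \<le> i \<longrightarrow> 1 \<le> p i \<and> p i \<le> N \<and> (\<forall>j<Suc N. 1 \<le> j \<longrightarrow> p i = p j \<longrightarrow> i = j))"

text \<open>A certificate speaks of the positions 1 to \<open>N\<close> only; the identity elsewhere
  turns its values into a function to which \<open>permutes\<close> can apply.\<close>

definition restrict_perm :: "nat \<Rightarrow> (nat \<Rightarrow> nat) \<Rightarrow> nat \<Rightarrow> nat" where
  "restrict_perm N p i = (if 1 \<le> i \<and> i \<le> N then p i else i)"

text \<open>An injective map of a finite set into itself is onto, so range and injectivity are all
  that \<open>perm_ok\<close> tests.\<close>

lemma perm_ok_iff: "perm_ok N p \<longleftrightarrow> restrict_perm N p permutes {1..N}"
proof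
  assume p: "perm_ok N p"
  have "inj_on (restrict_perm N p) {1..N}" "restrict_perm N p ` {1..N} \<subseteq> {1..N}"
    using p by (auto simp: perm_ok_def restrict_perm_def inj_on_def)
  hence "bij_betw (restrict_perm N p) {1..N} {1..N}"
    using endo_inj_surj[of "{1..N}"] by (simp add: bij_betw_def)
  thus "restrict_perm N p permutes {1..N}"
    by (rule bij_imp_permutes) (auto simp: restrict_perm_def)
next
  assume p: "restrict_perm N p permutes {1..N}"
  show "perm_ok N p"
    unfolding perm_ok_def
  proof (intro allI impI)
    fix i assume i: "i < Suc N" "1 \<le> i"
    hence "restrict_perm N p i \<in> {1..N}" using permutes_in_image[OF p, of i] by simp
    moreover have "\<forall>j<Suc N. 1 \<le> j \<longrightarrow> p i = p j \<longrightarrow> i = j"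
      using i injD[OF permutes_inj[OF p], of i] by (auto simp: restrict_perm_def)
    ultimately show "1 \<le> p i \<and> p i \<le> N \<and> (\<forall>j<Suc N. 1 \<le> j \<longrightarrow> p i = p j \<longrightarrow> i = j)"
      using i by (simp add: restrict_perm_def)
  qed
qed

lemma restrict_perm_eq:
  assumes "\<sigma> permutes {1..N}"
  shows "restrict_perm N p = \<sigma> \<longleftrightarrow> (\<forall>i. 1 \<le> i \<longrightarrow> i \<le> N \<longrightarrow> p i = \<sigma> i)"
  using permutes_not_in[OF assms] by (auto simp: restrict_perm_def fun_eq_iff)

definition edge_ok :: "nat \<Rightarrow> (nat \<Rightarrow> nat) \<Rightarrow> (nat \<Rightarrow> nat) \<Rightarrow> nat \<Rightarrow> nat \<Rightarrow> bool" where
  "edge_ok N p p' j b \<longleftrightarrow> (\<exists>s<Suc N. \<exists>t<Suc N. 1 \<le> s \<and> s \<le> j \<and> j < t \<and> b = p s \<and>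
     p' s = p t \<and> p' t = p s \<and> (\<forall>i<Suc N. 1 \<le> i \<longrightarrow> i \<noteq> s \<longrightarrow> i \<noteq> t \<longrightarrow> p' i = p i) \<and>
     inversions N p' = Suc (inversions N p))"

text \<open>Composition with a transposition is rendered by values: two are exchanged and the others
  kept. Outside \<open>{1..N}\<close> both permutations are the identity, so comparing the values
  inside settles equality of functions.\<close>

lemma edge_ok_iff:
  assumes "\<sigma> permutes {1..N}" "\<sigma>' permutes {1..N}"
    and p: "\<And>i. 1 \<le> i \<Longrightarrow> i \<le> N \<Longrightarrow> p i = \<sigma> i" "\<And>i. 1 \<le> i \<Longrightarrow> i \<le> N \<Longrightarrow> p' i = \<sigma>' i"
  shows "edge_ok N p p' j b \<longleftrightarrow> labeled_edge N \<sigma> (j, b) \<sigma>'"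
proof -
  have len: "perm_length \<sigma> = inversions N p" "perm_length \<sigma>' = inversions N p'"
    using perm_length_eq_inversions[OF assms(1) p(1)] perm_length_eq_inversions[OF assms(2) p(2)]
    by blast+
  have swap: "\<sigma>' = \<sigma> \<circ> Transposition.transpose s t \<longleftrightarrow>
      p' s = p t \<and> p' t = p s \<and> (\<forall>i<Suc N. 1 \<le> i \<longrightarrow> i \<noteq> s \<longrightarrow> i \<noteq> t \<longrightarrow> p' i = p i)"
    if st: "1 \<le> s" "s < t" "t \<le> N" for s t
  proof
    assume "\<sigma>' = \<sigma> \<circ> Transposition.transpose s t"
    thus "p' s = p t \<and> p' t = p s \<and> (\<forall>i<Suc N. 1 \<le> i \<longrightarrow> i \<noteq> s \<longrightarrow> i \<noteq> t \<longrightarrow> p' i = p i)"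
      using st p by (auto simp: transpose_apply_other)
  next
    assume *: "p' s = p t \<and> p' t = p s \<and> (\<forall>i<Suc N. 1 \<le> i \<longrightarrow> i \<noteq> s \<longrightarrow> i \<noteq> t \<longrightarrow> p' i = p i)"
    show "\<sigma>' = \<sigma> \<circ> Transposition.transpose s t"
    proof
      fix i
      show "\<sigma>' i = (\<sigma> \<circ> Transposition.transpose s t) i"
      proof (cases "1 \<le> i \<and> i \<le> N")
        case True
        have "\<sigma>' i = p' i" using p(2) True by simp
        also consider "i = s" | "i = t" | "i \<noteq> s" "i \<noteq> t" by blast
        hence "p' i = (\<sigma> \<circ> Transposition.transpose s t) i"
        proof cases
          case 1
          thus ?thesis using * p(1)[of t] st by simp
        next
          case 2
          thus ?thesis using * p(1)[of s] st by simp
        next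
          case 3
          thus ?thesis using * p(1)[of i] True by (simp add: transpose_apply_other)
        qed
        finally show ?thesis .
      next
        case False
        hence "i \<noteq> s" "i \<noteq> t" "i \<notin> {1..N}" using st by auto
        thus ?thesis using permutes_not_in[OF assms(1), of i] permutes_not_in[OF assms(2), of i]
          by (simp add: transpose_apply_other)
      qed
    qed
  qed
  have "labeled_edge N \<sigma> (j, b) \<sigma>' \<longleftrightarrow> (\<exists>s t. (1 \<le> s \<and> s \<le> j \<and> j < t \<and> t \<le> N) \<and> b = \<sigma> s \<and>
      \<sigma>' = \<sigma> \<circ> Transposition.transpose s t \<and> inversions N p' = Suc (inversions N p))"
    (is "?E \<longleftrightarrow> ?R")
  proof
    assume ?R
    then obtain s t where "1 \<le> s" "s \<le> j" "j < t" "t \<le> N" "b = \<sigma> s"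
      "\<sigma>' = \<sigma> \<circ> Transposition.transpose s t" "inversions N p' = Suc (inversions N p)" by blast
    moreover from this have "s < t" by linarith
    ultimately show ?E
      using assms(1) unfolding labeled_edge_def cover_by_def len
      by (intro exI[of _ s] exI[of _ t] exI[of _ j]) simp
  qed (auto simp: labeled_edge_def cover_by_def len)
  also have "\<dots> \<longleftrightarrow> (\<exists>s t. (1 \<le> s \<and> s \<le> j \<and> j < t \<and> t \<le> N) \<and> b = p s \<and>
      (p' s = p t \<and> p' t = p s \<and> (\<forall>i<Suc N. 1 \<le> i \<longrightarrow> i \<noteq> s \<longrightarrow> i \<noteq> t \<longrightarrow> p' i = p i)) \<and>
      inversions N p' = Suc (inversions N p))"
  proof (intro ex_cong1 conj_cong refl)
    fix s t assume "1 \<le> s \<and> s \<le> j \<and> j < t \<and> t \<le> N"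
    thus "b = \<sigma> s \<longleftrightarrow> b = p s"
      "\<sigma>' = \<sigma> \<circ> Transposition.transpose s t \<longleftrightarrow>
        p' s = p t \<and> p' t = p s \<and> (\<forall>i<Suc N. 1 \<le> i \<longrightarrow> i \<noteq> s \<longrightarrow> i \<noteq> t \<longrightarrow> p' i = p i)"
      using p(1)[of s] swap[of s t] by auto
  qed
  also have "\<dots> \<longleftrightarrow> edge_ok N p p' j b"
  proof
    assume "edge_ok N p p' j b"
    thus "\<exists>s t. (1 \<le> s \<and> s \<le> j \<and> j < t \<and> t \<le> N) \<and> b = p s \<and>
      (p' s = p t \<and> p' t = p s \<and> (\<forall>i<Suc N. 1 \<le> i \<longrightarrow> i \<noteq> s \<longrightarrow> i \<noteq> t \<longrightarrow> p' i = p i)) \<and>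
      inversions N p' = Suc (inversions N p)"
      unfolding edge_ok_def less_Suc_eq_le by blast
  next
    assume "\<exists>s t. (1 \<le> s \<and> s \<le> j \<and> j < t \<and> t \<le> N) \<and> b = p s \<and>
      (p' s = p t \<and> p' t = p s \<and> (\<forall>i<Suc N. 1 \<le> i \<longrightarrow> i \<noteq> s \<longrightarrow> i \<noteq> t \<longrightarrow> p' i = p i)) \<and>
      inversions N p' = Suc (inversions N p)"
    then obtain s t where st: "1 \<le> s" "s \<le> j" "j < t" "t \<le> N" "b = p s" "p' s = p t" "p' t = p s"
      "\<forall>i<Suc N. 1 \<le> i \<longrightarrow> i \<noteq> s \<longrightarrow> i \<noteq> t \<longrightarrow> p' i = p i" "inversions N p' = Suc (inversions N p)"
      by blast
    moreover from this have "s < Suc N" "t < Suc N" by linarith+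
    ultimately show "edge_ok N p p' j b" unfolding edge_ok_def by blast
  qed
  finally show ?thesis ..
qed

definition code_ok :: "nat \<Rightarrow> (nat \<Rightarrow> nat) \<Rightarrow> (nat \<Rightarrow> nat) \<Rightarrow> bool" where
  "code_ok N p c \<longleftrightarrow> (\<forall>i<Suc N. 1 \<le> i \<longrightarrow> code_sum N p i = c i)"

text \<open>The Lehmer code of a permutation of \<open>{1..N}\<close> vanishes beyond
  \<open>N\<close>, so its first \<open>N\<close> entries identify the permutation by
  \<open>code_perm_unique\<close>.\<close>

lemma code_ok_iff:
  assumes "\<sigma> permutes {1..N}" "\<And>i. 1 \<le> i \<Longrightarrow> i \<le> N \<Longrightarrow> p i = \<sigma> i" "length v \<le> N"
    "\<And>i. 1 \<le> i \<Longrightarrow> i \<le> N \<Longrightarrow> c i = (if i \<le> length v then v ! (i - 1) else 0)"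
  shows "code_ok N p c \<longleftrightarrow> \<sigma> = perm_of_code v"
proof
  assume "code_ok N p c"
  hence *: "lehmer \<sigma> i = (if i \<le> length v then v ! (i - 1) else 0)" if "1 \<le> i" "i \<le> N" for i
    using that lehmer_eq_code_sum[OF assms(1,2)] assms(4) by (auto simp: code_ok_def less_Suc_eq_le)
  have "lehmer \<sigma> i = 0" if "i > N" for i
    using perm_above(2)[OF assms(1), of i] that by (force simp: lehmer_def card_eq_0_iff)
  hence "lehmer \<sigma> i = lehmer (perm_of_code v) i" if "1 \<le> i" for i
    using * that assms(3) perm_of_code(2)[of i v] by (cases "i \<le> N") auto
  thus "\<sigma> = perm_of_code v" by (rule code_perm_unique[OF assms(1) perm_of_code(1)])
next
  assume "\<sigma> = perm_of_code v"
  thus "code_ok N p c"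
    using lehmer_eq_code_sum[OF assms(1,2)] perm_of_code(2)[of _ v] assms(4)
    by (auto simp: code_ok_def less_Suc_eq_le)
qed

section \<open>Increasing chains as tables of values\<close>

definition states :: "perm \<Rightarrow> chain \<Rightarrow> nat \<Rightarrow> perm" where
  "states \<sigma> C r = (\<sigma> # map snd C) ! r"

lemma labeled_edge_permutes: "labeled_edge N \<sigma> l \<rho> \<Longrightarrow> \<sigma> permutes {1..N} \<and> \<rho> permutes {1..N}"
  using is_chain_set[of N \<sigma> "[(l, \<rho>)]" \<rho>]
  by (auto simp: labeled_edge_def cover_by_def intro!: permutes_compose permutes_swap_id)

text \<open>The recursion along the list is replaced by conditions on consecutive states, which
  bounded quantifiers over the index can check.\<close>

lemma is_chain_iff:
  "is_chain N \<sigma> C \<pi> \<longleftrightarrow> (\<forall>r\<le>length C. states \<sigma> C r permutes {1..N}) \<and>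
     (\<forall>r<length C. labeled_edge N (states \<sigma> C r) (fst (C ! r)) (states \<sigma> C (Suc r))) \<and>
     states \<sigma> C (length C) = \<pi>"
proof (induction C arbitrary: \<sigma>)
  case Nil
  show ?case by (auto simp: states_def)
next
  case (Cons e C)
  obtain l \<rho> where e: "e = (l, \<rho>)" by (cases e)
  have states: "states \<sigma> ((l, \<rho>) # C) 0 = \<sigma>" "states \<sigma> ((l, \<rho>) # C) (Suc r) = states \<rho> C r" for r
    by (simp_all add: states_def)
  have all: "(\<forall>i<Suc n. Q i) \<longleftrightarrow> Q 0 \<and> (\<forall>i<n. Q (Suc i))" for n and Q :: "nat \<Rightarrow> bool"
    by (auto simp: less_Suc_eq_0_disj)
  have all_le: "(\<forall>i\<le>n. Q i) \<longleftrightarrow> Q 0 \<and> (\<forall>i<n. Q (Suc i))" for n and Q :: "nat \<Rightarrow> bool"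
    by (metis Suc_le_eq le0 not0_implies_Suc)
  have "states \<rho> C 0 = \<rho>" by (simp add: states_def)
  thus ?case
    using labeled_edge_permutes[of N \<sigma> l \<rho>]
    by (auto simp: e all_le all states Cons.IH)
qed

definition chain_ok ::
    "nat \<Rightarrow> (nat \<Rightarrow> nat) \<Rightarrow> (nat \<Rightarrow> nat) \<Rightarrow> nat \<Rightarrow> (nat \<Rightarrow> nat \<Rightarrow> nat) \<Rightarrow> (nat \<Rightarrow> nat) \<Rightarrow> (nat \<Rightarrow> nat) \<Rightarrow> bool" where
  "chain_ok N c c' h P J V \<longleftrightarrow> (\<forall>r<Suc h. perm_ok N (P r)) \<and> code_ok N (P 0) c \<and> code_ok N (P h) c' \<and>
     (\<forall>r<h. edge_ok N (P r) (P (Suc r)) (J r) (V r)) \<and>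
     (\<forall>r<h. \<forall>r'<r. J r' < J r \<or> J r' = J r \<and> V r' < V r)"

text \<open>Links raw table entries to a chain. Values of \<open>P r\<close> outside the positions 1
  to \<open>N\<close> are left open here; \<open>supp_ok\<close> later forces the corresponding
  entries to be 0.\<close>

definition records ::
    "nat \<Rightarrow> perm \<Rightarrow> nat \<Rightarrow> (nat \<Rightarrow> nat \<Rightarrow> nat) \<Rightarrow> (nat \<Rightarrow> nat) \<Rightarrow> (nat \<Rightarrow> nat) \<Rightarrow> chain \<Rightarrow> bool" where
  "records N \<sigma> h P J V C \<longleftrightarrow> length C = h \<and> (\<forall>r\<le>h. \<forall>i. 1 \<le> i \<longrightarrow> i \<le> N \<longrightarrow> P r i = states \<sigma> C r i) \<and>
     (\<forall>r<h. fst (C ! r) = (J r, V r))"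

lemma chain_ok_iff:
  assumes "length v \<le> N" "length w \<le> N"
    and c: "\<And>i. 1 \<le> i \<Longrightarrow> i \<le> N \<Longrightarrow> c i = (if i \<le> length v then v ! (i - 1) else 0)"
      "\<And>i. 1 \<le> i \<Longrightarrow> i \<le> N \<Longrightarrow> c' i = (if i \<le> length w then w ! (i - 1) else 0)"
  shows "chain_ok N c c' h P J V \<longleftrightarrow>
    (\<exists>C\<in>increasing_chains N (perm_of_code v) (perm_of_code w). records N (perm_of_code v) h P J V C)"
proof
  assume ok: "chain_ok N c c' h P J V"
  define S where "S = (\<lambda>r. restrict_perm N (P r))"
  define C where "C = map (\<lambda>r. ((J r, V r), S (Suc r))) [0..<h]"
  have S: "S r permutes {1..N}" if "r \<le> h" for r
    using ok that by (auto simp: S_def chain_ok_def perm_ok_iff)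
  have PS: "1 \<le> i \<Longrightarrow> i \<le> N \<Longrightarrow> P r i = S r i" for r i by (simp add: S_def restrict_perm_def)
  have ends: "S 0 = perm_of_code v" "S h = perm_of_code w"
    using code_ok_iff[OF S PS assms(1) c(1), of 0] code_ok_iff[OF S PS assms(2) c(2), of h] ok
    by (auto simp: chain_ok_def)
  have states: "states (perm_of_code v) C r = S r" if "r \<le> h" for r
    using that ends(1) by (cases r) (auto simp: states_def C_def)
  have "labeled_edge N (S r) (J r, V r) (S (Suc r))" if "r < h" for r
    using edge_ok_iff[OF S S PS PS, of r "Suc r"] that ok by (auto simp: chain_ok_def)
  hence "is_chain N (perm_of_code v) C (perm_of_code w)"
    using S ends by (auto simp: is_chain_iff states C_def[THEN arg_cong[where f = length], simplified])
      (auto simp: C_def)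
  moreover have "sorted_wrt label_less (map fst C)"
    using ok by (auto simp: sorted_wrt_iff_nth_less C_def chain_ok_def)
  moreover have "records N (perm_of_code v) h P J V C"
    unfolding records_def using states PS by (auto simp: C_def)
  ultimately show "\<exists>C\<in>increasing_chains N (perm_of_code v) (perm_of_code w).
      records N (perm_of_code v) h P J V C"
    by (auto simp: increasing_chains_def)
next
  assume "\<exists>C\<in>increasing_chains N (perm_of_code v) (perm_of_code w).
      records N (perm_of_code v) h P J V C"
  then obtain C where C: "is_chain N (perm_of_code v) C (perm_of_code w)"
      "sorted_wrt label_less (map fst C)" and rec: "records N (perm_of_code v) h P J V C"
    by (auto simp: increasing_chains_def)
  define S where "S = states (perm_of_code v) C"
  have len: "length C = h" using rec by (simp add: records_def)
  have S: "S r permutes {1..N}" if "r \<le> h" for r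
    using C(1) that len by (auto simp: S_def is_chain_iff)
  have PS: "1 \<le> i \<Longrightarrow> i \<le> N \<Longrightarrow> P r i = S r i" if "r \<le> h" for r i
    using rec that by (simp add: S_def records_def)
  have "perm_ok N (P r)" if "r \<le> h" for r
    using S[OF that] PS[OF that] restrict_perm_eq[OF S[OF that], of "P r"] by (simp add: perm_ok_iff)
  moreover have "code_ok N (P 0) c"
    using code_ok_iff[OF S[of 0] PS[of 0] assms(1) c(1)] by (simp add: S_def states_def)
  moreover have "code_ok N (P h) c'"
    using code_ok_iff[OF S[of h] PS[of h] assms(2) c(2)] C(1) len by (simp add: S_def is_chain_iff)
  moreover have "edge_ok N (P r) (P (Suc r)) (J r) (V r)" if "r < h" for r
    using edge_ok_iff[OF S[of r] S[of "Suc r"] PS[of r] PS[of "Suc r"]] that C(1) rec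
    by (auto simp: is_chain_iff S_def records_def)
  moreover have "J r' < J r \<or> J r' = J r \<and> V r' < V r" if "r < h" "r' < r" for r r'
    using C(2) that rec by (auto simp: sorted_wrt_iff_nth_less records_def)
  ultimately show "chain_ok N c c' h P J V" by (simp add: chain_ok_def less_Suc_eq_le)
qed

text \<open>A permutation of \<open>{1..N}\<close> is determined by its values there, so the entries
  fix the target and the label of every edge. Distinct chains therefore get distinct
  certificates.\<close>

lemma records_unique:
  assumes "records N \<sigma> h P J V C" "records N \<sigma> h P J V C'" "is_chain N \<sigma> C \<pi>" "is_chain N \<sigma> C' \<pi>"
  shows "C = C'"
proof (rule nth_equalityI)
  show len: "length C = length C'" using assms by (simp add: records_def)
  fix r assume r: "r < length C"
  hence "states \<sigma> C (Suc r) = states \<sigma> C' (Suc r)"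
    using assms len restrict_perm_eq[of "states \<sigma> C (Suc r)" N "P (Suc r)"]
      restrict_perm_eq[of "states \<sigma> C' (Suc r)" N "P (Suc r)"]
    by (auto simp: records_def is_chain_iff Suc_le_eq)
  hence "snd (C ! r) = snd (C' ! r)" using r len by (simp add: states_def)
  moreover have "fst (C ! r) = fst (C' ! r)" using assms(1,2) r by (simp add: records_def)
  ultimately show "C ! r = C' ! r" by (rule prod_eqI[rotated])
qed

section \<open>Certificates for skew Schubert polynomials\<close>

text \<open>\<open>triangle\<close> is defined by a division, for which expressions have no
  constructor; a bounded sum is feasible.\<close>

lemma triangle_eq_sum: "triangle n = (\<Sum>i<n. Suc i)"
  by (induction n) simp_all

lemma feasible_prod_encode:
  assumes "feasible a" "feasible b"
  shows "feasible (\<lambda>z e. prod_encode (a z e, b z e))"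
proof (rule feasible_comp2[OF _ assms])
  show "feasible (\<lambda>z e. prod_encode (e 0, e 1))"
    unfolding prod_encode_def triangle_eq_sum prod.case by (intro feasible_intros)
qed

text \<open>Flattens several tables, told apart by the tag \<open>c\<close>, into the single index
  of a certificate. Cantor pairing is injective and grows quadratically, so polynomially many
  entries are enough.\<close>

definition addr :: "nat \<Rightarrow> nat \<Rightarrow> nat \<Rightarrow> nat \<Rightarrow> nat" where
  "addr c i j k = prod_encode (prod_encode (c, i), prod_encode (j, k))"

lemma feasible_addr:
  "feasible c \<Longrightarrow> feasible i \<Longrightarrow> feasible j \<Longrightarrow> feasible k \<Longrightarrow>
    feasible (\<lambda>z e. addr (c z e) (i z e) (j z e) (k z e))"
  unfolding addr_def by (intro feasible_prod_encode)

lemma addr_eq_iff [simp]: "addr c i j k = addr c' i' j' k' \<longleftrightarrow> c = c' \<and> i = i' \<and> j = j' \<and> k = k'"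
  by (auto simp: addr_def)

lemma ex_addr: "\<exists>c i j k. p = addr c i j k"
  unfolding addr_def by (metis prod_decode_inverse prod.collapse)

lemma prod_encode_less: "a < M \<Longrightarrow> b < M \<Longrightarrow> prod_encode (a, b) < 4 * (M * M)"
proof -
  assume "a < M" "b < M"
  have "triangle (a + b) \<le> (a + b) * (a + b)"
    by (cases "a + b") (simp_all add: triangle_def)
  hence "prod_encode (a, b) < (a + b + 1) * (a + b + 1)" by (simp add: prod_encode_def)
  also have "\<dots> \<le> (2 * M) * (2 * M)" using \<open>a < M\<close> \<open>b < M\<close> by (intro mult_mono) auto
  finally show ?thesis by simp
qed

lemma addr_less:
  assumes "c < M" "i < M" "j < M" "k < M"
  shows "addr c i j k < 4 * ((4 * (M * M)) * (4 * (M * M)))"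
  unfolding addr_def by (intro prod_encode_less assms)

text \<open>This is \<open>Suc n * Suc n + 7\<close>: the square bounds the length of a chain, and
  the 7 makes room for the tags 0 to 6 and for strict inequalities.\<close>

definition index_bound :: "nat poly" where
  "index_bound = [:8, 2, 1:]"

text \<open>The bound of \<open>addr_less\<close> for indices below \<open>index_bound\<close>;
  being at least \<open>index_bound\<close>, it also bounds the entries.\<close>

definition cert_bound :: "nat poly" where
  "cert_bound = 4 * ((4 * (index_bound * index_bound)) * (4 * (index_bound * index_bound)))"

lemma poly_index_bound: "poly index_bound n = Suc n * Suc n + 7"
  by (simp add: index_bound_def algebra_simps)

lemma index_bound_le_cert_bound: "poly index_bound n \<le> poly cert_bound n"
proof -
  have "M \<le> 4 * ((4 * (M * M)) * (4 * (M * M)))" for M :: nat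
  proof -
    define X where "X = 4 * (M * M)"
    have "M \<le> M * M" "X \<le> X * X" by (rule le_square)+
    moreover have "M * M \<le> X" by (simp add: X_def)
    ultimately show ?thesis unfolding X_def[symmetric] by linarith
  qed
  thus ?thesis by (simp add: cert_bound_def)
qed

text \<open>
  The layout of a certificate: \<open>blk\<close> gives the numbers of the unary blocks \<open>m, v, w\<close> of the input,
  followed by the digit counts of its binary blocks; \<open>dig\<close> the digits of the latter; \<open>prm\<close> the values
  of the \<open>r\<close>-th permutation of the chain; \<open>hgt\<close> the length of the chain; \<open>pos\<close> and \<open>val\<close> the labels
  \<open>(j, b)\<close> of its edges; and \<open>num\<close> the digits of the \<open>c\<close>-th number chosen below \<open>a\<^sub>i\<close>.
\<close>

definition blk :: "(nat \<Rightarrow> nat) \<Rightarrow> nat \<Rightarrow> nat" where "blk u i = u (addr 0 i 0 0)"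
definition dig :: "(nat \<Rightarrow> nat) \<Rightarrow> nat \<Rightarrow> nat \<Rightarrow> nat" where "dig u i k = u (addr 1 i k 0)"
definition prm :: "(nat \<Rightarrow> nat) \<Rightarrow> nat \<Rightarrow> nat \<Rightarrow> nat" where "prm u r i = u (addr 2 r i 0)"
definition hgt :: "(nat \<Rightarrow> nat) \<Rightarrow> nat" where "hgt u = u (addr 3 0 0 0)"
definition pos :: "(nat \<Rightarrow> nat) \<Rightarrow> nat \<Rightarrow> nat" where "pos u r = u (addr 4 r 0 0)"
definition val :: "(nat \<Rightarrow> nat) \<Rightarrow> nat \<Rightarrow> nat" where "val u r = u (addr 5 r 0 0)"
definition num :: "(nat \<Rightarrow> nat) \<Rightarrow> nat \<Rightarrow> nat \<Rightarrow> nat \<Rightarrow> nat" where "num u i c k = u (addr 6 i c k)"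

text \<open>This recovers \<open>N\<close>, the \<open>code_size\<close> of \<open>w\<close>, whose
  entries follow those of \<open>v\<close> in the parse; each contributes 1 for its place in the
  list.\<close>

definition csize :: "(nat \<Rightarrow> nat) \<Rightarrow> nat" where
  "csize u = (\<Sum>i<blk u 0. Suc (blk u (Suc (blk u 0 + i))))"

definition nblocks :: "(nat \<Rightarrow> nat) \<Rightarrow> nat" where
  "nblocks u = Suc (2 * blk u 0 + (csize u - 1))"

text \<open>The start of block \<open>i\<close>: the unary form of \<open>k\<close> takes
  \<open>k + 1\<close> bits, and a framed string of \<open>k\<close> digits takes
  \<open>2 * k + 1\<close>.\<close>

definition off :: "(nat \<Rightarrow> nat) \<Rightarrow> nat \<Rightarrow> nat" where
  "off u i = (\<Sum>j<i. if j < Suc (2 * blk u 0) then Suc (blk u j) else Suc (2 * blk u j))"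

text \<open>The index \<open>blk u i - 1 - k\<close> reverses the digits, since
  \<open>binary\<close> writes the most significant one first and \<open>dig\<close> counts from the
  least significant. The condition on the top digit excludes leading zeros.\<close>

definition enc_ok :: "nat \<Rightarrow> (nat \<Rightarrow> bool) \<Rightarrow> (nat \<Rightarrow> nat) \<Rightarrow> bool" where
  "enc_ok n X u \<longleftrightarrow> n = off u (nblocks u) \<and>
     (\<forall>i<Suc (2 * blk u 0). (\<forall>k<blk u i. X (off u i + k)) \<and> \<not> X (off u i + blk u i)) \<and>
     (\<forall>i<nblocks u. Suc (2 * blk u 0) \<le> i \<longrightarrow>
       (\<forall>k<blk u i. dig u i k \<le> 1 \<and> X (off u i + 2 * k) \<and>
         (X (off u i + (2 * k + 1)) \<longleftrightarrow> dig u i (blk u i - 1 - k) = 1)) \<and>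
       \<not> X (off u i + 2 * blk u i) \<and> (0 < blk u i \<longrightarrow> dig u i (blk u i - 1) = 1))"

definition nrep :: "(nat \<Rightarrow> nat) \<Rightarrow> nat \<Rightarrow> nat" where
  "nrep u i = csize u - i - (\<Sum>r<hgt u. of_bool (pos u r = i))"

text \<open>Block \<open>2 * blk u 0 + i\<close> carries the value of the variable with index
  \<open>i\<close>, and \<open>nrep u i\<close> is its exponent. The inner existential is the
  comparison of \<open>less_iff_bits\<close>.\<close>

definition num_ok :: "(nat \<Rightarrow> nat) \<Rightarrow> bool" where
  "num_ok u \<longleftrightarrow> (\<forall>i<csize u. 1 \<le> i \<longrightarrow> (\<forall>c<nrep u i.
     (\<forall>k<blk u (2 * blk u 0 + i). num u i c k \<le> 1) \<and>
     (\<exists>k<blk u (2 * blk u 0 + i). dig u (2 * blk u 0 + i) k = 1 \<and> num u i c k = 0 \<and>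
        (\<forall>k'<blk u (2 * blk u 0 + i). k < k' \<longrightarrow> dig u (2 * blk u 0 + i) k' = num u i c k'))))"

definition used :: "(nat \<Rightarrow> nat) \<Rightarrow> nat \<Rightarrow> nat \<Rightarrow> nat \<Rightarrow> nat \<Rightarrow> bool" where
  "used u c i j k \<longleftrightarrow>
     c = 0 \<and> i < nblocks u \<and> j = 0 \<and> k = 0 \<or>
     c = 1 \<and> Suc (2 * blk u 0) \<le> i \<and> i < nblocks u \<and> j < blk u i \<and> k = 0 \<or>
     c = 2 \<and> i \<le> hgt u \<and> 1 \<le> j \<and> j \<le> csize u \<and> k = 0 \<or>
     c = 3 \<and> i = 0 \<and> j = 0 \<and> k = 0 \<or>
     (c = 4 \<or> c = 5) \<and> i < hgt u \<and> j = 0 \<and> k = 0 \<or>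
     c = 6 \<and> 1 \<le> i \<and> i < csize u \<and> j < nrep u i \<and> k < blk u (2 * blk u 0 + i)"

text \<open>A free entry would multiply the count, so entries outside the layout must be 0. The
  inverse of \<open>addr\<close> is found by bounded search.\<close>

definition supp_ok :: "nat \<Rightarrow> (nat \<Rightarrow> nat) \<Rightarrow> bool" where
  "supp_ok n u \<longleftrightarrow> (\<forall>p<poly cert_bound n. u p = 0 \<or>
     (\<exists>c<7. \<exists>i<poly index_bound n. \<exists>j<poly index_bound n. \<exists>k<poly index_bound n.
        p = addr c i j k \<and> used u c i j k))"

definition cert_ok :: "nat \<Rightarrow> (nat \<Rightarrow> bool) \<Rightarrow> (nat \<Rightarrow> nat) \<Rightarrow> bool" where
  "cert_ok n X u \<longleftrightarrow> enc_ok n X u \<and>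
     chain_ok (csize u) (\<lambda>i. if i \<le> blk u 0 then blk u i else 0)
       (\<lambda>i. if i \<le> blk u 0 then blk u (blk u 0 + i) else 0) (hgt u) (prm u) (pos u) (val u) \<and>
     num_ok u \<and> supp_ok n u"

lemma feasible_cert_ok:
  "feasible (\<lambda>z e. of_bool (cert_ok (fst_length z) (fst_bit z) (cert cert_bound z)))"
  unfolding cert_ok_def enc_ok_def chain_ok_def perm_ok_def code_ok_def code_sum_def edge_ok_def
    inversions_def num_ok_def supp_ok_def used_def nrep_def off_def nblocks_def csize_def
    blk_def dig_def prm_def hgt_def pos_def val_def num_def
  by (intro feasible_intros feasible_fst_length feasible_fst_bit feasible_cert feasible_addr)

section \<open>The parse of the input as part of the certificate\<close>

locale instance_data =
  fixes v w a :: "nat list"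
  assumes length_eq: "length v = length w" and length_a: "length a = code_size w - 1"
begin

definition blocks :: "nat list" where
  "blocks = length v # v @ w @ map (length \<circ> binary) a"

text \<open>Compares the guessed parse with a triple and does not mention the input string;
  \<open>enc_ok_iff\<close> then brings in the string.\<close>

definition enc_match :: "(nat \<Rightarrow> nat) \<Rightarrow> bool" where
  "enc_match u \<longleftrightarrow> (\<forall>i<length blocks. blk u i = blocks ! i) \<and>
     (\<forall>i<length a. \<forall>k<length (binary (a ! i)). dig u (Suc (2 * length v) + i) k = of_bool (bit (a ! i) k))"

lemma length_blocks: "length blocks = Suc (2 * length v + length a)"
  by (simp add: blocks_def length_eq)

lemma nth_blocks:
  "blocks ! 0 = length v"
  "i < length v \<Longrightarrow> blocks ! Suc i = v ! i"
  "i < length v \<Longrightarrow> blocks ! Suc (length v + i) = w ! i"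
  "i < length a \<Longrightarrow> blocks ! (Suc (2 * length v) + i) = length (binary (a ! i))"
  using length_eq by (simp_all add: blocks_def nth_append mult_2)

lemma enc_match_sizes:
  assumes "enc_match u"
  shows "blk u 0 = length v" "csize u = code_size w" "nblocks u = length blocks"
proof -
  have blk: "blk u i = blocks ! i" if "i < length blocks" for i
    using assms that by (simp add: enc_match_def)
  show m: "blk u 0 = length v" using blk[of 0] by (simp add: length_blocks nth_blocks)
  have "csize u = (\<Sum>i<length w. Suc (w ! i))"
    unfolding csize_def m length_eq[symmetric]
    by (intro sum.cong) (auto simp: blk length_blocks nth_blocks)
  thus "csize u = code_size w"
    by (simp add: code_size_def sum_list_sum_nth sum.distrib atLeast0LessThan sum_Suc)
  thus "nblocks u = length blocks" by (simp add: nblocks_def m length_blocks length_a)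
qed

definition words :: "bool list list" where
  "words = map unary (length v # v @ w) @ map (framed \<circ> binary) a"

lemma encode_words: "encode_instance (v, w, a) = concat words"
  by (simp add: words_def)

lemma length_words: "length words = length blocks"
  by (simp add: words_def length_blocks length_eq)

lemma nth_words:
  "i < Suc (2 * length v) \<Longrightarrow> words ! i = unary (blocks ! i)"
  "i < length a \<Longrightarrow> words ! (Suc (2 * length v) + i) = framed (binary (a ! i))"
proof -
  assume "i < Suc (2 * length v)"
  hence "i < length (length v # v @ w)" by (simp add: length_eq)
  moreover have "blocks = (length v # v @ w) @ map (length \<circ> binary) a" by (simp add: blocks_def)
  ultimately show "words ! i = unary (blocks ! i)"
    unfolding words_def by (simp only: nth_append length_map if_True nth_map)
next
  assume "i < length a"
  thus "words ! (Suc (2 * length v) + i) = framed (binary (a ! i))"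
    by (simp add: words_def nth_append length_eq)
qed

lemma length_nth_words:
  "i < length blocks \<Longrightarrow>
    length (words ! i) = (if i < Suc (2 * length v) then Suc (blocks ! i) else Suc (2 * blocks ! i))"
proof (cases "i < Suc (2 * length v)")
  case False
  assume "i < length blocks"
  moreover obtain j where "i = Suc (2 * length v) + j" using False by (metis le_Suc_ex not_less)
  ultimately show ?thesis
    using nth_words(2)[of j] nth_blocks(4)[of j] by (simp add: length_blocks)
qed (simp add: nth_words)

lemma all_blocks:
  "(\<forall>i<length blocks. P i) \<longleftrightarrow>
    (\<forall>i<Suc (2 * length v). P i) \<and> (\<forall>i<length a. P (Suc (2 * length v) + i))"
proof -
  have "(\<forall>i<m + n. P i) \<longleftrightarrow> (\<forall>i<m. P i) \<and> (\<forall>i<n. P (m + i))" for m n :: nat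
    by auto (metis add_diff_inverse_nat add_less_cancel_left)
  from this[of "Suc (2 * length v)" "length a"] show ?thesis by (simp add: length_blocks)
qed

text \<open>Once the guessed sizes and digits are those of the triple, the conditions on digits hold
  by themselves, and what remains of \<open>enc_ok\<close> is \<open>eq_concat_iff_bit_at\<close>
  for the list \<open>words\<close>.\<close>

lemma enc_ok_iff:
  assumes "enc_match u"
  shows "enc_ok (length x) (bit_at x) u \<longleftrightarrow> x = encode_instance (v, w, a)"
proof -
  note sizes = enc_match_sizes[OF assms]
  have blk: "blk u i = blocks ! i" if "i < length blocks" for i
    using assms that by (simp add: enc_match_def)
  have off: "off u i = (\<Sum>j<i. length (words ! j))" if "i \<le> length blocks" for i
    unfolding off_def sizes using that by (intro sum.cong) (auto simp: blk length_nth_words)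
  define o' where "o' = (\<lambda>i. \<Sum>j<i. length (words ! j))"
  have "x = encode_instance (v, w, a) \<longleftrightarrow> length x = o' (length blocks) \<and>
      (\<forall>i<length blocks. \<forall>k<length (words ! i). bit_at x (o' i + k) = words ! i ! k)"
    unfolding encode_words eq_concat_iff_bit_at length_words o'_def ..
  also have "\<dots> \<longleftrightarrow> length x = off u (nblocks u) \<and>
      (\<forall>i<Suc (2 * length v). (\<forall>k<blk u i. bit_at x (off u i + k)) \<and> \<not> bit_at x (off u i + blk u i)) \<and>
      (\<forall>i<length a. (\<forall>k<length (binary (a ! i)). bit_at x (off u (Suc (2 * length v) + i) + 2 * k) \<and>
          bit_at x (off u (Suc (2 * length v) + i) + (2 * k + 1)) = binary (a ! i) ! k) \<and>
        \<not> bit_at x (off u (Suc (2 * length v) + i) + 2 * length (binary (a ! i))))"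
    (is "_ \<longleftrightarrow> _ \<and> _ \<and> (\<forall>i<length a. ?Q i)")
  proof -
    have 1: "(\<forall>k<length (words ! i). bit_at x (o' i + k) = words ! i ! k) \<longleftrightarrow>
        (\<forall>k<blk u i. bit_at x (off u i + k)) \<and> \<not> bit_at x (off u i + blk u i)"
      if "i < Suc (2 * length v)" for i
    proof -
      have "off u i = o' i" "blk u i = blocks ! i"
        using that off[of i] blk[of i] by (simp_all add: length_blocks o'_def)
      thus ?thesis by (simp only: nth_words(1)[OF that] unary_block_iff)
    qed
    have 2: "(\<forall>k<length (words ! (Suc (2 * length v) + i)). bit_at x (o' (Suc (2 * length v) + i) + k) =
        words ! (Suc (2 * length v) + i) ! k) \<longleftrightarrow> ?Q i"
      if "i < length a" for i
    proof -
      have "off u (Suc (2 * length v) + i) = o' (Suc (2 * length v) + i)"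
        using that off[of "Suc (2 * length v) + i"] by (simp add: length_blocks o'_def)
      thus ?thesis by (simp only: nth_words(2)[OF that] framed_block_iff)
    qed
    have "off u (nblocks u) = o' (length blocks)" by (simp add: off sizes o'_def)
    thus ?thesis unfolding all_blocks using 1 2 by simp
  qed
  also have "\<dots> \<longleftrightarrow> enc_ok (length x) (bit_at x) u"
  proof -
    have "?Q i \<longleftrightarrow> (\<forall>k<blk u (Suc (2 * length v) + i). dig u (Suc (2 * length v) + i) k \<le> 1 \<and>
          bit_at x (off u (Suc (2 * length v) + i) + 2 * k) \<and>
          (bit_at x (off u (Suc (2 * length v) + i) + (2 * k + 1)) \<longleftrightarrow>
            dig u (Suc (2 * length v) + i) (blk u (Suc (2 * length v) + i) - 1 - k) = 1)) \<and>
        \<not> bit_at x (off u (Suc (2 * length v) + i) + 2 * blk u (Suc (2 * length v) + i)) \<and>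
        (0 < blk u (Suc (2 * length v) + i) \<longrightarrow>
          dig u (Suc (2 * length v) + i) (blk u (Suc (2 * length v) + i) - 1) = 1)"
      if i: "i < length a" for i
    proof -
      have b: "blk u (Suc (2 * length v) + i) = length (binary (a ! i))"
        using blk[of "Suc (2 * length v) + i"] i nth_blocks(4)[OF i] by (simp add: length_blocks)
      have d: "dig u (Suc (2 * length v) + i) k = of_bool (bit (a ! i) k)"
        if "k < length (binary (a ! i))" for k
        using assms i that by (simp add: enc_match_def)
      have top: "bit (a ! i) (length (binary (a ! i)) - 1)" if "0 < length (binary (a ! i))"
        using binary_bits(2)[of "a ! i"] that by simp
      show ?thesis
        unfolding b using d top by (auto simp: nth_binary)
    qed
    moreover have "(\<forall>i<nblocks u. Suc (2 * length v) \<le> i \<longrightarrow> P i) \<longleftrightarrow>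
        (\<forall>i<length a. P (Suc (2 * length v) + i))" for P
      unfolding sizes all_blocks by auto
    ultimately show ?thesis unfolding enc_ok_def sizes(1) by simp
  qed
  finally show ?thesis ..
qed

end

text \<open>Any accepted parse describes some triple, which is read off it. The condition on the top
  digit makes the guessed digit counts agree with the lengths of \<open>binary\<close>.\<close>

lemma enc_ok_match:
  assumes "enc_ok n X u"
  shows "\<exists>v w a. instance_data v w a \<and> instance_data.enc_match v w a u"
proof -
  define m where "m = blk u 0"
  define v where "v = map (\<lambda>i. blk u (Suc i)) [0..<m]"
  define w where "w = map (\<lambda>i. blk u (Suc (m + i))) [0..<m]"
  \<comment> \<open>The least significant digit comes first, as \<open>horner_sum\<close>
    expects.\<close>
  define digs where "digs = (\<lambda>i. map (\<lambda>k. dig u (Suc (2 * m) + i) k = 1) [0..<blk u (Suc (2 * m) + i)])"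
  define a where "a = map (\<lambda>i. horner_sum of_bool 2 (digs i) :: nat) [0..<csize u - 1]"
  have csize: "code_size w = csize u"
    by (simp add: code_size_def csize_def w_def m_def sum_list_sum_nth atLeast0LessThan sum_Suc)
  interpret instance_data v w a
    by unfold_locales (simp_all add: csize, simp_all add: v_def w_def a_def)
  have len: "length v = m" "length w = m" "length a = csize u - 1"
    by (simp_all add: v_def w_def a_def)
  have bit_a: "bit (a ! i) k \<longleftrightarrow> k < blk u (Suc (2 * m) + i) \<and> dig u (Suc (2 * m) + i) k = 1"
    if "i < length a" for i k
    using that by (auto simp: a_def bit_horner_sum_bit_iff digs_def)
  have ok: "dig u (Suc (2 * m) + i) k \<le> 1" "dig u (Suc (2 * m) + i) (blk u (Suc (2 * m) + i) - 1) = 1"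
    if "i < length a" "k < blk u (Suc (2 * m) + i)" for i k
  proof -
    have "Suc (2 * m) + i < nblocks u" using that(1) by (simp add: nblocks_def m_def len)
    thus "dig u (Suc (2 * m) + i) k \<le> 1" "dig u (Suc (2 * m) + i) (blk u (Suc (2 * m) + i) - 1) = 1"
      using assms that(2) by (auto simp: enc_ok_def m_def)
  qed
  have length_binary: "length (binary (a ! i)) = blk u (Suc (2 * m) + i)" if "i < length a" for i
    by (rule length_binary_unique) (use ok(2)[OF that] in \<open>auto simp: bit_a[OF that]\<close>)
  have "blk u i = blocks ! i" if "i < length blocks" for i
  proof -
    have "i = 0 \<or> (\<exists>j<m. i = Suc j) \<or> (\<exists>j<m. i = Suc (m + j)) \<or> (\<exists>j<length a. i = Suc (2 * m) + j)"
      using that unfolding length_blocks len(1) by presburger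
    then consider "i = 0" | j where "i = Suc j" "j < m" | j where "i = Suc (m + j)" "j < m"
      | j where "i = Suc (2 * m) + j" "j < length a" by blast
    thus ?thesis
    proof cases
      case 1
      thus ?thesis by (simp add: nth_blocks len) (simp add: m_def)
    next
      case (2 j)
      thus ?thesis using nth_blocks(2)[of j] by (simp add: len) (simp add: v_def)
    next
      case (3 j)
      thus ?thesis using nth_blocks(3)[of j] by (simp add: len) (simp add: w_def)
    next
      case (4 j)
      thus ?thesis using nth_blocks(4)[of j] length_binary[of j] by (simp add: len)
    qed
  qed
  moreover have "dig u (Suc (2 * length v) + i) k = of_bool (bit (a ! i) k)"
    if "i < length a" "k < length (binary (a ! i))" for i k
    using ok(1)[OF that(1), of k] that
    by (auto simp: length_binary bit_a len le_Suc_eq)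
  ultimately have "enc_match u" by (simp add: enc_match_def)
  thus ?thesis using instance_data_axioms by blast
qed

section \<open>Correspondence between weighted chains and certificates\<close>

lemma label_count_eq_sum: "label_count C i = (\<Sum>r<length C. of_bool (fst (fst (C ! r)) = i))"
proof -
  have "(\<Sum>r<length C. of_bool (fst (fst (C ! r)) = i) :: nat) = card {r \<in> {..<length C}. fst (fst (C ! r)) = i}"
    by (rule sum_of_bool_eq_card) simp
  also have "{r \<in> {..<length C}. fst (fst (C ! r)) = i} = {r. r < length C \<and> i = map (fst \<circ> fst) C ! r}"
    by auto
  also have "card \<dots> = label_count C i"
    by (simp add: label_count_def count_list_eq_length_filter length_filter_conv_card cong: conj_cong)
  finally show ?thesis ..
qed

text \<open>\<open>n\<close> is below \<open>2 ^ k\<close>, and so is \<open>t\<close>. A number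
  chosen below a coordinate thus fits into as many digits as that coordinate has.\<close>

lemma bit_above_binary: "t \<le> n \<Longrightarrow> length (binary n) \<le> k \<Longrightarrow> \<not> bit t k"
proof -
  assume t: "t \<le> n" and k: "length (binary n) \<le> k"
  have "take_bit k n = n"
    using binary_bits(3)[of n] k
    by (intro bit_eqI) (metis bit_take_bit_iff le_trans linorder_not_less)
  hence "t < 2 ^ k" using t by (metis take_bit_nat_less_exp le_less_trans)
  thus "\<not> bit t k" by (metis bit_take_bit_iff less_irrefl take_bit_nat_eq_self)
qed

text \<open>Every edge adds one inversion, and inversions are pairs of positions.\<close>

lemma is_chain_length_le:
  assumes "is_chain N \<sigma> C \<pi>"
  shows "length C \<le> Suc N * Suc N"
proof -
  have "\<pi> permutes {1..N}" using assms is_chain_iff by auto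
  hence "perm_length \<pi> = inversions N \<pi>" by (rule perm_length_eq_inversions) simp
  also have "\<dots> \<le> (\<Sum>i<Suc N. \<Sum>j<Suc N. 1)"
    unfolding inversions_def by (intro sum_mono) simp
  finally show ?thesis using is_chain_length[OF assms] by simp
qed

context instance_data
begin

abbreviation "N \<equiv> code_size w"
abbreviation "\<sigma> \<equiv> perm_of_code v"
abbreviation "\<pi> \<equiv> perm_of_code w"

definition mult :: "chain \<Rightarrow> nat \<Rightarrow> nat" where
  "mult C i = N - i - label_count C i"

definition choices :: "(chain \<times> (nat \<Rightarrow> nat \<Rightarrow> nat)) set" where
  "choices = (SIGMA C:increasing_chains N \<sigma> \<pi>.
     Pi\<^sub>E {1..N-1} (\<lambda>i. Pi\<^sub>E {..<mult C i} (\<lambda>_. {..<a ! (i - 1)})))"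

text \<open>A power counts functions: \<open>mult C i\<close> places filled with numbers below
  \<open>a ! (i - 1)\<close>. The product sets are extensional, so their cardinalities multiply to
  exactly the value of the monomial.\<close>

lemma card_choices: "card choices = skew_schubert_code w v (\<lambda>i. a ! (i - 1))"
proof -
  have "card choices = (\<Sum>C\<in>increasing_chains N \<sigma> \<pi>.
      card (Pi\<^sub>E {1..N-1} (\<lambda>i. Pi\<^sub>E {..<mult C i} (\<lambda>_. {..<a ! (i - 1)}))))"
    unfolding choices_def
    by (intro card_SigmaI finite_increasing_chains ballI finite_PiE) simp_all
  thus ?thesis
    by (simp add: skew_schubert_code_def skew_schubert_def card_PiE mult_def)
qed

text \<open>The layout of \<open>used\<close> with its sizes taken from the instance and the chain
  rather than from the certificate; \<open>used_iff_slot\<close> reconciles the two.\<close>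

definition slot :: "chain \<Rightarrow> nat \<Rightarrow> nat \<Rightarrow> nat \<Rightarrow> nat \<Rightarrow> bool" where
  "slot C c i j k \<longleftrightarrow>
     c = 0 \<and> i < length blocks \<and> j = 0 \<and> k = 0 \<or>
     c = 1 \<and> Suc (2 * length v) \<le> i \<and> i < length blocks \<and> j < blocks ! i \<and> k = 0 \<or>
     c = 2 \<and> i \<le> length C \<and> 1 \<le> j \<and> j \<le> N \<and> k = 0 \<or>
     c = 3 \<and> i = 0 \<and> j = 0 \<and> k = 0 \<or>
     (c = 4 \<or> c = 5) \<and> i < length C \<and> j = 0 \<and> k = 0 \<or>
     c = 6 \<and> 1 \<le> i \<and> i < N \<and> j < mult C i \<and> k < length (binary (a ! (i - 1)))"

definition table :: "chain \<Rightarrow> (nat \<Rightarrow> nat \<Rightarrow> nat) \<Rightarrow> nat \<Rightarrow> nat \<Rightarrow> nat \<Rightarrow> nat \<Rightarrow> nat" where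
  "table C t c i j k =
     (if \<not> slot C c i j k then 0
      else if c = 0 then blocks ! i
      else if c = 1 then of_bool (bit (a ! (i - Suc (2 * length v))) j)
      else if c = 2 then states \<sigma> C i j
      else if c = 3 then length C
      else if c = 4 then fst (fst (C ! i))
      else if c = 5 then snd (fst (C ! i))
      else of_bool (bit (t i j) k))"

definition fill :: "chain \<Rightarrow> (nat \<Rightarrow> nat \<Rightarrow> nat) \<Rightarrow> nat \<Rightarrow> nat" where
  "fill C t p = (let (q, r) = prod_decode p; (c, i) = prod_decode q; (j, k) = prod_decode r
     in table C t c i j k)"

lemma fill_addr [simp]: "fill C t (addr c i j k) = table C t c i j k"
  by (simp add: fill_def addr_def)

lemma eq_fill_iff: "u = fill C t \<longleftrightarrow> (\<forall>c i j k. u (addr c i j k) = table C t c i j k)"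
  by (auto simp: fun_eq_iff) (metis ex_addr fill_addr)

lemma enc_match_fill: "enc_match (fill C t)"
  unfolding enc_match_def blk_def dig_def
  using nth_blocks(4) by (auto simp: table_def slot_def length_blocks)

lemma records_fill: "records N \<sigma> (hgt (fill C t)) (prm (fill C t)) (pos (fill C t)) (val (fill C t)) C"
  by (auto simp: records_def hgt_def prm_def pos_def val_def table_def slot_def)

lemma nrep_eq_mult:
  assumes "enc_match u" "records N \<sigma> (hgt u) (prm u) (pos u) (val u) C"
  shows "nrep u i = mult C i"
proof -
  have "(\<Sum>r<hgt u. of_bool (pos u r = i)) = (\<Sum>r<length C. of_bool (fst (fst (C ! r)) = i) :: nat)"
    using assms(2) by (intro sum.cong) (auto simp: records_def)
  thus ?thesis
    unfolding nrep_def mult_def enc_match_sizes(2)[OF assms(1)] label_count_eq_sum by simp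
qed

lemma enc_match_digits:
  assumes "enc_match u" "1 \<le> i" "i < N"
  shows "blk u (2 * blk u 0 + i) = length (binary (a ! (i - 1)))"
    "k < length (binary (a ! (i - 1))) \<Longrightarrow> dig u (2 * blk u 0 + i) k = of_bool (bit (a ! (i - 1)) k)"
proof -
  have i: "2 * blk u 0 + i = Suc (2 * length v) + (i - 1)" "i - 1 < length a"
    using assms(2,3) by (simp_all add: enc_match_sizes(1)[OF assms(1)] length_a)
  have "blk u (Suc (2 * length v) + (i - 1)) = blocks ! (Suc (2 * length v) + (i - 1))"
    using assms(1) i(2) by (simp add: enc_match_def length_blocks)
  thus "blk u (2 * blk u 0 + i) = length (binary (a ! (i - 1)))"
    unfolding i(1) nth_blocks(4)[OF i(2)] .
  show "dig u (2 * blk u 0 + i) k = of_bool (bit (a ! (i - 1)) k)"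
    if "k < length (binary (a ! (i - 1)))"
    using assms(1) i(2) that unfolding i(1) enc_match_def by blast
qed

lemma chain_ok_cert:
  assumes "enc_match u"
  shows "chain_ok (csize u) (\<lambda>i. if i \<le> blk u 0 then blk u i else 0)
      (\<lambda>i. if i \<le> blk u 0 then blk u (blk u 0 + i) else 0) (hgt u) (prm u) (pos u) (val u) \<longleftrightarrow>
    (\<exists>C\<in>increasing_chains N \<sigma> \<pi>. records N \<sigma> (hgt u) (prm u) (pos u) (val u) C)"
  unfolding enc_match_sizes[OF assms]
proof (rule chain_ok_iff)
  show "length v \<le> N" "length w \<le> N" by (simp_all add: code_size_def length_eq)
  have blk: "blk u i = blocks ! i" if "i < length blocks" for i
    using assms that by (simp add: enc_match_def)
  fix i :: nat assume i: "1 \<le> i"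
  show "(if i \<le> length v then blk u i else 0) = (if i \<le> length v then v ! (i - 1) else 0)"
    using i nth_blocks(2)[of "i - 1"] by (simp add: blk length_blocks)
  show "(if i \<le> length v then blk u (length v + i) else 0) = (if i \<le> length w then w ! (i - 1) else 0)"
    using i nth_blocks(3)[of "i - 1"] by (simp add: blk length_blocks flip: length_eq)
qed

lemma num_cond_iff:
  assumes "enc_match u" "1 \<le> i" "i < N" "\<And>k. length (binary (a ! (i - 1))) \<le> k \<Longrightarrow> \<not> bit s k"
    "\<And>k. k < length (binary (a ! (i - 1))) \<Longrightarrow> num u i c k = of_bool (bit s k)"
  shows "(\<exists>k<blk u (2 * blk u 0 + i). dig u (2 * blk u 0 + i) k = 1 \<and> num u i c k = 0 \<and>
        (\<forall>k'<blk u (2 * blk u 0 + i). k < k' \<longrightarrow> dig u (2 * blk u 0 + i) k' = num u i c k')) \<longleftrightarrow>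
    s < a ! (i - 1)"
proof -
  let ?L = "length (binary (a ! (i - 1)))"
  have "s < a ! (i - 1) \<longleftrightarrow> (\<exists>k<?L. bit (a ! (i - 1)) k \<and> \<not> bit s k \<and>
      (\<forall>k'<?L. k < k' \<longrightarrow> (bit (a ! (i - 1)) k' \<longleftrightarrow> bit s k')))"
    using binary_bits(3) assms(4) by (intro less_iff_bits) auto
  thus ?thesis
    unfolding enc_match_digits(1)[OF assms(1-3)]
    by (simp add: enc_match_digits(2)[OF assms(1-3)] assms(5) of_bool_eq_iff del: One_nat_def
        cong: conj_cong imp_cong)
qed

lemma used_iff_slot:
  assumes "enc_match u" "records N \<sigma> (hgt u) (prm u) (pos u) (val u) C"
  shows "used u c i j k \<longleftrightarrow> slot C c i j k"
proof -
  have 1: "Suc (2 * length v) \<le> i \<and> i < length blocks \<and> j < blk u i \<and> k = 0 \<longleftrightarrow>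
      Suc (2 * length v) \<le> i \<and> i < length blocks \<and> j < blocks ! i \<and> k = 0"
    using assms(1) unfolding enc_match_def by metis
  have 6: "1 \<le> i \<and> i < N \<and> j < mult C i \<and> k < blk u (2 * blk u 0 + i) \<longleftrightarrow>
      1 \<le> i \<and> i < N \<and> j < mult C i \<and> k < length (binary (a ! (i - 1)))"
    using enc_match_digits(1)[OF assms(1)] by metis
  have "hgt u = length C" using assms(2) by (simp add: records_def)
  thus ?thesis
    unfolding used_def slot_def nrep_eq_mult[OF assms] enc_match_sizes(2,3)[OF assms(1)] 6
    unfolding enc_match_sizes(1)[OF assms(1)] 1 by (simp only:)
qed

text \<open>No entry is left undetermined: tags 0 and 1 are fixed by the instance, 2 to 5 by the
  chain, 6 by the chosen numbers, and the rest is 0.\<close>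

lemma eq_fill:
  assumes "enc_match u" "records N \<sigma> (hgt u) (prm u) (pos u) (val u) C"
    and "\<And>c i j k. \<not> used u c i j k \<Longrightarrow> u (addr c i j k) = 0"
    and "\<And>i c k. used u 6 i c k \<Longrightarrow> num u i c k = of_bool (bit (t i c) k)"
  shows "u = fill C t"
  unfolding eq_fill_iff
proof (intro allI)
  fix c i j k
  note used = used_iff_slot[OF assms(1,2)]
  show "u (addr c i j k) = table C t c i j k"
  proof (cases "used u c i j k")
    case False
    thus ?thesis using assms(3)[OF False] unfolding used by (simp add: table_def)
  next
    case True
    have 6: "c = 6 \<Longrightarrow> u (addr c i j k) = of_bool (bit (t i j) k)"
      using assms(4)[of i j k] True by (simp add: num_def)
    have 1: "u (addr 1 i j 0) = of_bool (bit (a ! (i - Suc (2 * length v))) j)"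
      if "Suc (2 * length v) \<le> i" "i < length blocks" "j < blocks ! i"
    proof -
      obtain i' where i': "i = Suc (2 * length v) + i'" using \<open>Suc (2 * length v) \<le> i\<close> le_Suc_ex by blast
      hence "i' < length a" using that(2) by (simp add: length_blocks)
      thus ?thesis
        using assms(1) that(3) nth_blocks(4)[of i'] unfolding enc_match_def dig_def i' by simp
    qed
    have slot: "slot C c i j k" using True unfolding used .
    hence table: "table C t c i j k = (if c = 0 then blocks ! i
      else if c = 1 then of_bool (bit (a ! (i - Suc (2 * length v))) j)
      else if c = 2 then states \<sigma> C i j else if c = 3 then length C
      else if c = 4 then fst (fst (C ! i)) else if c = 5 then snd (fst (C ! i))
      else of_bool (bit (t i j) k))" by (simp add: table_def)
    show ?thesis
      using slot assms(1,2) 1 6 unfolding table slot_def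
      by (elim disjE conjE)
        (simp_all add: enc_match_def records_def blk_def prm_def hgt_def pos_def val_def)
  qed
qed

lemma length_encode: "length (encode_instance (v, w, a)) = (\<Sum>i<length blocks. length (words ! i))"
  unfolding encode_words length_words[symmetric]
  using eq_concat_iff_bit_at[of "concat words" words] by blast

text \<open>Every word has at least one bit, so there are at most \<open>n\<close> blocks. The
  coordinates account for \<open>N - 1\<close> of them and the length of the codes for one more,
  whence \<open>N\<close> is at most \<open>n\<close>.\<close>

lemma size_bounds:
  defines "n \<equiv> length (encode_instance (v, w, a))"
  shows "length blocks \<le> n" "i < length blocks \<Longrightarrow> blocks ! i \<le> n" "N \<le> n"
proof -
  have len: "Suc (blocks ! i) \<le> length (words ! i)" if "i < length blocks" for i
    using that by (simp add: length_nth_words)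
  have "(\<Sum>i<length blocks. 1) \<le> n"
    unfolding n_def length_encode using len by (intro sum_mono) (metis One_nat_def Suc_le_mono le0 lessThan_iff order_trans)
  thus 1: "length blocks \<le> n" by simp
  show "blocks ! i \<le> n" if "i < length blocks"
  proof -
    have "length (words ! i) \<le> n"
      unfolding n_def length_encode using that by (intro member_le_sum) auto
    thus ?thesis using len[OF that] by linarith
  qed
  show "N \<le> n" using 1 by (simp add: length_blocks length_a)
qed

lemma binary_le:
  assumes "1 \<le> i" "i < N"
  shows "length (binary (a ! (i - 1))) \<le> length (encode_instance (v, w, a))"
  using size_bounds(2)[of "Suc (2 * length v) + (i - 1)"] nth_blocks(4)[of "i - 1"] assms
  by (simp add: length_blocks length_a)

lemma used_fill_bounds:
  assumes "C \<in> increasing_chains N \<sigma> \<pi>" "used (fill C t) c i j k"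
  defines "b \<equiv> poly index_bound (length (encode_instance (v, w, a)))"
  shows "c < 7" "i < b" "j < b" "k < b"
proof -
  define n where "n = length (encode_instance (v, w, a))"
  have n: "length blocks \<le> n" "N \<le> n" "\<And>i. i < length blocks \<Longrightarrow> blocks ! i \<le> n"
    "\<And>i. 1 \<le> i \<Longrightarrow> i < N \<Longrightarrow> length (binary (a ! (i - 1))) \<le> n"
    using size_bounds binary_le by (simp_all add: n_def)
  have "length C \<le> Suc N * Suc N"
    using assms(1) is_chain_length_le by (auto simp: increasing_chains_def)
  also have "\<dots> \<le> Suc n * Suc n" using n(2) by (intro mult_mono) auto
  also have "\<dots> < b" by (simp add: b_def n_def poly_index_bound del: encode_instance.simps)
  finally have C: "length C < b" .
  have "b = Suc n * Suc n + 7" by (simp only: b_def n_def poly_index_bound)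
  hence "n < b" by simp
  have "mult C i \<le> N" by (simp add: mult_def)
  note used = assms(2)[unfolded used_iff_slot[OF enc_match_fill records_fill] slot_def]
  show "c < 7" using used by auto
  show "i < b" using used C \<open>n < b\<close> n(1,2) by auto
  show "j < b" using used \<open>n < b\<close> n(2) n(3)[of i] \<open>mult C i \<le> N\<close> by auto
  show "k < b" using used \<open>n < b\<close> n(4)[of i] by auto
qed

lemma table_nonzero_used: "table C t c i j k \<noteq> 0 \<Longrightarrow> used (fill C t) c i j k"
  unfolding used_iff_slot[OF enc_match_fill records_fill] by (auto simp: table_def split: if_splits)

lemma table_le:
  assumes "C \<in> increasing_chains N \<sigma> \<pi>"
  shows "table C t c i j k \<le> poly index_bound (length (encode_instance (v, w, a)))"
proof -
  define n where "n = length (encode_instance (v, w, a))"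
  have chain: "is_chain N \<sigma> C \<pi>" using assms by (simp add: increasing_chains_def)
  have "length C \<le> Suc N * Suc N" by (rule is_chain_length_le[OF chain])
  also have "\<dots> \<le> Suc n * Suc n" using size_bounds(3) by (intro mult_mono) (auto simp: n_def)
  finally have 1: "length C \<le> Suc n * Suc n" .
  have 2: "blocks ! i \<le> n" if "i < length blocks" using size_bounds(2)[OF that] by (simp add: n_def)
  have 3: "states \<sigma> C i j \<le> n" if "i \<le> length C" "1 \<le> j" "j \<le> N"
  proof -
    have "states \<sigma> C i permutes {1..N}" using chain that(1) is_chain_iff by blast
    hence "states \<sigma> C i j \<in> {1..N}" using that by (subst permutes_in_image) auto
    thus ?thesis using size_bounds(3) by (simp add: n_def)
  qed
  have 4: "fst (fst (C ! i)) \<le> n \<and> snd (fst (C ! i)) \<le> n" if "i < length C"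
  proof -
    have "C ! i \<in> ({0..N} \<times> {0..N}) \<times> {\<rho>. \<rho> permutes {1..N}}"
      using is_chain_set[OF chain] nth_mem[OF that] by blast
    thus ?thesis using size_bounds(3) by (auto simp: n_def)
  qed
  have "n \<le> Suc n * Suc n" by simp
  have "table C t c i j k \<le> Suc n * Suc n + 7"
  proof (cases "slot C c i j k")
    case True
    consider "c = 0" "i < length blocks" | "c = 2" "i \<le> length C" "1 \<le> j" "j \<le> N" | "c = 3"
      | "c = 4" "i < length C" | "c = 5" "i < length C" | "c = 1 \<or> c = 6"
      using True unfolding slot_def by blast
    thus ?thesis
      using True \<open>n \<le> _\<close> 1 2 3 4 by cases (auto simp: table_def)
  qed (simp add: table_def)
  thus ?thesis by (simp add: poly_index_bound n_def)
qed

definition certs :: "(nat \<Rightarrow> nat) set" where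
  "certs = (let x = encode_instance (v, w, a); q = poly cert_bound (length x) in
     {u. (\<forall>p. u p \<le> q) \<and> (\<forall>p\<ge>q. u p = 0) \<and> cert_ok (length x) (bit_at x) u})"

lemma fill_in_certs:
  assumes "(C, t) \<in> choices"
  shows "fill C t \<in> certs"
proof -
  define x where "x = encode_instance (v, w, a)"
  let ?u = "fill C t" and ?q = "poly cert_bound (length x)"
  have C: "C \<in> increasing_chains N \<sigma> \<pi>" using assms by (simp add: choices_def)
  have t: "t i c < a ! (i - 1)" if "1 \<le> i" "i < N" "c < mult C i" for i c
    using assms that by (force simp: choices_def PiE_iff)
  note match = enc_match_fill[of C t] and rec = records_fill[of C t]
  have used: "\<exists>c<7. \<exists>i<poly index_bound (length x). \<exists>j<poly index_bound (length x).
      \<exists>k<poly index_bound (length x). p = addr c i j k \<and> used ?u c i j k"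
    if nz: "?u p \<noteq> 0" for p
  proof -
    obtain c i j k where p: "p = addr c i j k" using ex_addr by blast
    hence "used ?u c i j k" using nz table_nonzero_used by simp
    thus ?thesis using used_fill_bounds[OF C] p by (auto simp: x_def)
  qed
  have "?u p \<le> ?q" for p
  proof -
    obtain c i j k where "p = addr c i j k" using ex_addr by blast
    thus ?thesis
      using table_le[OF C, of t c i j k] index_bound_le_cert_bound[of "length x"] by (simp add: x_def)
  qed
  moreover have "?u p = 0" if "p \<ge> ?q" for p
  proof (rule ccontr)
    assume "?u p \<noteq> 0"
    then obtain c i j k where "c < 7" "i < poly index_bound (length x)"
      "j < poly index_bound (length x)" "k < poly index_bound (length x)" "p = addr c i j k"
      using used by blast
    hence "p < ?q"
      using addr_less[of c "poly index_bound (length x)" i j k]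
      by (simp add: cert_bound_def poly_index_bound)
    thus False using that by simp
  qed
  moreover have "cert_ok (length x) (bit_at x) ?u"
    unfolding cert_ok_def
  proof (intro conjI)
    show "enc_ok (length x) (bit_at x) ?u" using enc_ok_iff[OF match, of x] by (simp add: x_def)
    show "chain_ok (csize ?u) (\<lambda>i. if i \<le> blk ?u 0 then blk ?u i else 0)
        (\<lambda>i. if i \<le> blk ?u 0 then blk ?u (blk ?u 0 + i) else 0) (hgt ?u) (prm ?u) (pos ?u) (val ?u)"
      unfolding chain_ok_cert[OF match] using C rec by blast
    show "num_ok ?u"
      unfolding num_ok_def nrep_eq_mult[OF match rec] enc_match_sizes(2)[OF match]
    proof (intro allI impI conjI)
      fix i c assume i: "i < N" "1 \<le> i" and c: "c < mult C i"
      have num: "num ?u i c k = of_bool (bit (t i c) k)" if "k < length (binary (a ! (i - 1)))" for k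
        using that i c by (simp add: num_def table_def slot_def)
      show "num ?u i c k \<le> 1" if "k < blk ?u (2 * blk ?u 0 + i)" for k
        using num[of k] that unfolding enc_match_digits(1)[OF match i(2,1)] by simp
      show "\<exists>k<blk ?u (2 * blk ?u 0 + i). dig ?u (2 * blk ?u 0 + i) k = 1 \<and> num ?u i c k = 0 \<and>
        (\<forall>k'<blk ?u (2 * blk ?u 0 + i). k < k' \<longrightarrow> dig ?u (2 * blk ?u 0 + i) k' = num ?u i c k')"
        using t[OF i(2,1) c] bit_above_binary[OF less_imp_le]
        by (subst num_cond_iff[OF match i(2,1), of "t i c"]) (auto simp: num)
    qed
    show "supp_ok (length x) ?u" unfolding supp_ok_def using used by blast
  qed
  ultimately show ?thesis by (simp add: certs_def x_def Let_def)
qed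

text \<open>The chain is recovered by \<open>records_unique\<close> and each number from its stored
  digits, its higher bits being zero. Outside the index ranges the functions agree by
  extensionality.\<close>

lemma inj_fill: "inj_on (\<lambda>(C, t). fill C t) choices"
proof (rule inj_onI, clarify)
  fix C t C' t' assume *: "(C, t) \<in> choices" "(C', t') \<in> choices" and eq: "fill C t = fill C' t'"
  have t: "t \<in> Pi\<^sub>E {1..N-1} (\<lambda>i. Pi\<^sub>E {..<mult C i} (\<lambda>_. {..<a ! (i - 1)}))"
    and t': "t' \<in> Pi\<^sub>E {1..N-1} (\<lambda>i. Pi\<^sub>E {..<mult C' i} (\<lambda>_. {..<a ! (i - 1)}))"
    and "is_chain N \<sigma> C \<pi>" "is_chain N \<sigma> C' \<pi>"
    using * by (simp_all add: choices_def increasing_chains_def)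
  hence C: "C = C'"
    using records_unique[OF records_fill[of C t] records_fill[of C' t', folded eq]] by blast
  have "t i = t' i" if i: "i \<in> {1..N-1}" for i
  proof (rule PiE_ext)
    have "1 \<le> i" "i < N" using i by auto
    show ti: "t i \<in> Pi\<^sub>E {..<mult C i} (\<lambda>_. {..<a ! (i - 1)})" using t i by (rule PiE_mem)
    show ti': "t' i \<in> Pi\<^sub>E {..<mult C i} (\<lambda>_. {..<a ! (i - 1)})" using t' i unfolding C by (rule PiE_mem)
    fix c assume c: "c \<in> {..<mult C i}"
    hence less: "t i c < a ! (i - 1)" "t' i c < a ! (i - 1)"
      using PiE_mem[OF ti c] PiE_mem[OF ti' c] by simp_all
    show "t i c = t' i c"
    proof (rule bit_eqI)
      fix k
      show "bit (t i c) k \<longleftrightarrow> bit (t' i c) k"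
      proof (cases "k < length (binary (a ! (i - 1)))")
        case True
        have "table C t 6 i c k = table C t' 6 i c k" using fun_cong[OF eq, of "addr 6 i c k"] C by simp
        thus ?thesis using True \<open>1 \<le> i\<close> \<open>i < N\<close> c by (simp add: table_def slot_def of_bool_eq_iff)
      next
        case False
        thus ?thesis using less bit_above_binary[OF less_imp_le] by (simp add: not_less)
      qed
    qed
  qed
  hence "t = t'" by (rule PiE_ext[OF t t'[folded C]])
  thus "C = C' \<and> t = t'" using C by simp
qed

lemma certs_subset_fill: "certs \<subseteq> (\<lambda>(C, t). fill C t) ` choices"
proof
  define x where "x = encode_instance (v, w, a)"
  let ?q = "poly cert_bound (length x)"
  fix u assume "u \<in> certs"
  hence u: "\<And>p. p \<ge> ?q \<Longrightarrow> u p = 0" and ok: "cert_ok (length x) (bit_at x) u"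
    by (simp_all add: certs_def x_def Let_def)
  obtain v' w' a' where inst': "instance_data v' w' a'" and match': "instance_data.enc_match v' w' a' u"
    using ok enc_ok_match unfolding cert_ok_def by blast
  have "x = encode_instance (v', w', a')"
    using ok instance_data.enc_ok_iff[OF inst' match'] by (simp add: cert_ok_def)
  \<comment> \<open>The parsed triple is at first just some triple with encoding \<open>x\<close>.
    Equal lengths of its two codes make the encoding uniquely decodable.\<close>
  hence "(v, w, a) = (v', w', a')"
    using instance_data.length_eq[OF inst'] length_eq unfolding x_def
    by (auto simp: unary_append_eq concat_unary_append_eq concat_framed_binary_eq)
  hence match: "enc_match u" using match' by simp
  obtain C where C: "C \<in> increasing_chains N \<sigma> \<pi>"
    and rec: "records N \<sigma> (hgt u) (prm u) (pos u) (val u) C"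
    using ok chain_ok_cert[OF match] unfolding cert_ok_def by blast
  have zero: "u (addr c i j k) = 0" if "\<not> used u c i j k" for c i j k
  proof (cases "addr c i j k < ?q")
    case True
    thus ?thesis using ok that unfolding cert_ok_def supp_ok_def by (metis addr_eq_iff)
  qed (use u in simp)
  define s where "s = (\<lambda>i c. horner_sum of_bool 2
    (map (\<lambda>k. num u i c k = 1) [0..<length (binary (a ! (i - 1)))]) :: nat)"
  \<comment> \<open>Restriction to the index ranges makes the family extensional, as membership in
    \<open>choices\<close> demands.\<close>
  define t where "t = (\<lambda>i\<in>{1..N-1}. \<lambda>c\<in>{..<mult C i}. s i c)"
  have bit_s: "bit (s i c) k \<longleftrightarrow> k < length (binary (a ! (i - 1))) \<and> num u i c k = 1" for i c k
    by (auto simp: s_def bit_horner_sum_bit_iff)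
  have num: "num u i c k = of_bool (bit (s i c) k)"
    if "1 \<le> i" "i < N" "c < mult C i" "k < length (binary (a ! (i - 1)))" for i c k
  proof -
    have "num u i c k \<le> 1"
      using ok that enc_match_digits(1)[OF match that(1,2)]
      by (simp add: cert_ok_def num_ok_def nrep_eq_mult[OF match rec] enc_match_sizes(2)[OF match])
    thus ?thesis using that(4) by (auto simp: bit_s le_Suc_eq)
  qed
  have less: "s i c < a ! (i - 1)" if "1 \<le> i" "i < N" "c < mult C i" for i c
  proof (subst num_cond_iff[OF match that(1,2), of "s i c" c, symmetric])
    show "\<exists>k<blk u (2 * blk u 0 + i). dig u (2 * blk u 0 + i) k = 1 \<and> num u i c k = 0 \<and>
        (\<forall>k'<blk u (2 * blk u 0 + i). k < k' \<longrightarrow> dig u (2 * blk u 0 + i) k' = num u i c k')"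
      using ok that unfolding cert_ok_def num_ok_def nrep_eq_mult[OF match rec]
        enc_match_sizes(2)[OF match] by blast
  qed (use num that in \<open>auto simp: bit_s\<close>)
  have "(C, t) \<in> choices"
    unfolding choices_def t_def
  proof (intro SigmaI C)
    show "(\<lambda>i\<in>{1..N-1}. \<lambda>c\<in>{..<mult C i}. s i c) \<in>
        Pi\<^sub>E {1..N-1} (\<lambda>i. Pi\<^sub>E {..<mult C i} (\<lambda>_. {..<a ! (i - 1)}))"
      unfolding restrict_PiE_iff using less by auto
  qed
  moreover have "u = fill C t"
  proof (rule eq_fill[OF match rec zero])
    fix i c k assume "used u 6 i c k"
    hence "1 \<le> i" "i < N" "c < mult C i" "k < length (binary (a ! (i - 1)))"
      by (simp_all add: used_iff_slot[OF match rec] slot_def)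
    moreover from this have "i \<in> {1..N-1}" by auto
    ultimately show "num u i c k = of_bool (bit (t i c) k)" using num[of i c k] by (simp add: t_def)
  qed
  ultimately show "u \<in> (\<lambda>(C, t). fill C t) ` choices" by force
qed

lemma card_certs: "card certs = skew_schubert_code w v (\<lambda>i. a ! (i - 1))"
proof -
  have "certs = (\<lambda>(C, t). fill C t) ` choices"
    using certs_subset_fill fill_in_certs by auto
  thus ?thesis using card_image[OF inj_fill] card_choices by simp
qed

end

section \<open>Membership of the evaluation problem in #P\<close>

lemma is_chain_bruhat_le: "is_chain N \<sigma> C \<pi> \<Longrightarrow> bruhat_le N \<sigma> \<pi>"
proof (induction N \<sigma> C \<pi> rule: is_chain.induct)
  case (2 N \<sigma> l \<rho> C \<pi>)
  hence "bruhat_le N \<rho> \<pi>" "labeled_edge N \<sigma> l \<rho>" by simp_all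
  thus ?case
    unfolding bruhat_le_def labeled_edge_def
    by (metis (mono_tags, lifting) converse_rtranclp_into_rtranclp cover_by_def)
qed (simp add: bruhat_le_def)

theorem theorem1p2:
  shows "string_function encode_instance skew_instances skew_value \<in> sharp_P"
proof -
  have "string_function encode_instance skew_instances skew_value x =
      card {u. (\<forall>p. u p \<le> poly cert_bound (length x)) \<and> (\<forall>p\<ge>poly cert_bound (length x). u p = 0) \<and>
        cert_ok (length x) (bit_at x) u}" (is "_ = card ?W") for x
  proof (cases "\<exists>v w a. instance_data v w a \<and> x = encode_instance (v, w, a)")
    case True
    then obtain v w a where inst: "instance_data v w a" and x: "x = encode_instance (v, w, a)" by blast
    interpret instance_data v w a by (rule inst)
    have "?W = certs" by (simp only: certs_def x Let_def)
    hence W: "card ?W = skew_value (v, w, a)" by (simp add: card_certs skew_value_def)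
    show ?thesis
    proof (cases "code_le v w")
      case True
      hence mem: "(v, w, a) \<in> skew_instances"
        using length_eq length_a by (simp add: skew_instances_def)
      hence "inv_into skew_instances encode_instance x = (v, w, a)"
        unfolding x by (rule inv_into_f_f[OF inj_on_encode_instance])
      moreover have "x \<in> encode_instance ` skew_instances" using mem x by blast
      ultimately show ?thesis by (simp only: string_function_def W if_True)
    next
      case False
      have "increasing_chains N \<sigma> \<pi> = {}"
        using False is_chain_bruhat_le unfolding increasing_chains_def code_le_def by blast
      hence "skew_value (v, w, a) = 0"
        by (simp add: skew_value_def skew_schubert_code_def skew_schubert_def)
      \<comment> \<open>The codes can be read off \<open>x\<close> uniquely, so no other triple with
        this encoding can satisfy the Bruhat condition.\<close>
      moreover have "x \<notin> encode_instance ` skew_instances"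
      proof
        assume "x \<in> encode_instance ` skew_instances"
        then obtain v' w' a' where 1: "x = encode_instance (v', w', a')" "length v' = length w'"
          "code_le v' w'" by (auto simp: skew_instances_def)
        hence "v = v' \<and> w = w'"
          using x length_eq by (auto simp: unary_append_eq concat_unary_append_eq)
        thus False using False 1 by simp
      qed
      ultimately show ?thesis by (simp add: string_function_def W)
    qed
  next
    case False
    have "x \<notin> encode_instance ` skew_instances"
    proof
      assume "x \<in> encode_instance ` skew_instances"
      then obtain v w a where "x = encode_instance (v, w, a)" "(v, w, a) \<in> skew_instances" by auto
      moreover from this have "instance_data v w a" by (simp add: skew_instances_def instance_data_def)
      ultimately show False using False by blast
    qed
    \<comment> \<open>An accepted certificate would itself provide a triple with encoding
      \<open>x\<close>.\<close>
    moreover have "\<not> cert_ok (length x) (bit_at x) u" for u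
      using False enc_ok_match instance_data.enc_ok_iff unfolding cert_ok_def by blast
    ultimately show ?thesis by (simp add: string_function_def)
  qed
  thus ?thesis using card_certificates_sharp_P[OF feasible_cert_ok] by presburger
qed

end
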